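(* In the combinatorial Marker-Cutter game with initial counter $g_0$, restricted Cutter has a strategy ensuring that the game reaches a game state of value at least $\frac43 g_0+2$.
   Context: A set of boundary cycles is a pair $(D,\chi)$: $D$ a finite directed graph each of whose components is a directed cycle (loops allowed, no isolated vertices), $\chi:E(D)\to L$ an edge labelling; proper if each label is used on at most two edges. A game state is $\gamma=(D,\chi,g)$ with $(D,\chi)$ proper, $g\in\mathbb N_0$; its value $v(\gamma)$ is the number of distinct labels used. Combinatorial Marker-Cutter game: start with $D_0$ empty, $\chi_0$ empty and counter $g_0\in\mathbb N$. At turn $k$ with state $(D_k,\chi_k,g_k)$, Marker chooses $v,w$ (not necessarily distinct) from $V(D_k)\sqcup\{v_\gamma,w_\gamma\}$ (dummy vertices; each chosen dummy vertex, without multiplicity, is added as a new vertex). Let $C,C'$ be the components containing $v,w$. Splitting a vertex $u$ replaces it by a source $u_1$ (incident to the out-edge) and a sink $u_2$ (incident to the in-edge). If $C=C'$: splitting turns $C$ into a directed path $P$ from $v_1$ to $w_2$ and a directed path $P'$ from $w_1$ to $v_2$ (trivial paths with $v_1=w_2$, $v_2=w_1$ if $v=w$ is dummy); new edges $f=\overrightarrow{w_2v_1}$, $f'=\overrightarrow{v_2w_1}$; $\hat C_1=P\cup\{f\}$, $\hat C_2=P'\cup\{f'\}$. Cutter chooses (a) $D_{k+1}=\bar D\cup\hat C_1\cup\hat C_2$, $g_{k+1}=g_k-1$ (only if $g_k\ge1$); (b) $D_{k+1}=\bar D\cup\hat C_1$, $g_{k+1}=\bar g$; (c) $D_{k+1}=\bar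 D\cup\hat C_2$, $g_{k+1}=\bar g$; with $\bar D$ a union of components of $D_k\setminus C$, $0\le\bar g\le g_k$. If $C\ne C'$: splitting turns $C$ into a path $P$ from $v_1$ to $v_2$ (trivial if $v$ dummy) and $C'$ into $P'$ from $w_1$ to $w_2$; the only move (d) is $D_{k+1}=(D_k\cup\hat C)\setminus(C\cup C')$ with $\hat C=P\cup P'\cup\{\overrightarrow{w_2v_1},\overrightarrow{v_2w_1}\}$, $g_{k+1}=g_k$. In all cases old labels are kept and the new edges receive one common new label not previously used. A contraction contracts one edge (deleting resulting isolated vertices). $(D',\chi',g')$ is a reduction of $(D,\chi,g)$ if $g'\le g$, $D'$ is obtained from $D$ by contractions and $\chi'=\chi$ on $E(D')$. Game states are equivalent if they are isomorphic as labelled digraphs up to a bijective relabelling and have equal counters. Restricted Cutter may never make a move producing a game state equivalent to a reduction of an earlier game state (including the current one), and in moves (a), (b), (c) must take $\bar D=D_k\setminus C$ and $\bar g=g_k$; if restricted Cutter has no legal move, the game ends. *)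

theory Defs
  imports Complex_Main "Graph_Theory.Graph_Theory"
begin

section \<open>Boundary cycles and game states\<close>

type_synonym dgraph = "(nat, nat) pre_digraph"

text \<open>The labelling is a total function; only its values on the arcs of the graph matter.\<close>

record gstate =
  graph :: dgraph
  labelling :: "nat \<Rightarrow> nat"
  counter :: nat

text \<open>Components are those of the underlying undirected graph, as full subgraphs.\<close>

definition component :: "dgraph \<Rightarrow> nat \<Rightarrow> dgraph" where
  "component G u = G \<restriction> {x. u \<rightarrow>\<^sup>*\<^bsub>with_proj (mk_symmetric G)\<^esub> x}"

definition components :: "dgraph \<Rightarrow> dgraph set" where
  "components G = component G ` verts G"

definition directed_cycle :: "dgraph \<Rightarrow> bool" where
  "directed_cycle G \<longleftrightarrow>
     (\<exists>p. pre_digraph.cycle G p \<and> arcs G = set p \<and> verts G = tail G ` set p)"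

definition boundary_cycles :: "dgraph \<Rightarrow> bool" where
  "boundary_cycles G \<longleftrightarrow> fin_digraph G \<and> (\<forall>K \<in> components G. directed_cycle K)"

definition proper_labelling :: "dgraph \<Rightarrow> (nat \<Rightarrow> nat) \<Rightarrow> bool" where
  "proper_labelling G \<chi> \<longleftrightarrow> (\<forall>l. card {e \<in> arcs G. \<chi> e = l} \<le> 2)"

definition game_state :: "gstate \<Rightarrow> bool" where
  "game_state \<gamma> \<longleftrightarrow> boundary_cycles (graph \<gamma>) \<and> proper_labelling (graph \<gamma>) (labelling \<gamma>)"

definition labels :: "gstate \<Rightarrow> nat set" where
  "labels \<gamma> = labelling \<gamma> ` arcs (graph \<gamma>)"

definition state_value :: "gstate \<Rightarrow> nat" where
  "state_value \<gamma> = card (labels \<gamma>)"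

definition initial_state :: "nat \<Rightarrow> gstate" where
  "initial_state g =
     \<lparr> graph = \<lparr> verts = {}, arcs = {}, tail = (\<lambda>_. 0), head = (\<lambda>_. 0) \<rparr>,
       labelling = (\<lambda>_. 0), counter = g \<rparr>"


section \<open>Reductions and equivalence\<close>

text \<open>Contracting a loop deletes it. The vertex resulting from a contraction keeps the name of
  the tail of the contracted arc.\<close>

definition delete_isolated :: "dgraph \<Rightarrow> dgraph" where
  "delete_isolated G = G\<lparr> verts := {x \<in> verts G. \<exists>e \<in> arcs G. tail G e = x \<or> head G e = x} \<rparr>"

definition contract_arc :: "dgraph \<Rightarrow> nat \<Rightarrow> dgraph" where
  "contract_arc G e =
     (let m = (\<lambda>x. if x = head G e then tail G e else x)
      in delete_isolated
           \<lparr> verts = m ` verts G, arcs = arcs G - {e},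
             tail = (\<lambda>a. m (tail G a)), head = (\<lambda>a. m (head G a)) \<rparr>)"

definition contraction :: "dgraph \<Rightarrow> dgraph \<Rightarrow> bool" where
  "contraction G G' \<longleftrightarrow> (\<exists>e \<in> arcs G. G' = contract_arc G e)"

definition reduction_of :: "gstate \<Rightarrow> gstate \<Rightarrow> bool" where
  "reduction_of \<gamma>' \<gamma> \<longleftrightarrow>
     counter \<gamma>' \<le> counter \<gamma> \<and> contraction\<^sup>*\<^sup>* (graph \<gamma>) (graph \<gamma>') \<and>
     (\<forall>e \<in> arcs (graph \<gamma>'). labelling \<gamma>' e = labelling \<gamma> e)"

definition equivalent :: "gstate \<Rightarrow> gstate \<Rightarrow> bool" where
  "equivalent \<gamma> \<gamma>' \<longleftrightarrow>
     counter \<gamma> = counter \<gamma>' \<and>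
     (\<exists>h \<rho>. pre_digraph.digraph_isomorphism (graph \<gamma>) h \<and> graph \<gamma>' = app_iso h (graph \<gamma>) \<and>
        bij_betw \<rho> (labels \<gamma>) (labels \<gamma>') \<and>
        (\<forall>e \<in> arcs (graph \<gamma>). labelling \<gamma>' (iso_arcs h e) = \<rho> (labelling \<gamma> e)))"


section \<open>Moves\<close>

text \<open>Marker chooses a pair of natural numbers. A chosen number that is not a vertex of the current
  graph stands for a dummy vertex: two different ones for the two different dummies, one
  repeated number for the choice of a single dummy. Hence every pair is a possible choice.\<close>

definition with_dummies :: "dgraph \<Rightarrow> nat \<Rightarrow> nat \<Rightarrow> dgraph" where
  "with_dummies G v w = G\<lparr> verts := verts G \<union> {v, w} \<rparr>"

text \<open>The source is \<open>u\<^sub>1\<close>, the sink \<open>u\<^sub>2\<close>. Taking \<open>u\<^sub>1 = u\<^sub>2\<close> only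
  renames \<open>u\<close>; this is used for dummy vertices.\<close>

definition split_vertex :: "nat \<Rightarrow> nat \<Rightarrow> nat \<Rightarrow> dgraph \<Rightarrow> dgraph" where
  "split_vertex u u\<^sub>1 u\<^sub>2 G =
     \<lparr> verts = (verts G - {u}) \<union> {u\<^sub>1, u\<^sub>2}, arcs = arcs G,
       tail = (\<lambda>e. if tail G e = u then u\<^sub>1 else tail G e),
       head = (\<lambda>e. if head G e = u then u\<^sub>2 else head G e) \<rparr>"

text \<open>\<open>opened G v w v\<^sub>1 v\<^sub>2 w\<^sub>1 w\<^sub>2 H\<close>: \<open>H\<close> arises from \<open>G\<close>, with the dummies
  added, by splitting \<open>v\<close> and \<open>w\<close>. If \<open>v = w\<close>, then \<open>v\<close> is
  split for both roles: one path, from \<open>v\<^sub>1\<close> to \<open>w\<^sub>2\<close>, is the component of \<open>v\<close> cut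
  open at \<open>v\<close> (trivial for a dummy), and the other one, from \<open>w\<^sub>1\<close> to \<open>v\<^sub>2\<close>, is
  trivial. Exchanging these two paths would only exchange Cutter's options \<open>Keep_First\<close> and
  \<open>Keep_Second\<close> below.\<close>

inductive opened ::
  "dgraph \<Rightarrow> nat \<Rightarrow> nat \<Rightarrow> nat \<Rightarrow> nat \<Rightarrow> nat \<Rightarrow> nat \<Rightarrow> dgraph \<Rightarrow> bool"
  for G v w where
  two: "\<lbrakk> v \<noteq> w;
          {v\<^sub>1, v\<^sub>2, w\<^sub>1, w\<^sub>2} \<inter> verts (with_dummies G v w) = {}; {v\<^sub>1, v\<^sub>2} \<inter> {w\<^sub>1, w\<^sub>2} = {};
          v\<^sub>1 = v\<^sub>2 \<longleftrightarrow> v \<notin> verts G; w\<^sub>1 = w\<^sub>2 \<longleftrightarrow> w \<notin> verts G;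
          H = split_vertex w w\<^sub>1 w\<^sub>2 (split_vertex v v\<^sub>1 v\<^sub>2 (with_dummies G v w)) \<rbrakk>
        \<Longrightarrow> opened G v w v\<^sub>1 v\<^sub>2 w\<^sub>1 w\<^sub>2 H"
| one: "\<lbrakk> v = w;
          {v\<^sub>1, v\<^sub>2, w\<^sub>2} \<inter> verts (with_dummies G v w) = {}; v\<^sub>2 \<notin> {v\<^sub>1, w\<^sub>2}; w\<^sub>1 = v\<^sub>2;
          v\<^sub>1 = w\<^sub>2 \<longleftrightarrow> v \<notin> verts G;
          H = pre_digraph.add_vert (split_vertex v v\<^sub>1 w\<^sub>2 (with_dummies G v w)) v\<^sub>2 \<rbrakk>
        \<Longrightarrow> opened G v w v\<^sub>1 v\<^sub>2 w\<^sub>1 w\<^sub>2 H"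

definition add_edge :: "dgraph \<Rightarrow> nat \<Rightarrow> nat \<Rightarrow> nat \<Rightarrow> dgraph" where
  "add_edge G e x y =
     G\<lparr> arcs := insert e (arcs G), tail := (tail G)(e := x), head := (head G)(e := y) \<rparr>"

text \<open>Union of two disjoint graphs. The library's union takes the incidence functions of its first
  argument and is only meant for graphs having the same ones.\<close>

definition disjoint_union :: "dgraph \<Rightarrow> dgraph \<Rightarrow> dgraph" (infixl \<open>\<squnion>\<^sub>D\<close> 65) where
  "G \<squnion>\<^sub>D H =
     \<lparr> verts = verts G \<union> verts H, arcs = arcs G \<union> arcs H,
       tail = (\<lambda>e. if e \<in> arcs G then tail G e else tail H e),
       head = (\<lambda>e. if e \<in> arcs G then head G e else head H e) \<rparr>"

definition union_of_components :: "dgraph \<Rightarrow> dgraph \<Rightarrow> bool" where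
  "union_of_components B G \<longleftrightarrow> (\<exists>\<K> \<subseteq> components G. B = G \<restriction> (\<Union>K \<in> \<K>. verts K))"

text \<open>The arguments are what Cutter keeps of the rest of the graph and, if only one of the two new
  cycles is kept, of the counter.\<close>

datatype cutter_choice =
    Keep_Both dgraph
  | Keep_First dgraph nat
  | Keep_Second dgraph nat
  | Merge

text \<open>The first argument lists all game states so far, the current one last. The names of the new
  vertices, of the two new arcs and the new label are arbitrary, subject to freshness.\<close>

definition cutter_move ::
  "gstate list \<Rightarrow> nat \<times> nat \<Rightarrow> cutter_choice \<Rightarrow> gstate \<Rightarrow> bool" where
  "cutter_move hist = (\<lambda>(v, w) c \<gamma>'.
     let \<gamma> = last hist; D = graph \<gamma>; g = counter \<gamma>;
         C = component (with_dummies D v w) v;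
         C' = component (with_dummies D v w) w;
         R = D \<restriction> (verts D - verts C)
     in \<exists>v\<^sub>1 v\<^sub>2 w\<^sub>1 w\<^sub>2 H f f' l.
          opened D v w v\<^sub>1 v\<^sub>2 w\<^sub>1 w\<^sub>2 H \<and>
          f \<noteq> f' \<and> f \<notin> arcs D \<and> f' \<notin> arcs D \<and>
          (\<forall>\<delta> \<in> set hist. l \<notin> labels \<delta>) \<and>
          labelling \<gamma>' = (labelling \<gamma>)(f := l, f' := l) \<and>
          (let P = component H v\<^sub>1; P' = component H w\<^sub>1;
               C\<^sub>1 = add_edge P f w\<^sub>2 v\<^sub>1;
               C\<^sub>2 = add_edge P' f' v\<^sub>2 w\<^sub>1
           in case c of
                Keep_Both B \<Rightarrow> C = C' \<and> union_of_components B R \<and> g \<ge> 1 \<and>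
                  graph \<gamma>' = B \<squnion>\<^sub>D C\<^sub>1 \<squnion>\<^sub>D C\<^sub>2 \<and> counter \<gamma>' = g - 1
              | Keep_First B b \<Rightarrow> C = C' \<and> union_of_components B R \<and> b \<le> g \<and>
                  graph \<gamma>' = B \<squnion>\<^sub>D C\<^sub>1 \<and> counter \<gamma>' = b
              | Keep_Second B b \<Rightarrow> C = C' \<and> union_of_components B R \<and> b \<le> g \<and>
                  graph \<gamma>' = B \<squnion>\<^sub>D C\<^sub>2 \<and> counter \<gamma>' = b
              | Merge \<Rightarrow> C \<noteq> C' \<and>
                  graph \<gamma>' = (D \<restriction> (verts D - (verts C \<union> verts C')))
                               \<squnion>\<^sub>D add_edge (add_edge (P \<squnion>\<^sub>D P') f w\<^sub>2 v\<^sub>1) f' v\<^sub>2 w\<^sub>1 \<and>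
                  counter \<gamma>' = g))"

definition keeps_everything :: "gstate \<Rightarrow> nat \<times> nat \<Rightarrow> cutter_choice \<Rightarrow> bool" where
  "keeps_everything \<gamma> = (\<lambda>(v, w) c.
     let D = graph \<gamma>; R = D \<restriction> (verts D - verts (component (with_dummies D v w) v))
     in case c of
          Keep_Both B \<Rightarrow> B = R
        | Keep_First B b \<Rightarrow> B = R \<and> b = counter \<gamma>
        | Keep_Second B b \<Rightarrow> B = R \<and> b = counter \<gamma>
        | Merge \<Rightarrow> True)"

definition restricted_move :: "gstate list \<Rightarrow> nat \<times> nat \<Rightarrow> gstate \<Rightarrow> bool" where
  "restricted_move hist vw \<gamma>' \<longleftrightarrow>
     (\<exists>c. cutter_move hist vw c \<gamma>' \<and> keeps_everything (last hist) vw c) \<and>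
     \<not> (\<exists>\<gamma> \<in> set hist. \<exists>\<delta>. reduction_of \<delta> \<gamma> \<and> equivalent \<gamma>' \<delta>)"


section \<open>Strategies\<close>

text \<open>A strategy answers the states so far and Marker's current choice by a new state. It has to be
  legal whenever a legal answer exists; otherwise the game has ended and its answer is
  irrelevant.\<close>

type_synonym strategy = "gstate list \<Rightarrow> nat \<times> nat \<Rightarrow> gstate"

definition restricted_strategy :: "strategy \<Rightarrow> bool" where
  "restricted_strategy \<sigma> \<longleftrightarrow>
     (\<forall>hist vw. (\<exists>\<gamma>'. restricted_move hist vw \<gamma>') \<longrightarrow> restricted_move hist vw (\<sigma> hist vw))"

text \<open>The states after \<open>n\<close> turns if Marker chooses \<open>m k\<close> at turn \<open>k\<close>. As \<open>\<sigma>\<close> is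
  deterministic, sequences \<open>m\<close> also cover adaptive choices of Marker.\<close>

fun play :: "nat \<Rightarrow> strategy \<Rightarrow> (nat \<Rightarrow> nat \<times> nat) \<Rightarrow> nat \<Rightarrow> gstate list" where
  "play g \<sigma> m 0 = [initial_state g]"
| "play g \<sigma> m (Suc n) = play g \<sigma> m n @ [\<sigma> (play g \<sigma> m n) (m n)]"

text \<open>The condition on \<open>k < n\<close> says that the game has not ended before turn \<open>n\<close>.\<close>

definition ensures_value :: "nat \<Rightarrow> strategy \<Rightarrow> real \<Rightarrow> bool" where
  "ensures_value g \<sigma> t \<longleftrightarrow>
     (\<forall>m. \<exists>n. (\<forall>k < n. restricted_move (play g \<sigma> m k) (m k) (\<sigma> (play g \<sigma> m k) (m k))) \<and>
             game_state (last (play g \<sigma> m n)) \<and>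
             t \<le> real (state_value (last (play g \<sigma> m n))))"

end

theory Submission
  imports Defs "HOL-Library.Disjoint_Sets"
begin

text \<open>A reduction never has more labels than the original state, so every move that raises the value
  is legal. Cutter only makes such moves; then the value is the number of turns played, and it
  remains to see that every three moves (a) are accompanied by at least one other move, up to an
  additive constant. Call a label private to one of the two paths of a split cycle if all its
  occurrences lie on that path. If one of the paths has at most two edges and no private label,
  Cutter deletes it, which loses no label; otherwise Cutter plays (a). Hence each cycle has four
  edges unless it carries a label that is used only once or that was created with a dummy vertex,
  and a turn creates at most three labels of this kind. A label used only once counts for two edges
  in the sum of the lengths of the cycles, which is thus twice the number of labels. So twice the
  number of labels is at least four times the number of cycles, up to a deficit that is paid for by
  the moves other than (a). Together with the effect of the moves on the number of cycles (one more
  in (a), one less in (d)) this bounds the number of moves (a) when the counter is used up.\<close>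

section \<open>Digraphs partitioned into directed cycles\<close>

text \<open>Write n for the value, s for the number of cycles and a for
  \<open>g\<^sub>0 - g\<close>, the number of moves (a) made. Up to corrections, the budget is |K| +
  8a <= 4n + 4s. Move (a) raises n and s by one each, which explains the 8. A merger raises n and
  lowers s, so with equal coefficients it is neutral. A deletion gains 4 on the right and puts at
  most three labels into K, hence the limit of two edges for a deleted side. Conversely every cycle
  weighs about 4 when its edges, its once-used labels and its labels in K are added up, so 4s <= 2n
  + |K|. Eliminating s and |K| leaves 8a <= 6n, the source of 4/3. The additive constant is
  delicate: cycles with a single label may weigh only 3, which \<open>one_label_cycles\<close>
  corrects, and 8a + 12 <= 6n is needed when a side cannot be deleted. There 10 is the final
  \<open>bonus\<close>, and 2 is the excess of the requested cycle, each side of which weighs at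
  least 3. The bound of four edges rests on the fact that splitting and reconnecting never makes two
  old edges adjacent: once two edges with a common label are apart, they stay apart.\<close>

declare pre_digraph.cas.simps [simp]

lemma cas_append_iff:
  "pre_digraph.cas G u (p @ q) v \<longleftrightarrow> (\<exists>x. pre_digraph.cas G u p x \<and> pre_digraph.cas G x q v)"
  by (induction p arbitrary: u) auto

lemma cas_cong:
  assumes "\<forall>e \<in> set p. tail G e = tail G' e \<and> head G e = head G' e"
  shows "pre_digraph.cas G u p v \<longleftrightarrow> pre_digraph.cas G' u p v"
  using assms by (induction p arbitrary: u) auto

lemma cas_verts:
  assumes "pre_digraph.cas G u p v"
  shows "insert v (tail G ` set p) = insert u (head G ` set p)"
  using assms
proof (induction p arbitrary: u)
  case (Cons e p)
  then show ?case by simp blast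
qed auto

text \<open>For a closed walk both insertions in \<open>cas_verts\<close> add the same vertex u, and
  on a nonempty walk u is already a tail and a head.\<close>

lemma cas_closed_heads:
  assumes "pre_digraph.cas G u p u"
  shows "head G ` set p = tail G ` set p"
proof (cases p rule: rev_cases)
  case (snoc q e)
  then have h: "u \<in> head G ` set p"
    using assms by (auto simp: cas_append_iff)
  have "u \<in> tail G ` set p"
    using assms snoc by (metis append_is_Nil_conv image_eqI list.set_sel(1) not_Cons_self2 pre_digraph.cas_simp)
  with h cas_verts[OF assms] show ?thesis by (metis insert_absorb)
qed auto

definition cycle_arcs :: "dgraph \<Rightarrow> nat set \<Rightarrow> bool" where
  "cycle_arcs G S \<longleftrightarrow> (\<exists>u p. p \<noteq> [] \<and> distinct p \<and> set p = S \<and> pre_digraph.cas G u p u)"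

text \<open>Injectivity of the tail map gives every vertex exactly one outgoing arc, so cycles are
  determined by their arc sets and moves become set operations on \<open>\<S>\<close>. Injectivity
  of the head map then follows by counting.\<close>

definition cycle_partition :: "dgraph \<Rightarrow> nat set set \<Rightarrow> bool" where
  "cycle_partition G \<S> \<longleftrightarrow> finite \<S> \<and> disjoint \<S> \<and> arcs G = \<Union>\<S> \<and> verts G = tail G ` arcs G \<and>
     inj_on (tail G) (arcs G) \<and> (\<forall>S \<in> \<S>. cycle_arcs G S)"

lemma cycle_arcs_rotate:
  assumes "cycle_arcs G S" "e \<in> S"
  obtains p where "distinct (e # p)" "set (e # p) = S"
    "pre_digraph.cas G (tail G e) (e # p) (tail G e)"
proof -
  obtain u p where p: "p \<noteq> []" "distinct p" "set p = S" "pre_digraph.cas G u p u"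
    using assms(1) unfolding cycle_arcs_def by blast
  with assms(2) obtain xs ys where "p = xs @ e # ys" by (metis split_list)
  with p have "distinct (e # (ys @ xs))" "set (e # (ys @ xs)) = S"
    "pre_digraph.cas G (tail G e) (e # (ys @ xs)) (tail G e)"
    by (auto simp: cas_append_iff)
  then show thesis by (rule that)
qed

lemma cycle_arcs_heads:
  assumes "cycle_arcs G S"
  shows "head G ` S = tail G ` S"
proof -
  obtain u p where "set p = S" "pre_digraph.cas G u p u"
    using assms unfolding cycle_arcs_def by blast
  then show ?thesis using cas_closed_heads by metis
qed

lemma cycle_arcs_finite: "cycle_arcs G S \<Longrightarrow> finite S"
  unfolding cycle_arcs_def by auto

lemma cycle_arcs_nonempty: "cycle_arcs G S \<Longrightarrow> S \<noteq> {}"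
  unfolding cycle_arcs_def by auto

text \<open>Heads and tails of a closed walk form the same finite set, so the head map has as many
  values as the injective tail map.\<close>

lemma cycle_arcs_inj_head:
  assumes "cycle_arcs G S" "inj_on (tail G) S"
  shows "inj_on (head G) S"
  by (metis assms cycle_arcs_finite cycle_arcs_heads card_image eq_card_imp_inj_on)

lemma cycle_partition_arcs: "cycle_partition G \<S> \<Longrightarrow> arcs G = \<Union>\<S>"
  unfolding cycle_partition_def by blast

lemma cycle_partition_finite_arcs: "cycle_partition G \<S> \<Longrightarrow> finite (arcs G)"
  unfolding cycle_partition_def by (metis cycle_arcs_finite finite_Union)

lemma cycle_partition_wf:
  assumes "cycle_partition G \<S>"
  shows "wf_digraph G"
proof
  fix e assume e: "e \<in> arcs G"
  then show "tail G e \<in> verts G" using assms unfolding cycle_partition_def by simp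
  from e obtain S where "S \<in> \<S>" "e \<in> S" using assms unfolding cycle_partition_def by auto
  then have "head G e \<in> tail G ` S" 
    using assms cycle_arcs_heads unfolding cycle_partition_def by blast
  then show "head G e \<in> verts G"
    using assms \<open>S \<in> \<S>\<close> unfolding cycle_partition_def by auto
qed

lemma cycle_partition_tail_unique:
  assumes "cycle_partition G \<S>" "S \<in> \<S>" "e \<in> arcs G" "tail G e \<in> tail G ` S"
  shows "e \<in> S"
proof -
  from assms(4) obtain e' where "e' \<in> S" "tail G e = tail G e'" by auto
  then show ?thesis using assms unfolding cycle_partition_def by (metis Union_iff inj_onD)
qed

text \<open>The head of an arc is the tail of an arc of the same cycle, which reduces the claim to
  uniqueness by tails.\<close>

lemma cycle_partition_head_unique:
  assumes "cycle_partition G \<S>" "S \<in> \<S>" "e \<in> arcs G" "head G e \<in> tail G ` S"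
  shows "e \<in> S"
proof -
  obtain T where T: "T \<in> \<S>" "e \<in> T" using assms unfolding cycle_partition_def by auto
  then have "head G e \<in> tail G ` T" using assms(1) cycle_arcs_heads unfolding cycle_partition_def by blast
  then obtain e1 where e1: "e1 \<in> T" "head G e = tail G e1" by auto
  then have "e1 \<in> S" using assms cycle_partition_tail_unique T
    by (metis UnionI cycle_partition_def)
  with e1 T assms(1,2) have "S = T" unfolding cycle_partition_def disjoint_def by blast
  with T show ?thesis by simp
qed

lemma cycle_partition_inj_head:
  assumes "cycle_partition G \<S>"
  shows "inj_on (head G) (arcs G)"
proof (rule inj_onI)
  fix e e' assume e: "e \<in> arcs G" "e' \<in> arcs G" "head G e = head G e'"
  then obtain T where T: "T \<in> \<S>" "e \<in> T" using assms unfolding cycle_partition_def by auto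
  then have cyc: "cycle_arcs G T" using assms unfolding cycle_partition_def by simp
  with T e have "e' \<in> T"
    using cycle_partition_head_unique[OF assms T(1) e(2)] cycle_arcs_heads by (metis imageI)
  moreover have "inj_on (tail G) T"
    using assms T unfolding cycle_partition_def by (metis Union_upper inj_on_subset)
  ultimately show "e = e'" using cycle_arcs_inj_head[OF cyc] T e by (metis inj_onD)
qed

section \<open>Components along walks and cycles\<close>

lemma symmetric_reachable_walk:
  assumes "a \<rightarrow>\<^sup>*\<^bsub>with_proj (mk_symmetric G)\<^esub> u" "pre_digraph.cas G u p z" "set p \<subseteq> arcs G"
    "insert z (tail G ` set p) \<subseteq> verts G" "x \<in> insert z (tail G ` set p)"
  shows "a \<rightarrow>\<^sup>*\<^bsub>with_proj (mk_symmetric G)\<^esub> x"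
  using assms
proof (induction p arbitrary: u)
  case (Cons e p)
  have e: "(u, head G e) \<in> parcs (mk_symmetric G)"
    using Cons.prems unfolding parcs_mk_symmetric by auto
  have "head G e \<in> insert z (tail G ` set p)"
    using Cons.prems(2) cas_verts[of G "head G e" p z] by auto
  then have "head G e \<in> verts G" using Cons.prems(4) by auto
  then have r: "a \<rightarrow>\<^sup>*\<^bsub>with_proj (mk_symmetric G)\<^esub> head G e"
    using Cons.prems(1) e unfolding reachable_def
    by (auto intro: rtrancl_on_into_rtrancl_on)
  show ?case
  proof (cases "x \<in> insert z (tail G ` set p)")
    case True
    then show ?thesis using Cons.IH[OF r] Cons.prems by auto
  next
    case False
    then have "x = u" using Cons.prems by auto
    then show ?thesis using Cons.prems(1) by simp
  qed
qed auto

text \<open>The walk makes its vertices reachable in the symmetrized graph, and by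
  \<open>sep\<close> no arc outside p leads out of them. The end z is listed separately so that the
  empty walk, whose component is one vertex, is included; on a nonempty closed walk it is
  redundant.\<close>

lemma component_of_walk:
  assumes walk: "pre_digraph.cas G u p z" "set p \<subseteq> arcs G" "insert z (tail G ` set p) \<subseteq> verts G"
    and sep: "\<forall>e \<in> arcs G - set p. tail G e \<notin> insert z (tail G ` set p) \<and> head G e \<notin> insert z (tail G ` set p)"
  shows "component G u = G \<restriction> insert z (tail G ` set p)"
    and "arcs (component G u) = set p"
proof -
  let ?V = "insert z (tail G ` set p)"
  have V: "?V = insert u (head G ` set p)" using cas_verts[OF walk(1)] .
  have u: "u \<in> ?V" unfolding V by simp
  have "x \<in> ?V" if "u \<rightarrow>\<^sup>*\<^bsub>with_proj (mk_symmetric G)\<^esub> x" for x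
    using that unfolding reachable_def
  proof (induction rule: rtrancl_on_induct)
    case base
    then show ?case using u by blast
  next
    case (step y x)
    then obtain e where e: "e \<in> arcs G"
      "y = tail G e \<and> x = head G e \<or> y = head G e \<and> x = tail G e"
      by (auto simp: parcs_mk_symmetric)
    then have "e \<in> set p" using sep step by blast
    moreover have "tail G e \<in> ?V" "head G e \<in> ?V" if "e \<in> set p" for e
      using that V by auto
    ultimately show ?case using e(2) by metis
  qed
  moreover have "u \<rightarrow>\<^sup>*\<^bsub>with_proj (mk_symmetric G)\<^esub> u"
    using walk u unfolding reachable_def by auto
  ultimately have "{x. u \<rightarrow>\<^sup>*\<^bsub>with_proj (mk_symmetric G)\<^esub> x} = ?V"
    using symmetric_reachable_walk[OF _ walk] by blast
  then show *: "component G u = G \<restriction> ?V" unfolding component_def by simp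
  have "tail G e \<in> ?V \<and> head G e \<in> ?V" if "e \<in> set p" for e
    using that V by auto
  then show "arcs (component G u) = set p"
    unfolding * using sep walk(2) by auto
qed

lemma component_of_cycle:
  assumes "cycle_partition G \<S>" "S \<in> \<S>" "u \<in> tail G ` S"
  shows "component G u = G \<restriction> (tail G ` S)" "arcs (component G u) = S"
proof -
  obtain e where e: "e \<in> S" "u = tail G e" using assms(3) by auto
  have "cycle_arcs G S" using assms unfolding cycle_partition_def by simp
  then obtain p where p: "distinct (e # p)" "set (e # p) = S" "pre_digraph.cas G u (e # p) u"
    using cycle_arcs_rotate[of G S e] e by metis
  have V: "insert u (tail G ` set (e # p)) = tail G ` S" using p(2) e by auto
  have 1: "set (e # p) \<subseteq> arcs G"
    unfolding p(2) using assms unfolding cycle_partition_def by auto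
  have 2: "insert u (tail G ` set (e # p)) \<subseteq> verts G"
    unfolding V using assms unfolding cycle_partition_def by auto
  have 3: "\<forall>a \<in> arcs G - set (e # p). tail G a \<notin> insert u (tail G ` set (e # p)) \<and>
      head G a \<notin> insert u (tail G ` set (e # p))"
    unfolding V p(2)
    using cycle_partition_tail_unique[OF assms(1,2)] cycle_partition_head_unique[OF assms(1,2)] assms(3)
    by (auto simp: insert_absorb)
  show "component G u = G \<restriction> (tail G ` S)"
    using component_of_walk(1)[OF p(3) 1 2 3] by (simp only: V)
  show "arcs (component G u) = S"
    using component_of_walk(2)[OF p(3) 1 2 3] by (simp only: p(2))
qed

text \<open>Links the view by arc sets with the official notion; this certifies that the final state
  is a game state.\<close>

lemma cycle_partition_boundary_cycles:
  assumes "cycle_partition G \<S>"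
  shows "boundary_cycles G"
proof -
  have fin: "fin_digraph G"
    using assms cycle_partition_wf[OF assms] cycle_partition_finite_arcs[OF assms]
    by (intro wf_digraph.fin_digraphI) (auto simp: cycle_partition_def)
  have "directed_cycle (component G u)" if "u \<in> verts G" for u
  proof -
    have "u \<in> tail G ` \<Union>\<S>" using that assms unfolding cycle_partition_def by simp
    then obtain S e where S: "S \<in> \<S>" "e \<in> S" "u = tail G e" by blast
    then have "cycle_arcs G S" using assms unfolding cycle_partition_def by simp
    then obtain p where p: "distinct (e # p)" "set (e # p) = S" "pre_digraph.cas G u (e # p) u"
      using cycle_arcs_rotate[of G S e] S by metis
    let ?K = "component G u"
    have K: "?K = G \<restriction> (tail G ` S)" "arcs ?K = S"
      using component_of_cycle[OF assms S(1)] S by auto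
    have cas: "pre_digraph.cas ?K u (e # p) u"
      using p(3) cas_cong[of "e # p" G ?K] unfolding K(1) by (metis induce_subgraph_head induce_subgraph_tail)
    have "inj_on (head G) S"
      using cycle_partition_inj_head[OF assms] S assms
      by (metis Union_upper cycle_partition_def inj_on_subset)
    \<comment> \<open>The vertices visited after the start are the heads of the arcs, and their
      distinctness is what the notion of a cycle demands.\<close>
    then have "distinct (map (head ?K) (e # p))"
      using p unfolding distinct_map K(1) by simp
    then have "distinct (tl (pre_digraph.awalk_verts ?K u (e # p)))"
      unfolding pre_digraph.awalk_verts_conv'[OF cas] by simp
    moreover have "pre_digraph.awalk ?K u (e # p) u"
      unfolding pre_digraph.awalk_def using cas p(2) K S by auto
    ultimately have "pre_digraph.cycle ?K (e # p)"
      unfolding pre_digraph.cycle_def by blast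
    moreover have "verts ?K = tail ?K ` set (e # p)"
      unfolding p(2) K(1) by simp
    ultimately show ?thesis
      unfolding directed_cycle_def using K(2) p(2) by metis
  qed
  then show ?thesis
    using fin unfolding boundary_cycles_def components_def by auto
qed

section \<open>Assembling and removing cycles\<close>

lemma cycle_partition_single:
  assumes "p \<noteq> []" "distinct p" "arcs K = set p" "pre_digraph.cas K u p u"
    "inj_on (tail K) (set p)" "verts K = tail K ` set p"
  shows "cycle_partition K {set p}"
  using assms unfolding cycle_partition_def cycle_arcs_def by auto

lemma cycle_arcs_cong:
  assumes "\<forall>e \<in> S. tail G e = tail G' e \<and> head G e = head G' e"
  shows "cycle_arcs G S \<longleftrightarrow> cycle_arcs G' S"
  using assms cas_cong[of _ G G'] unfolding cycle_arcs_def by metis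

lemma cycle_partition_union:
  assumes "cycle_partition A \<A>" "cycle_partition B \<B>"
    "arcs A \<inter> arcs B = {}" "verts A \<inter> verts B = {}"
  shows "cycle_partition (A \<squnion>\<^sub>D B) (\<A> \<union> \<B>)"
proof -
  have A: "finite \<A>" "disjoint \<A>" "arcs A = \<Union>\<A>" "verts A = tail A ` arcs A"
     "inj_on (tail A) (arcs A)" "\<And>S. S \<in> \<A> \<Longrightarrow> cycle_arcs A S"
    and B: "finite \<B>" "disjoint \<B>" "arcs B = \<Union>\<B>" "verts B = tail B ` arcs B"
     "inj_on (tail B) (arcs B)" "\<And>S. S \<in> \<B> \<Longrightarrow> cycle_arcs B S"
    using assms unfolding cycle_partition_def by auto
  let ?G = "A \<squnion>\<^sub>D B"
  have t: "\<And>e. e \<in> arcs A \<Longrightarrow> tail ?G e = tail A e \<and> head ?G e = head A e"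
    "\<And>e. e \<in> arcs B \<Longrightarrow> tail ?G e = tail B e \<and> head ?G e = head B e"
    using assms(3) unfolding disjoint_union_def by auto
  have "disjoint (\<A> \<union> \<B>)"
    using A B assms(3) by (intro disjoint_union) auto
  moreover have "arcs ?G = \<Union>(\<A> \<union> \<B>)"
    using A B unfolding disjoint_union_def by auto
  moreover have "verts ?G = tail ?G ` arcs ?G"
  proof -
    have "tail ?G ` arcs ?G = tail ?G ` arcs A \<union> tail ?G ` arcs B"
      unfolding disjoint_union_def by auto
    also have "\<dots> = tail A ` arcs A \<union> tail B ` arcs B"
      using t by (simp cong: image_cong)
    finally show ?thesis using A B unfolding disjoint_union_def by auto
  qed
  moreover have "inj_on (tail ?G) (arcs ?G)"
  proof -
    have "inj_on (tail ?G) (arcs A)" using A(5) t inj_on_cong[of "arcs A" "tail ?G" "tail A"] by blast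
    moreover have "inj_on (tail ?G) (arcs B)" using B(5) t inj_on_cong[of "arcs B" "tail ?G" "tail B"] by blast
    moreover have "tail ?G ` arcs A = verts A" "tail ?G ` arcs B = verts B"
      using A(4) B(4) t by (auto simp: image_iff)
    ultimately have "inj_on (tail ?G) (arcs A \<union> arcs B)"
      using assms(4) unfolding inj_on_Un by auto
    then show ?thesis unfolding disjoint_union_def by simp
  qed
  moreover have "cycle_arcs ?G S" if "S \<in> \<A> \<union> \<B>" for S
  proof (cases "S \<in> \<A>")
    case True
    then have "\<forall>e \<in> S. tail A e = tail ?G e \<and> head A e = head ?G e"
      using A(3) t(1) by (metis UnionI)
    then show ?thesis using A(6)[OF True] cycle_arcs_cong by blast
  next
    case False
    then have "S \<in> \<B>" using that by simp
    then have "\<forall>e \<in> S. tail B e = tail ?G e \<and> head B e = head ?G e"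
      using B(3) t(2) by (metis UnionI)
    then show ?thesis using B(6)[OF \<open>S \<in> \<B>\<close>] cycle_arcs_cong by blast
  qed
  ultimately show ?thesis using A B unfolding cycle_partition_def by simp
qed

text \<open>A vertex of the removed cycles is a tail or a head only of their own arcs, so deleting
  the vertices deletes exactly these arcs.\<close>

lemma cycle_partition_restrict:
  assumes "cycle_partition G \<S>" "\<T> \<subseteq> \<S>"
  shows "cycle_partition (G \<restriction> (verts G - tail G ` \<Union>\<T>)) (\<S> - \<T>)"
    and "arcs (G \<restriction> (verts G - tail G ` \<Union>\<T>)) = \<Union>(\<S> - \<T>)"
proof -
  let ?R = "G \<restriction> (verts G - tail G ` \<Union>\<T>)"
  have P: "finite \<S>" "disjoint \<S>" "arcs G = \<Union>\<S>" "verts G = tail G ` arcs G"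
     "inj_on (tail G) (arcs G)" "\<And>S. S \<in> \<S> \<Longrightarrow> cycle_arcs G S"
    using assms unfolding cycle_partition_def by auto
  interpret wf_digraph G using cycle_partition_wf[OF assms(1)] .
  have U: "\<Union>\<T> \<inter> \<Union>(\<S> - \<T>) = {}"
  proof -
    have "S \<inter> T = {}" if "S \<in> \<T>" "T \<in> \<S> - \<T>" for S T
      using that assms(2) disjointD[OF P(2), of S T] by blast
    then show ?thesis by blast
  qed
  have U2: "\<Union>\<S> = \<Union>\<T> \<union> \<Union>(\<S> - \<T>)"
    using assms(2) by blast
  have tl: "tail G e \<in> tail G ` \<Union>\<T> \<longleftrightarrow> e \<in> \<Union>\<T>" if "e \<in> arcs G" for e
    using that assms(2) cycle_partition_tail_unique[OF assms(1)] by blast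
  have hd: "head G e \<in> tail G ` \<Union>\<T> \<longleftrightarrow> e \<in> \<Union>\<T>" if "e \<in> arcs G" for e
  proof
    assume "head G e \<in> tail G ` \<Union>\<T>"
    then show "e \<in> \<Union>\<T>" using that assms(2) cycle_partition_head_unique[OF assms(1)] by blast
  next
    assume "e \<in> \<Union>\<T>"
    then show "head G e \<in> tail G ` \<Union>\<T>" using assms(2) P(6) cycle_arcs_heads by blast
  qed
  show arcs: "arcs ?R = \<Union>(\<S> - \<T>)"
  proof -
    have "arcs ?R = {e \<in> arcs G. e \<notin> \<Union>\<T>}"
      using tl hd by auto
    then show ?thesis using U U2 P(3) by blast
  qed
  have "verts ?R = tail ?R ` arcs ?R"
    unfolding arcs using tl U U2 P(3,4) by auto
  moreover have "inj_on (tail ?R) (arcs ?R)"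
    using P(3,5) U2 unfolding arcs by (auto intro: inj_on_subset)
  moreover have "disjoint (\<S> - \<T>)" using P(2) by (meson Diff_subset pairwise_subset)
  moreover have "cycle_arcs ?R S" if "S \<in> \<S> - \<T>" for S
    using that P(6) cycle_arcs_cong[of S G ?R] by auto
  ultimately show "cycle_partition ?R (\<S> - \<T>)"
    using arcs P(1) unfolding cycle_partition_def by blast
qed

section \<open>Opening cycles\<close>

text \<open>An empty q stands for a trivial path. The end z is no tail on the walk, which keeps the
  tail map injective once an arc leaving z is added.\<close>

definition open_walk :: "dgraph \<Rightarrow> nat \<Rightarrow> nat list \<Rightarrow> nat \<Rightarrow> bool" where
  "open_walk H u q z \<longleftrightarrow> pre_digraph.cas H u q z \<and> distinct q \<and>
     component H u = H \<restriction> insert z (tail H ` set q) \<and> arcs (component H u) = set q \<and>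
     z \<notin> tail H ` set q \<and> inj_on (tail H) (set q)"

lemma open_walk_close:
  assumes "open_walk H u q z" "f \<notin> set q"
  shows "cycle_partition (add_edge (component H u) f z u) {insert f (set q)}"
proof -
  let ?K = "add_edge (component H u) f z u"
  have w: "pre_digraph.cas H u q z" "distinct q" "component H u = H \<restriction> insert z (tail H ` set q)"
    "arcs (component H u) = set q" "z \<notin> tail H ` set q" "inj_on (tail H) (set q)"
    using assms(1) unfolding open_walk_def by auto
  have t: "tail H e = tail ?K e \<and> head H e = head ?K e" if "e \<in> set q" for e
    using that assms(2) unfolding add_edge_def w(3) by auto
  then have "pre_digraph.cas ?K u q z" using w(1) cas_cong[of q H ?K] by blast
  then have "pre_digraph.cas ?K u (q @ [f]) u"
    unfolding cas_append_iff by (auto simp: add_edge_def)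
  moreover have f: "tail ?K f = z" by (simp add: add_edge_def)
  have im: "tail ?K ` set q = tail H ` set q" using t by (simp cong: image_cong)
  have "inj_on (tail ?K) (set q)" using w(6) t inj_on_cong[of "set q" "tail H" "tail ?K"] by blast
  then have "inj_on (tail ?K) (set (q @ [f]))"
    using f im w(5) assms(2) by simp
  moreover have "arcs ?K = set (q @ [f])" using w(4) by (simp add: add_edge_def)
  moreover have "verts ?K = insert z (tail H ` set q)"
    by (simp add: add_edge_def w(3))
  then have "verts ?K = tail ?K ` set (q @ [f])"
    using im f by simp
  ultimately have "cycle_partition ?K {set (q @ [f])}"
    using w(2) assms(2) by (intro cycle_partition_single) auto
  then show ?thesis by simp
qed

text \<open>The new cycle runs through q, \<open>f'\<close>, \<open>q'\<close> and f in this
  order.\<close>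

lemma open_walk_merge:
  assumes "open_walk H u q z" "open_walk H u' q' z'" "set q \<inter> set q' = {}"
    "insert z (tail H ` set q) \<inter> insert z' (tail H ` set q') = {}"
    "f \<noteq> f'" "f \<notin> set q \<union> set q'" "f' \<notin> set q \<union> set q'"
  shows "cycle_partition (add_edge (add_edge (component H u \<squnion>\<^sub>D component H u') f z' u) f' z u')
           {insert f (insert f' (set q \<union> set q'))}" (is "cycle_partition ?K _")
proof -
  have w: "pre_digraph.cas H u q z" "distinct q" "component H u = H \<restriction> insert z (tail H ` set q)"
    "arcs (component H u) = set q" "z \<notin> tail H ` set q" "inj_on (tail H) (set q)"
    using assms(1) unfolding open_walk_def by auto
  have w': "pre_digraph.cas H u' q' z'" "distinct q'" "component H u' = H \<restriction> insert z' (tail H ` set q')"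
    "arcs (component H u') = set q'" "z' \<notin> tail H ` set q'" "inj_on (tail H) (set q')"
    using assms(2) unfolding open_walk_def by auto
  have tc: "tail (component H u) = tail H" "head (component H u) = head H"
    "tail (component H u') = tail H" "head (component H u') = head H"
    using w(3) w'(3) by simp_all
  have t: "tail H e = tail ?K e \<and> head H e = head ?K e" if "e \<in> set q \<union> set q'" for e
    using that assms(6,7) by (auto simp: add_edge_def disjoint_union_def tc)
  have f: "tail ?K f = z'" "head ?K f = u" "tail ?K f' = z" "head ?K f' = u'"
    using assms(5) by (auto simp: add_edge_def)
  have "pre_digraph.cas ?K u q z" using w(1) t cas_cong[of q H ?K] by blast
  moreover have "pre_digraph.cas ?K u' q' z'" using w'(1) t cas_cong[of q' H ?K] by blast
  ultimately have "pre_digraph.cas ?K u (q @ [f'] @ q' @ [f]) u"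
    unfolding cas_append_iff using f by auto
  then have cas: "pre_digraph.cas ?K u (q @ [f'] @ q' @ [f]) u" .
  have im: "tail ?K ` set q = tail H ` set q" "tail ?K ` set q' = tail H ` set q'"
    using t by (simp_all cong: image_cong)
  have "inj_on (tail ?K) (set q)" "inj_on (tail ?K) (set q')"
    using w(6) w'(6) t inj_on_cong[of "set q" "tail H" "tail ?K"] inj_on_cong[of "set q'" "tail H" "tail ?K"]
    by blast+
  moreover have "tail ?K ` set q \<inter> tail ?K ` set q' = {}"
    using im assms(4) by auto
  ultimately have "inj_on (tail ?K) (set q \<union> set q')"
    unfolding inj_on_Un by blast
  then have "inj_on (tail ?K) (insert f (insert f' (set q \<union> set q')))"
    using f im w(5) w'(5) assms(4,5,6,7) by (auto simp: image_Un)
  then have inj: "inj_on (tail ?K) (set (q @ [f'] @ q' @ [f]))"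
    by (simp add: insert_commute Un_commute)
  moreover have "arcs ?K = set (q @ [f'] @ q' @ [f])"
    using w(4) w'(4) by (auto simp: add_edge_def disjoint_union_def)
  moreover have "verts ?K = tail ?K ` set (q @ [f'] @ q' @ [f])"
  proof -
    have "verts ?K = insert z (tail H ` set q) \<union> insert z' (tail H ` set q')"
      by (simp add: add_edge_def disjoint_union_def w(3) w'(3))
    then show ?thesis using im f by auto
  qed
  ultimately have "cycle_partition ?K {set (q @ [f'] @ q' @ [f])}"
    using w(2) w'(2) assms(3,5,6,7) cas by (intro cycle_partition_single) auto
  moreover have "set (q @ [f'] @ q' @ [f]) = insert f (insert f' (set q \<union> set q'))" by auto
  ultimately show ?thesis by simp
qed

text \<open>The tail of an arc moves along \<open>\<tau>\<close> and its head along \<open>\<eta>\<close> when the vertices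
  in \<open>X\<close> are split.\<close>

locale opened_graph =
  fixes D H :: dgraph and \<S> :: "nat set set" and X :: "nat set" and \<tau> \<eta> :: "nat \<Rightarrow> nat"
  assumes part: "cycle_partition D \<S>"
    and arcs_H: "arcs H = arcs D"
    and tail_H: "e \<in> arcs D \<Longrightarrow> tail H e = \<tau> (tail D e)"
    and head_H: "e \<in> arcs D \<Longrightarrow> head H e = \<eta> (head D e)"
    and inj_tau: "inj_on \<tau> (verts D)" and inj_eta: "inj_on \<eta> (verts D)"
    and sep: "\<lbrakk>x \<in> verts D; y \<in> verts D; \<tau> x = \<eta> y\<rbrakk> \<Longrightarrow> x = y \<and> x \<notin> X"
    and old: "\<lbrakk>x \<in> verts D; x \<notin> X\<rbrakk> \<Longrightarrow> \<tau> x = x \<and> \<eta> x = x"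
    and fresh: "\<lbrakk>x \<in> verts D; x \<in> X\<rbrakk> \<Longrightarrow> \<tau> x \<notin> verts D \<and> \<eta> x \<notin> verts D"
    and verts_H: "\<tau> ` verts D \<subseteq> verts H" "\<eta> ` verts D \<subseteq> verts H"
begin

sublocale wf_digraph D using cycle_partition_wf[OF part] .

text \<open>Only the first tail and the last head may be split. Interior vertices lie outside X,
  where \<open>\<tau>\<close> and \<open>\<eta>\<close> are the identity, so consecutive arcs still
  meet.\<close>

lemma cas_H:
  assumes "pre_digraph.cas D a q b" "q \<noteq> []" "set q \<subseteq> arcs D" "\<forall>e \<in> set (tl q). tail D e \<notin> X"
  shows "pre_digraph.cas H (\<tau> a) q (\<eta> b)"
  using assms
proof (induction q arbitrary: a)
  case (Cons e q)
  show ?case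
  proof (cases q)
    case Nil
    then show ?thesis using Cons.prems tail_H head_H by auto
  next
    case (Cons e' q')
    then have x: "head D e = tail D e'" "tail D e' \<in> verts D" "tail D e' \<notin> X"
      using Cons.prems by auto
    have "pre_digraph.cas H (\<tau> (head D e)) q (\<eta> b)"
      using Cons.prems Cons by (intro Cons.IH) auto
    then show ?thesis using Cons.prems tail_H head_H old[OF x(2,3)] x(1) by auto
  qed
qed simp

text \<open>As a and b are split, \<open>sep\<close> gives \<open>\<tau> a\<close> no incoming and
  \<open>\<eta> b\<close> no outgoing arc. With tails and heads in H still injective, no arc outside
  q touches the walk.\<close>

lemma open_walk_nontrivial:
  assumes q: "pre_digraph.cas D a q b" "q \<noteq> []" "distinct q" "set q \<subseteq> arcs D"
    and X: "a \<in> X" "b \<in> X" "\<forall>e \<in> set (tl q). tail D e \<notin> X"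
  shows "open_walk H (\<tau> a) q (\<eta> b)" "\<eta> b \<in> verts H"
proof -
  have cas: "pre_digraph.cas H (\<tau> a) q (\<eta> b)" using cas_H q X by blast
  have ab: "a \<in> verts D" "b \<in> verts D"
  proof -
    show "a \<in> verts D" using q by (cases q) auto
    have "b \<in> insert a (head D ` set q)" using cas_verts[OF q(1)] by blast
    then show "b \<in> verts D" using \<open>a \<in> verts D\<close> q(4) by auto
  qed
  then show b: "\<eta> b \<in> verts H" using verts_H by auto
  have inj: "inj_on (tail H) (arcs D)"
    using part inj_tau tail_H unfolding cycle_partition_def inj_on_def by (metis tail_in_verts)
  have V: "insert (\<eta> b) (tail H ` set q) = insert (\<tau> a) (head H ` set q)"
    using cas_verts[OF cas] .
  have no_b: "tail H e \<noteq> \<eta> b" if "e \<in> arcs D" for e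
    using sep[of "tail D e" b] that ab X tail_H by auto
  have no_a: "head H e \<noteq> \<tau> a" if "e \<in> arcs D" for e
    using sep[of a "head D e"] that ab X head_H by fastforce
  have tl: "tail H e \<notin> insert (\<eta> b) (tail H ` set q)" if "e \<in> arcs D - set q" for e
    using that no_b inj q(4) by (auto dest: inj_onD)
  have "inj_on (head H) (arcs D)"
    using cycle_partition_inj_head[OF part] inj_eta head_H unfolding inj_on_def by (metis head_in_verts)
  then have hd: "head H e \<notin> insert (\<tau> a) (head H ` set q)" if "e \<in> arcs D - set q" for e
    using that no_a q(4) by (auto dest: inj_onD)
  have sepH: "\<forall>e \<in> arcs H - set q. tail H e \<notin> insert (\<eta> b) (tail H ` set q) \<and>
       head H e \<notin> insert (\<eta> b) (tail H ` set q)"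
    using tl hd unfolding arcs_H V[symmetric] by blast
  have VH: "insert (\<eta> b) (tail H ` set q) \<subseteq> verts H"
  proof -
    have "tail H e \<in> verts H" if "e \<in> set q" for e
    proof -
      have "e \<in> arcs D" using that q(4) by blast
      then have "tail H e \<in> \<tau> ` verts D" using tail_H tail_in_verts by simp
      then show ?thesis using verts_H(1) by blast
    qed
    then show ?thesis using b by auto
  qed
  have "set q \<subseteq> arcs H" using q(4) arcs_H by simp
  note comp = component_of_walk[OF cas this VH sepH]
  have "\<eta> b \<notin> tail H ` set q"
  proof
    assume "\<eta> b \<in> tail H ` set q"
    then obtain e where "e \<in> set q" "tail H e = \<eta> b" by force
    then show False using no_b[of e] q(4) by blast
  qed
  moreover have "inj_on (tail H) (set q)" using inj q(4) by (rule inj_on_subset)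
  ultimately show "open_walk H (\<tau> a) q (\<eta> b)"
    using cas q(3) comp unfolding open_walk_def by blast
qed

lemma open_walk_trivial:
  assumes "u \<in> verts H" "u \<notin> \<tau> ` verts D" "u \<notin> \<eta> ` verts D"
  shows "open_walk H u [] u"
proof -
  have *: "\<forall>e \<in> arcs H - set []. tail H e \<notin> insert u (tail H ` set []) \<and> head H e \<notin> insert u (tail H ` set [])"
    using assms tail_H head_H arcs_H by (auto simp: image_iff)
  show ?thesis
    using component_of_walk[of H u "[]" u] * assms unfolding open_walk_def by auto
qed

text \<open>A common value of \<open>\<tau>\<close> and \<open>\<eta>\<close> comes from one unsplit
  vertex, so splitting may separate two arcs but never brings them together.\<close>

lemma adjacent_H:
  assumes "e \<in> arcs D" "e' \<in> arcs D" "head H e = tail H e'"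
  shows "head D e = tail D e'"
  using assms sep[of "tail D e'" "head D e"] tail_H head_H by auto

lemma ends_H_old:
  assumes "e \<in> arcs D" "tail D e \<notin> X" "head D e \<notin> X"
  shows "tail H e = tail D e \<and> head H e = head D e"
  using assms old tail_H head_H by simp

text \<open>A tail in H is a new vertex if the old one was split, and otherwise it is unchanged and
  thus a tail of S.\<close>

lemma tail_H_disjoint:
  assumes "Q \<subseteq> S" "S \<subseteq> arcs D" 
  shows "tail H ` Q \<inter> (verts D - tail D ` S) = {}"
proof -
  have "tail H e \<notin> verts D - tail D ` S" if "e \<in> Q" for e
    using that assms old[of "tail D e"] fresh[of "tail D e"] tail_H[of e] by (cases "tail D e \<in> X") auto
  then show ?thesis by blast
qed

end

text \<open>New vertices are numbers above all vertices and above v and w. At a dummy both maps take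
  the same value, because there \<open>opened\<close> asks for a mere renaming.\<close>

lemma opened_two:
  assumes part: "cycle_partition D \<S>" and "v \<noteq> w"
  obtains H \<tau> \<eta> where "opened D v w (\<tau> v) (\<eta> v) (\<tau> w) (\<eta> w) H" "opened_graph D H \<S> {v, w} \<tau> \<eta>"
    "\<tau> v = \<eta> v \<longleftrightarrow> v \<notin> verts D" "\<tau> w = \<eta> w \<longleftrightarrow> w \<notin> verts D"
    "{\<tau> v, \<eta> v} \<inter> {\<tau> w, \<eta> w} = {}" "{\<tau> v, \<eta> v, \<tau> w, \<eta> w} \<subseteq> verts H"
    "{\<tau> v, \<eta> v, \<tau> w, \<eta> w} \<inter> verts D = {}"
    "\<And>x. x \<noteq> v \<Longrightarrow> x \<noteq> w \<Longrightarrow> \<tau> x = x \<and> \<eta> x = x"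
proof -
  have fin: "finite (verts D)"
    using part cycle_partition_finite_arcs[OF part] unfolding cycle_partition_def by simp
  define N where "N = Suc (Max (insert v (insert w (verts D))))"
  have N: "x < N" if "x \<in> insert v (insert w (verts D))" for x
    unfolding N_def less_Suc_eq_le using fin that by (intro Max_ge) auto
  define \<tau> where "\<tau> = (id :: nat \<Rightarrow> nat)(v := N, w := N + 2)"
  define \<eta> where "\<eta> = (id :: nat \<Rightarrow> nat)(v := (if v \<in> verts D then N + 1 else N), w := (if w \<in> verts D then N + 3 else N + 2))"
  define H where "H = split_vertex w (\<tau> w) (\<eta> w) (split_vertex v (\<tau> v) (\<eta> v) (with_dummies D v w))"
  interpret wf_digraph D using cycle_partition_wf[OF part] .
  have te: "\<tau> v = N" "\<tau> w = N + 2" "\<eta> v = (if v \<in> verts D then N + 1 else N)"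
    "\<eta> w = (if w \<in> verts D then N + 3 else N + 2)"
    "\<And>x. x \<noteq> v \<Longrightarrow> x \<noteq> w \<Longrightarrow> \<tau> x = x \<and> \<eta> x = x"
    using assms(2) unfolding \<tau>_def \<eta>_def by auto
  have lt: "v < N" "w < N" "\<And>x. x \<in> verts D \<Longrightarrow> x < N" using N by auto
  have lt': "N \<notin> verts D" "Suc (Suc N) \<notin> verts D" "Suc (Suc (Suc N)) \<notin> verts D" "Suc N \<notin> verts D" "N + 1 \<notin> verts D" "N + 2 \<notin> verts D" "N + 3 \<notin> verts D"
    using lt(3) by fastforce+
  have op: "opened D v w (\<tau> v) (\<eta> v) (\<tau> w) (\<eta> w) H"
    using assms(2) lt(1,2) lt' unfolding te H_def
    by (intro opened.two) (auto simp: with_dummies_def)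
  have VH: "verts H = (verts D - {v, w}) \<union> {\<tau> v, \<eta> v, \<tau> w, \<eta> w}"
    using assms(2) lt(1,2) unfolding H_def te split_vertex_def with_dummies_def by auto
  have tH: "tail H e = \<tau> (tail D e)" "head H e = \<eta> (head D e)" for e
    using assms(2) lt(1,2) unfolding H_def te split_vertex_def with_dummies_def
    by (auto simp: te)
  have og: "opened_graph D H \<S> {v, w} \<tau> \<eta>"
  proof
    show "cycle_partition D \<S>" by fact
    show "arcs H = arcs D" unfolding H_def split_vertex_def with_dummies_def by simp
    show "inj_on \<tau> (verts D)"
      by (rule inj_onI) (use lt lt' assms(2) in \<open>auto simp: \<tau>_def fun_upd_def split: if_splits\<close>)
    show "inj_on \<eta> (verts D)"
      by (rule inj_onI) (use lt lt' assms(2) in \<open>auto simp: \<eta>_def fun_upd_def split: if_splits\<close>)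
    fix x assume x: "x \<in> verts D"
    show "\<tau> x = x \<and> \<eta> x = x" if "x \<notin> {v, w}" using that te by auto
    show "\<tau> x \<notin> verts D \<and> \<eta> x \<notin> verts D" if "x \<in> {v, w}"
      using that x te lt' by auto
    fix y assume y: "y \<in> verts D" "\<tau> x = \<eta> y"
    then show "x = y \<and> x \<notin> {v, w}"
      using x lt lt' assms(2) by (auto simp: \<tau>_def \<eta>_def fun_upd_def split: if_splits)
  next
    have "\<tau> x \<in> verts H \<and> \<eta> x \<in> verts H" if "x \<in> verts D" for x
      using that VH te(5)[of x] by (cases "x \<in> {v, w}") auto
    then show "\<tau> ` verts D \<subseteq> verts H" "\<eta> ` verts D \<subseteq> verts H" by blast+
  qed (use tH in \<open>simp_all\<close>)
  show thesis
  proof (rule that[OF op og])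
    show "{\<tau> v, \<eta> v, \<tau> w, \<eta> w} \<inter> verts D = {}" using lt' unfolding te by auto
  qed (use VH te in auto)
qed

text \<open>The extra vertex u plays both \<open>v\<^sub>2\<close> and \<open>w\<^sub>1\<close> and
  carries the trivial second path. The first path is the cycle cut open at v, or trivial as well for
  a dummy.\<close>

lemma opened_one:
  assumes part: "cycle_partition D \<S>"
  obtains H \<tau> \<eta> u where "opened D v v (\<tau> v) u u (\<eta> v) H" "opened_graph D H \<S> {v} \<tau> \<eta>"
    "\<tau> v = \<eta> v \<longleftrightarrow> v \<notin> verts D" "u \<notin> {\<tau> v, \<eta> v}" "{\<tau> v, \<eta> v, u} \<subseteq> verts H"
    "{\<tau> v, \<eta> v, u} \<inter> verts D = {}" "\<And>x. x \<noteq> v \<Longrightarrow> \<tau> x = x \<and> \<eta> x = x"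
proof -
  have fin: "finite (verts D)"
    using part cycle_partition_finite_arcs[OF part] unfolding cycle_partition_def by simp
  define N where "N = Suc (Max (insert v (verts D)))"
  have N: "x < N" if "x \<in> insert v (verts D)" for x
    unfolding N_def less_Suc_eq_le using fin that by (intro Max_ge) auto
  define \<tau> where "\<tau> = (id :: nat \<Rightarrow> nat)(v := N)"
  define \<eta> where "\<eta> = (id :: nat \<Rightarrow> nat)(v := (if v \<in> verts D then N + 1 else N))"
  define u where "u = N + 2"
  define H where "H = pre_digraph.add_vert (split_vertex v (\<tau> v) (\<eta> v) (with_dummies D v v)) u"
  interpret wf_digraph D using cycle_partition_wf[OF part] .
  have te: "\<tau> v = N" "\<eta> v = (if v \<in> verts D then N + 1 else N)"
    "\<And>x. x \<noteq> v \<Longrightarrow> \<tau> x = x \<and> \<eta> x = x"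
    unfolding \<tau>_def \<eta>_def by auto
  have lt: "v < N" "\<And>x. x \<in> verts D \<Longrightarrow> x < N" using N by auto
  have lt': "N \<notin> verts D" "Suc (Suc N) \<notin> verts D" "Suc (Suc (Suc N)) \<notin> verts D" "Suc N \<notin> verts D" "N + 1 \<notin> verts D" "N + 2 \<notin> verts D"
    using lt(2) by fastforce+
  have op: "opened D v v (\<tau> v) u u (\<eta> v) H"
    using lt(1) lt' unfolding te H_def u_def
    by (intro opened.one) (auto simp: with_dummies_def)
  have VH: "verts H = (verts D - {v}) \<union> {\<tau> v, \<eta> v, u}"
    using lt(1) unfolding H_def te split_vertex_def with_dummies_def pre_digraph.add_vert_def by auto
  have tH: "tail H e = \<tau> (tail D e)" "head H e = \<eta> (head D e)" for e
    using lt(1) unfolding H_def te split_vertex_def with_dummies_def pre_digraph.add_vert_def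
    by (auto simp: te)
  have og: "opened_graph D H \<S> {v} \<tau> \<eta>"
  proof
    show "cycle_partition D \<S>" by fact
    show "arcs H = arcs D" unfolding H_def split_vertex_def with_dummies_def pre_digraph.add_vert_def by simp
    show "inj_on \<tau> (verts D)"
      by (rule inj_onI) (use lt in \<open>auto simp: \<tau>_def fun_upd_def split: if_splits\<close>)
    show "inj_on \<eta> (verts D)"
      by (rule inj_onI) (use lt lt' in \<open>auto simp: \<eta>_def fun_upd_def split: if_splits\<close>)
    fix x assume x: "x \<in> verts D"
    show "\<tau> x = x \<and> \<eta> x = x" if "x \<notin> {v}" using that te by auto
    show "\<tau> x \<notin> verts D \<and> \<eta> x \<notin> verts D" if "x \<in> {v}"
      using that x te lt' by auto
    fix y assume y: "y \<in> verts D" "\<tau> x = \<eta> y"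
    then show "x = y \<and> x \<notin> {v}"
      using x lt lt' by (auto simp: \<tau>_def \<eta>_def fun_upd_def split: if_splits)
  next
    have "\<tau> x \<in> verts H \<and> \<eta> x \<in> verts H" if "x \<in> verts D" for x
      using that VH te(3)[of x] by (cases "x = v") auto
    then show "\<tau> ` verts D \<subseteq> verts H" "\<eta> ` verts D \<subseteq> verts H" by blast+
  qed (use tH in \<open>simp_all\<close>)
  show thesis
  proof (rule that[OF op og])
    show "{\<tau> v, \<eta> v, u} \<inter> verts D = {}" using lt' unfolding te u_def by auto
  qed (use VH te u_def in auto)
qed

section \<open>Moves that keep everything\<close>

text \<open>A restricted move without the ban on reductions, which is later settled by comparing
  values.\<close>

definition full_move :: "gstate list \<Rightarrow> nat \<times> nat \<Rightarrow> gstate \<Rightarrow> bool" where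
  "full_move hist vw \<gamma>' \<longleftrightarrow> (\<exists>c. cutter_move hist vw c \<gamma>' \<and> keeps_everything (last hist) vw c)"

text \<open>Used in contrapositive form: surviving arcs that are not adjacent remain so. Deleted and
  new arcs take no part in the comparison.\<close>

definition adjacency_reflecting :: "dgraph \<Rightarrow> dgraph \<Rightarrow> bool" where
  "adjacency_reflecting D G \<longleftrightarrow> (\<forall>e \<in> arcs D \<inter> arcs G. \<forall>e' \<in> arcs D \<inter> arcs G.
     head G e = tail G e' \<longrightarrow> head D e = tail D e')"

text \<open>Restricted Cutter keeps the whole rest, which has to be presented as the union of all
  its components.\<close>

lemma union_of_components_self:
  assumes "wf_digraph R"
  shows "union_of_components R R"
proof -
  interpret wf_digraph R by fact
  have "x \<in> verts R" if "u \<rightarrow>\<^sup>*\<^bsub>with_proj (mk_symmetric R)\<^esub> x" for u x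
    by (rule reachable_in_vertsE[OF that]) simp
  then have "verts K \<subseteq> verts R" if "K \<in> components R" for K
    using that unfolding components_def component_def by auto
  moreover have "u \<in> verts (component R u)" if "u \<in> verts R" for u
    using that unfolding component_def reachable_def by auto
  ultimately have "(\<Union>K \<in> components R. verts K) = verts R"
    unfolding components_def by blast
  moreover have "R \<restriction> verts R = R"
    by (intro pre_digraph.equality) auto
  ultimately show ?thesis unfolding union_of_components_def by (metis order_refl)
qed

lemma component_with_dummies:
  assumes "cycle_partition D \<S>" "S \<in> \<S>" "u \<in> tail D ` S"
  shows "component (with_dummies D v w) u = with_dummies D v w \<restriction> (tail D ` S)"
proof -
  let ?G = "with_dummies D v w"
  obtain e where e: "e \<in> S" "u = tail D e" using assms(3) by auto
  have "cycle_arcs D S" using assms unfolding cycle_partition_def by simp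
  then obtain p where p: "distinct (e # p)" "set (e # p) = S" "pre_digraph.cas D u (e # p) u"
    using cycle_arcs_rotate[of D S e] e by metis
  have G: "tail ?G = tail D" "head ?G = head D" "arcs ?G = arcs D" "verts D \<subseteq> verts ?G"
    unfolding with_dummies_def by auto
  have V: "insert u (tail ?G ` set (e # p)) = tail D ` S" using p(2) e unfolding G by auto
  have 0: "pre_digraph.cas ?G u (e # p) u" using p(3) cas_cong[of "e # p" D ?G] G by metis
  have 1: "set (e # p) \<subseteq> arcs ?G"
    unfolding p(2) using assms G(3) unfolding cycle_partition_def by auto
  have 2: "insert u (tail ?G ` set (e # p)) \<subseteq> verts ?G"
    unfolding V using assms G(4) unfolding cycle_partition_def by blast
  have 3: "\<forall>a \<in> arcs ?G - set (e # p). tail ?G a \<notin> insert u (tail ?G ` set (e # p)) \<and>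
      head ?G a \<notin> insert u (tail ?G ` set (e # p))"
    unfolding V unfolding p(2) G
    using cycle_partition_tail_unique[OF assms(1,2)] cycle_partition_head_unique[OF assms(1,2)] by blast
  show ?thesis
    using component_of_walk(1)[OF 0 1 2 3] by (simp only: V)
qed

lemma component_dummy:
  assumes "cycle_partition D \<S>" "u \<notin> verts D" "u \<in> {v, w}"
  shows "verts (component (with_dummies D v w) u) = {u}"
proof -
  let ?G = "with_dummies D v w"
  interpret wf_digraph D using cycle_partition_wf[OF assms(1)] .
  have "\<forall>a \<in> arcs ?G - set []. tail ?G a \<notin> insert u (tail ?G ` set []) \<and>
      head ?G a \<notin> insert u (tail ?G ` set [])"
    using assms(2) unfolding with_dummies_def by auto
  from component_of_walk(1)[OF _ _ _ this] show ?thesis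
    using assms(3) unfolding with_dummies_def by auto
qed

lemma open_walk_arcs_verts:
  assumes "open_walk H u q z"
  shows "arcs (component H u) = set q" "verts (component H u) = insert z (tail H ` set q)"
    "tail (component H u) = tail H" "head (component H u) = head H"
proof -
  have "component H u = H \<restriction> insert z (tail H ` set q)"
    using assms unfolding open_walk_def by blast
  then show "verts (component H u) = insert z (tail H ` set q)"
    "tail (component H u) = tail H" "head (component H u) = head H" by simp_all
  show "arcs (component H u) = set q" using assms unfolding open_walk_def by blast
qed

lemma keep_first_move:
  assumes "last hist = \<lparr>graph = D, labelling = \<chi>, counter = g\<rparr>"
    "opened D v w v\<^sub>1 v\<^sub>2 w\<^sub>1 w\<^sub>2 H"
    "f \<noteq> f'" "f \<notin> arcs D" "f' \<notin> arcs D" "\<forall>\<delta> \<in> set hist. l \<notin> labels \<delta>"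
    "component (with_dummies D v w) v = component (with_dummies D v w) w"
    "union_of_components B (D \<restriction> (verts D - verts (component (with_dummies D v w) v)))" "b \<le> g"
  shows "cutter_move hist (v, w) (Keep_First B b)
    \<lparr>graph = B \<squnion>\<^sub>D add_edge (component H v\<^sub>1) f w\<^sub>2 v\<^sub>1, labelling = \<chi>(f := l, f' := l), counter = b\<rparr>"
  unfolding cutter_move_def assms(1) Let_def prod.case cutter_choice.case gstate.select_convs
  by (intro exI[of _ v\<^sub>1] exI[of _ v\<^sub>2] exI[of _ w\<^sub>1] exI[of _ w\<^sub>2] exI[of _ H] exI[of _ f] exI[of _ f']
      exI[of _ l] conjI assms refl)

lemma keep_second_move:
  assumes "last hist = \<lparr>graph = D, labelling = \<chi>, counter = g\<rparr>"
    "opened D v w v\<^sub>1 v\<^sub>2 w\<^sub>1 w\<^sub>2 H"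
    "f \<noteq> f'" "f \<notin> arcs D" "f' \<notin> arcs D" "\<forall>\<delta> \<in> set hist. l \<notin> labels \<delta>"
    "component (with_dummies D v w) v = component (with_dummies D v w) w"
    "union_of_components B (D \<restriction> (verts D - verts (component (with_dummies D v w) v)))" "b \<le> g"
  shows "cutter_move hist (v, w) (Keep_Second B b)
    \<lparr>graph = B \<squnion>\<^sub>D add_edge (component H w\<^sub>1) f' v\<^sub>2 w\<^sub>1, labelling = \<chi>(f := l, f' := l), counter = b\<rparr>"
  unfolding cutter_move_def assms(1) Let_def prod.case cutter_choice.case gstate.select_convs
  by (intro exI[of _ v\<^sub>1] exI[of _ v\<^sub>2] exI[of _ w\<^sub>1] exI[of _ w\<^sub>2] exI[of _ H] exI[of _ f] exI[of _ f']
      exI[of _ l] conjI assms refl)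

lemma keep_both_move:
  assumes "last hist = \<lparr>graph = D, labelling = \<chi>, counter = g\<rparr>"
    "opened D v w v\<^sub>1 v\<^sub>2 w\<^sub>1 w\<^sub>2 H"
    "f \<noteq> f'" "f \<notin> arcs D" "f' \<notin> arcs D" "\<forall>\<delta> \<in> set hist. l \<notin> labels \<delta>"
    "component (with_dummies D v w) v = component (with_dummies D v w) w"
    "union_of_components B (D \<restriction> (verts D - verts (component (with_dummies D v w) v)))" "g \<ge> 1"
  shows "cutter_move hist (v, w) (Keep_Both B)
    \<lparr>graph = B \<squnion>\<^sub>D add_edge (component H v\<^sub>1) f w\<^sub>2 v\<^sub>1 \<squnion>\<^sub>D add_edge (component H w\<^sub>1) f' v\<^sub>2 w\<^sub>1,
      labelling = \<chi>(f := l, f' := l), counter = g - 1\<rparr>"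
  unfolding cutter_move_def assms(1) Let_def prod.case cutter_choice.case gstate.select_convs
  by (intro exI[of _ v\<^sub>1] exI[of _ v\<^sub>2] exI[of _ w\<^sub>1] exI[of _ w\<^sub>2] exI[of _ H] exI[of _ f] exI[of _ f']
      exI[of _ l] conjI assms refl)

lemma merge_move:
  assumes "last hist = \<lparr>graph = D, labelling = \<chi>, counter = g\<rparr>"
    "opened D v w v\<^sub>1 v\<^sub>2 w\<^sub>1 w\<^sub>2 H"
    "f \<noteq> f'" "f \<notin> arcs D" "f' \<notin> arcs D" "\<forall>\<delta> \<in> set hist. l \<notin> labels \<delta>"
    "component (with_dummies D v w) v \<noteq> component (with_dummies D v w) w"
  shows "cutter_move hist (v, w) Merge
    \<lparr>graph = (D \<restriction> (verts D - (verts (component (with_dummies D v w) v) \<union> verts (component (with_dummies D v w) w))))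
       \<squnion>\<^sub>D add_edge (add_edge (component H v\<^sub>1 \<squnion>\<^sub>D component H w\<^sub>1) f w\<^sub>2 v\<^sub>1) f' v\<^sub>2 w\<^sub>1,
      labelling = \<chi>(f := l, f' := l), counter = g\<rparr>"
  unfolding cutter_move_def assms(1) Let_def prod.case cutter_choice.case gstate.select_convs
  by (intro exI[of _ v\<^sub>1] exI[of _ v\<^sub>2] exI[of _ w\<^sub>1] exI[of _ w\<^sub>2] exI[of _ H] exI[of _ f] exI[of _ f']
      exI[of _ l] conjI assms refl)

section \<open>Graphs produced by a turn\<close>

context opened_graph
begin

lemma adjacency_reflecting_H:
  assumes "\<And>e. e \<in> arcs D \<Longrightarrow> e \<in> arcs G \<Longrightarrow> tail G e = tail H e \<and> head G e = head H e"
  shows "adjacency_reflecting D G"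
  unfolding adjacency_reflecting_def using assms adjacent_H by simp

lemma rest:
  assumes "\<T> \<subseteq> \<S>" "X \<inter> verts D \<subseteq> tail D ` \<Union>\<T>" "R = D \<restriction> (verts D - tail D ` \<Union>\<T>)"
  shows "cycle_partition R (\<S> - \<T>)" "arcs R = \<Union>(\<S> - \<T>)" "verts R = verts D - tail D ` \<Union>\<T>"
    "\<And>e. e \<in> arcs R \<Longrightarrow> tail R e = tail H e \<and> head R e = head H e" "arcs R \<subseteq> arcs D"
proof -
  show "cycle_partition R (\<S> - \<T>)" "arcs R = \<Union>(\<S> - \<T>)"
    using cycle_partition_restrict[OF part assms(1)] unfolding assms(3) by blast+
  show "verts R = verts D - tail D ` \<Union>\<T>" "arcs R \<subseteq> arcs D" unfolding assms(3) by auto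
  fix e assume "e \<in> arcs R"
  then have "e \<in> arcs D" "tail D e \<notin> X" "head D e \<notin> X"
    using assms(2) unfolding assms(3) by auto
  then show "tail R e = tail H e \<and> head R e = head H e"
    using ends_H_old unfolding assms(3) by simp
qed

lemma closed_walk_ends:
  assumes "open_walk H u q z" "f \<notin> set q" "e \<in> set q"
  shows "tail (add_edge (component H u) f z u) e = tail H e \<and> head (add_edge (component H u) f z u) e = head H e"
  using assms open_walk_arcs_verts(3,4)[OF assms(1)] unfolding add_edge_def by auto

text \<open>Covers both answers that keep one side, and is the first stage of the answer that keeps
  both.\<close>

lemma keep_closed_walk:
  assumes T: "\<T> \<subseteq> \<S>" "X \<inter> verts D \<subseteq> tail D ` \<Union>\<T>" "R = D \<restriction> (verts D - tail D ` \<Union>\<T>)"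
    and q: "open_walk H u q z" "set q \<subseteq> \<Union>\<T>" "z \<notin> verts D" "f \<notin> arcs D"
    and G: "G = R \<squnion>\<^sub>D add_edge (component H u) f z u"
  shows "cycle_partition G ((\<S> - \<T>) \<union> {insert f (set q)})" "adjacency_reflecting D G"
    "verts G = verts R \<union> insert z (tail H ` set q)" "arcs G = arcs R \<union> insert f (set q)"
    "\<And>e. e \<in> arcs D \<Longrightarrow> e \<in> arcs G \<Longrightarrow> tail G e = tail H e \<and> head G e = head H e"
proof -
  note R = rest[OF T]
  have TD: "\<Union>\<T> \<subseteq> arcs D" using T(1) part unfolding cycle_partition_def by auto
  have disj: "\<Union>\<T> \<inter> \<Union>(\<S> - \<T>) = {}"
  proof -
    have "S \<inter> T = {}" if "S \<in> \<T>" "T \<in> \<S> - \<T>" for S T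
      using that T(1) part disjointD[of \<S> S T] unfolding cycle_partition_def by blast
    then show ?thesis by blast
  qed
  let ?K = "add_edge (component H u) f z u"
  have f: "f \<notin> set q" using q TD by auto
  have K: "arcs ?K = insert f (set q)" "verts ?K = insert z (tail H ` set q)"
    using open_walk_arcs_verts[OF q(1)] unfolding add_edge_def by simp_all
  have a: "arcs R \<inter> arcs ?K = {}"
  proof -
    have "f \<notin> arcs R" using q(4) R(5) by blast
    moreover have "set q \<inter> arcs R = {}" unfolding R(2) using q(2) disj by blast
    ultimately show ?thesis unfolding K by blast
  qed
  have "tail H ` set q \<inter> verts R = {}"
    using tail_H_disjoint[OF q(2) TD] R(3) by simp
  then have b: "verts R \<inter> verts ?K = {}" using K q(3) R(3) by auto
  show "cycle_partition G ((\<S> - \<T>) \<union> {insert f (set q)})"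
    unfolding G by (rule cycle_partition_union[OF R(1) open_walk_close[OF q(1) f] a b])
  show "verts G = verts R \<union> insert z (tail H ` set q)" "arcs G = arcs R \<union> insert f (set q)"
    unfolding G disjoint_union_def K by auto
  show ends: "tail G e = tail H e \<and> head G e = head H e" if "e \<in> arcs D" "e \<in> arcs G" for e
  proof (cases "e \<in> arcs R")
    case True
    then show ?thesis using R(4) unfolding G disjoint_union_def by simp
  next
    case False
    then have "e \<in> set q" using that q(4) K unfolding G disjoint_union_def by auto
    then show ?thesis using False closed_walk_ends[OF q(1) f] unfolding G disjoint_union_def by simp
  qed
  then show "adjacency_reflecting D G" by (rule adjacency_reflecting_H)
qed

end

text \<open>\<open>\<T>\<close> collects the cycles touched by the request: two, one, or none,
  depending on the dummies. The walks q and r share out their arcs; which ends they connect differs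
  between a split and a merger.\<close>

locale turn =
  fixes hist :: "gstate list" and v w :: nat and \<S> :: "nat set set" and D :: dgraph and \<chi> g
    and v\<^sub>1 v\<^sub>2 w\<^sub>1 w\<^sub>2 H X \<tau> \<eta> \<T> q r f f' l
  assumes last: "last hist = \<lparr>graph = D, labelling = \<chi>, counter = g\<rparr>"
    and open_H: "opened D v w v\<^sub>1 v\<^sub>2 w\<^sub>1 w\<^sub>2 H"
    and og: "opened_graph D H \<S> X \<tau> \<eta>"
    and T: "\<T> \<subseteq> \<S>" "X \<inter> verts D \<subseteq> tail D ` \<Union>\<T>"
    and qr: "set q \<union> set r = \<Union>\<T>" "set q \<inter> set r = {}"
    and new: "f \<noteq> f'" "f \<notin> arcs D" "f' \<notin> arcs D" "\<forall>\<delta> \<in> set hist. l \<notin> labels \<delta>"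
begin

sublocale opened_graph D H \<S> X \<tau> \<eta> by (rule og)

abbreviation "C \<equiv> component (with_dummies D v w) v"
abbreviation "C' \<equiv> component (with_dummies D v w) w"
abbreviation "R \<equiv> D \<restriction> (verts D - verts C)"
abbreviation "\<chi>' \<equiv> \<chi>(f := l, f' := l)"

end

text \<open>A vertex chosen twice fits in with an empty r, a dummy chosen twice with both q and r
  empty.\<close>

locale same_turn = turn +
  assumes CC: "C = C'" "verts D - verts C = verts D - tail D ` \<Union>\<T>"
    and q: "open_walk H v\<^sub>1 q w\<^sub>2" and r: "open_walk H w\<^sub>1 r v\<^sub>2"
    and vd: "insert w\<^sub>2 (tail H ` set q) \<inter> insert v\<^sub>2 (tail H ` set r) = {}" "w\<^sub>2 \<notin> verts D" "v\<^sub>2 \<notin> verts D"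
begin

lemma R_eq: "R = D \<restriction> (verts D - tail D ` \<Union>\<T>)"
  using CC(2) by simp

lemma R_union: "union_of_components R R"
  using cycle_partition_wf[OF rest(1)[OF T R_eq]] by (rule union_of_components_self)

lemma keep_first:
  obtains G where "full_move hist (v, w) \<lparr>graph = G, labelling = \<chi>', counter = g\<rparr>"
    "cycle_partition G ((\<S> - \<T>) \<union> {insert f (set q)})" "adjacency_reflecting D G"
proof -
  let ?G = "R \<squnion>\<^sub>D add_edge (component H v\<^sub>1) f w\<^sub>2 v\<^sub>1"
  let ?\<gamma> = "\<lparr>graph = ?G, labelling = \<chi>', counter = g\<rparr>"
  have "cutter_move hist (v, w) (Keep_First R g) ?\<gamma>"
    by (rule keep_first_move[OF last open_H new CC(1) R_union order_refl])
  moreover have "keeps_everything (last hist) (v, w) (Keep_First R g)"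
    unfolding keeps_everything_def last by simp
  ultimately have "full_move hist (v, w) ?\<gamma>" unfolding full_move_def by blast
  moreover have "set q \<subseteq> \<Union>\<T>" using qr(1) by blast
  ultimately show thesis
    using that keep_closed_walk(1,2)[OF T R_eq q _ vd(2) new(2) refl] by blast
qed

lemma keep_second:
  obtains G where "full_move hist (v, w) \<lparr>graph = G, labelling = \<chi>', counter = g\<rparr>"
    "cycle_partition G ((\<S> - \<T>) \<union> {insert f' (set r)})" "adjacency_reflecting D G"
proof -
  let ?G = "R \<squnion>\<^sub>D add_edge (component H w\<^sub>1) f' v\<^sub>2 w\<^sub>1"
  let ?\<gamma> = "\<lparr>graph = ?G, labelling = \<chi>', counter = g\<rparr>"
  have "cutter_move hist (v, w) (Keep_Second R g) ?\<gamma>"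
    by (rule keep_second_move[OF last open_H new CC(1) R_union order_refl])
  moreover have "keeps_everything (last hist) (v, w) (Keep_Second R g)"
    unfolding keeps_everything_def last by simp
  ultimately have "full_move hist (v, w) ?\<gamma>" unfolding full_move_def by blast
  moreover have "set r \<subseteq> \<Union>\<T>" using qr(1) by blast
  ultimately show thesis
    using that keep_closed_walk(1,2)[OF T R_eq r _ vd(3) new(3) refl] by blast
qed

lemma keep_both:
  assumes "g \<ge> 1"
  obtains G where "full_move hist (v, w) \<lparr>graph = G, labelling = \<chi>', counter = g - 1\<rparr>"
    "cycle_partition G ((\<S> - \<T>) \<union> {insert f (set q), insert f' (set r)})" "adjacency_reflecting D G"
proof -
  let ?G1 = "R \<squnion>\<^sub>D add_edge (component H v\<^sub>1) f w\<^sub>2 v\<^sub>1"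
  let ?K = "add_edge (component H w\<^sub>1) f' v\<^sub>2 w\<^sub>1"
  let ?G = "?G1 \<squnion>\<^sub>D ?K"
  let ?\<gamma> = "\<lparr>graph = ?G, labelling = \<chi>', counter = g - 1\<rparr>"
  have "cutter_move hist (v, w) (Keep_Both R) ?\<gamma>"
    by (rule keep_both_move[OF last open_H new CC(1) R_union assms])
  moreover have "keeps_everything (last hist) (v, w) (Keep_Both R)"
    unfolding keeps_everything_def last by simp
  ultimately have m: "full_move hist (v, w) ?\<gamma>" unfolding full_move_def by blast
  have qs: "set q \<subseteq> \<Union>\<T>" and rs: "set r \<subseteq> \<Union>\<T>" using qr(1) by blast+
  note G1 = keep_closed_walk[OF T R_eq q qs vd(2) new(2) refl]
  note G2 = keep_closed_walk[OF T R_eq r rs vd(3) new(3) refl]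
  note R = rest[OF T R_eq]
  have TD: "\<Union>\<T> \<subseteq> arcs D" using T(1) part unfolding cycle_partition_def by auto
  have fr: "f' \<notin> set r" using rs TD new by auto
  have K: "arcs ?K = insert f' (set r)" "verts ?K = insert v\<^sub>2 (tail H ` set r)"
    using open_walk_arcs_verts[OF r] unfolding add_edge_def by simp_all
  have disj: "\<Union>\<T> \<inter> \<Union>(\<S> - \<T>) = {}"
  proof -
    have "S \<inter> T = {}" if "S \<in> \<T>" "T \<in> \<S> - \<T>" for S T
      using that T(1) part disjointD[of \<S> S T] unfolding cycle_partition_def by blast
    then show ?thesis by blast
  qed
  have a: "arcs ?G1 \<inter> arcs ?K = {}"
  proof -
    have "arcs R \<inter> set r = {}" using R(2) disj rs by blast
    moreover have "f' \<notin> arcs R" "f \<notin> set r" "f' \<notin> set q" using R(5) new qs rs TD by blast+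
    ultimately show ?thesis unfolding K G1(4) using qr(2) new(1) by blast
  qed
  have "tail H ` set r \<inter> verts R = {}"
    using tail_H_disjoint[OF rs TD] R(3) by simp
  then have b: "verts ?G1 \<inter> verts ?K = {}" unfolding K G1(3) using vd R(3) by blast
  have part_G: "cycle_partition ?G (((\<S> - \<T>) \<union> {insert f (set q)}) \<union> {insert f' (set r)})"
    by (rule cycle_partition_union[OF G1(1) open_walk_close[OF r fr] a b])
  have "adjacency_reflecting D ?G"
  proof (rule adjacency_reflecting_H)
    fix e assume e: "e \<in> arcs D" "e \<in> arcs ?G"
    show "tail ?G e = tail H e \<and> head ?G e = head H e"
    proof (cases "e \<in> arcs ?G1")
      case True
      moreover have "tail ?G e = tail ?G1 e \<and> head ?G e = head ?G1 e"
        unfolding disjoint_union_def[of ?G1] using True by simp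
      ultimately show ?thesis using G1(5)[OF e(1)] by simp
    next
      case False
      then have "tail ?G e = tail ?K e \<and> head ?G e = head ?K e" "e \<in> arcs ?K"
        using e(2) unfolding disjoint_union_def[of ?G1] by auto
      moreover from this have "e \<in> set r" using K e(1) new by auto
      ultimately show ?thesis using closed_walk_ends[OF r fr] by simp
    qed
  qed
  moreover have "((\<S> - \<T>) \<union> {insert f (set q)}) \<union> {insert f' (set r)} =
      (\<S> - \<T>) \<union> {insert f (set q), insert f' (set r)}" by blast
  ultimately show thesis using that m part_G by metis
qed

end

locale merge_turn = turn +
  assumes CC: "C \<noteq> C'" "verts D - (verts C \<union> verts C') = verts D - tail D ` \<Union>\<T>"
    and q: "open_walk H v\<^sub>1 q v\<^sub>2" and r: "open_walk H w\<^sub>1 r w\<^sub>2"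
    and vd: "insert v\<^sub>2 (tail H ` set q) \<inter> insert w\<^sub>2 (tail H ` set r) = {}" "w\<^sub>2 \<notin> verts D" "v\<^sub>2 \<notin> verts D"
begin

lemma merge:
  obtains G where "full_move hist (v, w) \<lparr>graph = G, labelling = \<chi>', counter = g\<rparr>"
    "cycle_partition G ((\<S> - \<T>) \<union> {insert f (insert f' (\<Union>\<T>))})" "adjacency_reflecting D G"
    "head G f = v\<^sub>1" "tail G f' = v\<^sub>2" "head G f' = w\<^sub>1" "tail G f = w\<^sub>2"
proof -
  let ?R = "D \<restriction> (verts D - (verts C \<union> verts C'))"
  let ?K = "add_edge (add_edge (component H v\<^sub>1 \<squnion>\<^sub>D component H w\<^sub>1) f w\<^sub>2 v\<^sub>1) f' v\<^sub>2 w\<^sub>1"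
  let ?G = "?R \<squnion>\<^sub>D ?K"
  let ?\<gamma> = "\<lparr>graph = ?G, labelling = \<chi>', counter = g\<rparr>"
  have "cutter_move hist (v, w) Merge ?\<gamma>"
    by (rule merge_move[OF last open_H new CC(1)])
  moreover have "keeps_everything (last hist) (v, w) Merge"
    unfolding keeps_everything_def last by simp
  ultimately have m: "full_move hist (v, w) ?\<gamma>" unfolding full_move_def by blast
  have R_eq: "?R = D \<restriction> (verts D - tail D ` \<Union>\<T>)" using CC(2) by simp
  have qs: "set q \<subseteq> \<Union>\<T>" and rs: "set r \<subseteq> \<Union>\<T>" using qr(1) by blast+
  note R = rest[OF T R_eq]
  have TD: "\<Union>\<T> \<subseteq> arcs D" using T(1) part unfolding cycle_partition_def by auto
  have disj: "\<Union>\<T> \<inter> \<Union>(\<S> - \<T>) = {}"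
  proof -
    have "S \<inter> T = {}" if "S \<in> \<T>" "T \<in> \<S> - \<T>" for S T
      using that T(1) part disjointD[of \<S> S T] unfolding cycle_partition_def by blast
    then show ?thesis by blast
  qed
  have fr: "f \<notin> set q \<union> set r" "f' \<notin> set q \<union> set r" using qr(1) TD new by auto
  have K: "arcs ?K = insert f (insert f' (\<Union>\<T>))"
    "verts ?K = insert v\<^sub>2 (tail H ` set q) \<union> insert w\<^sub>2 (tail H ` set r)"
    using open_walk_arcs_verts[OF q] open_walk_arcs_verts[OF r] qr(1)
    unfolding add_edge_def disjoint_union_def by auto
  have part_K: "cycle_partition ?K {insert f (insert f' (\<Union>\<T>))}"
    using open_walk_merge[OF q r qr(2) vd(1) new(1) fr] unfolding qr(1) .
  have a: "arcs ?R \<inter> arcs ?K = {}"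
    unfolding K using R(2,5) disj new by blast
  have "tail H ` set r \<inter> verts ?R = {}" "tail H ` set q \<inter> verts ?R = {}"
    using tail_H_disjoint[OF rs TD] tail_H_disjoint[OF qs TD] R(3) by simp_all
  then have b: "verts ?R \<inter> verts ?K = {}" unfolding K using vd R(3) by blast
  have part_G: "cycle_partition ?G ((\<S> - \<T>) \<union> {insert f (insert f' (\<Union>\<T>))})"
    by (rule cycle_partition_union[OF R(1) part_K a b])
  have notR: "f \<notin> arcs ?R" "f' \<notin> arcs ?R" using new by auto
  have "adjacency_reflecting D ?G"
  proof (rule adjacency_reflecting_H)
    fix e assume e: "e \<in> arcs D" "e \<in> arcs ?G"
    show "tail ?G e = tail H e \<and> head ?G e = head H e"
    proof (cases "e \<in> arcs ?R")
      case True
      moreover have "tail ?G e = tail ?R e \<and> head ?G e = head ?R e"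
        unfolding disjoint_union_def[of ?R] using True by simp
      ultimately show ?thesis using R(4) by simp
    next
      case False
      then have 1: "tail ?G e = tail ?K e \<and> head ?G e = head ?K e" "e \<in> arcs ?K"
        using e(2) unfolding disjoint_union_def[of ?R] by auto
      have "tail ?K e = tail H e \<and> head ?K e = head H e"
        using e(1) new open_walk_arcs_verts(3,4)[OF q] open_walk_arcs_verts(3,4)[OF r]
        unfolding add_edge_def disjoint_union_def by auto
      then show ?thesis using 1 by simp
    qed
  qed
  moreover have "head ?G f = v\<^sub>1" "tail ?G f' = v\<^sub>2" "head ?G f' = w\<^sub>1" "tail ?G f = w\<^sub>2"
    using notR new(1) unfolding disjoint_union_def[of ?R] add_edge_def by auto
  ultimately show thesis using that m part_G by metis
qed

end

context opened_graph
begin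

lemma inj_tail_H: "inj_on (tail H) (arcs D)"
  using part inj_tau tail_H unfolding cycle_partition_def inj_on_def by (metis tail_in_verts)

lemma tail_H_neq_eta:
  assumes "e \<in> arcs D" "b \<in> X" "b \<in> verts D"
  shows "tail H e \<noteq> \<eta> b"
  using sep[of "tail D e" b] assms tail_H by auto

lemma tail_H_images_disjoint:
  assumes "Q \<subseteq> arcs D" "Q' \<subseteq> arcs D" "Q \<inter> Q' = {}"
  shows "tail H ` Q \<inter> tail H ` Q' = {}"
  using assms inj_tail_H by (metis image_Int_subset image_empty inj_on_image_Int subset_empty)

text \<open>The cycle is rotated to start at its only split vertex, which leaves no split vertex in
  the interior.\<close>

lemma open_walk_at:
  assumes "S \<in> \<S>" "v \<in> X" "v \<in> tail D ` S" "X \<inter> tail D ` S \<subseteq> {v}"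
  obtains q where "set q = S" "open_walk H (\<tau> v) q (\<eta> v)"
proof -
  obtain e where e: "e \<in> S" "v = tail D e" using assms(3) by auto
  have "cycle_arcs D S" using part assms(1) unfolding cycle_partition_def by simp
  then obtain p where p: "distinct (e # p)" "set (e # p) = S" "pre_digraph.cas D v (e # p) v"
    using cycle_arcs_rotate[of D S e] e by metis
  have sub: "set (e # p) \<subseteq> arcs D"
    unfolding p(2) using part assms(1) unfolding cycle_partition_def by auto
  have "tail D a \<notin> X" if "a \<in> set p" for a
  proof
    assume "tail D a \<in> X"
    moreover have "a \<in> S" using that p(2) by auto
    ultimately have "tail D a = tail D e" using assms(4) e by auto
    moreover have "a \<in> arcs D" "e \<in> arcs D" using sub that by auto
    ultimately have "a = e" using part unfolding cycle_partition_def by (meson inj_onD)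
    then show False using that p(1) by simp
  qed
  then have "open_walk H (\<tau> v) (e # p) (\<eta> v)"
    using open_walk_nontrivial(1)[OF p(3) _ p(1) sub assms(2,2)] by simp
  with p(2) show thesis by (rule that)
qed

end

definition new_names :: "gstate list \<Rightarrow> nat \<Rightarrow> nat \<Rightarrow> nat \<Rightarrow> bool" where
  "new_names hist f f' l \<longleftrightarrow> f \<noteq> f' \<and> f \<notin> arcs (graph (last hist)) \<and> f' \<notin> arcs (graph (last hist)) \<and>
     (\<forall>\<delta> \<in> set hist. l \<notin> labels \<delta>)"

lemma new_names_exist:
  assumes "finite (arcs (graph (last hist)))" "\<forall>\<delta> \<in> set hist. finite (labels \<delta>)"
  obtains f f' l where "new_names hist f f' l"
proof -
  obtain f where f: "f \<notin> arcs (graph (last hist))"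
    using assms(1) ex_new_if_finite infinite_UNIV_nat by blast
  obtain f' where f': "f' \<notin> insert f (arcs (graph (last hist)))"
    using assms(1) ex_new_if_finite infinite_UNIV_nat finite_insert by metis
  have "finite (\<Union>\<delta> \<in> set hist. labels \<delta>)" using assms(2) by simp
  then obtain l where "l \<notin> (\<Union>\<delta> \<in> set hist. labels \<delta>)"
    using ex_new_if_finite infinite_UNIV_nat by blast
  then have "new_names hist f f' l" unfolding new_names_def using f f' by auto
  then show thesis by (rule that)
qed

definition full_move_to ::
  "gstate list \<Rightarrow> nat \<times> nat \<Rightarrow> (nat \<Rightarrow> nat) \<Rightarrow> nat \<Rightarrow> nat set set \<Rightarrow> dgraph \<Rightarrow> bool" where
  "full_move_to hist vw \<chi>' g' \<S>' G \<longleftrightarrow>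
     full_move hist vw \<lparr>graph = G, labelling = \<chi>', counter = g'\<rparr> \<and> cycle_partition G \<S>' \<and>
     adjacency_reflecting (graph (last hist)) G"

lemma cycle_partition_same_cycle:
  assumes "cycle_partition D \<S>" "S \<in> \<S>" "T \<in> \<S>" "v \<in> tail D ` S" "v \<in> tail D ` T"
  shows "S = T"
proof -
  obtain e where e: "e \<in> S" "v = tail D e" using assms(4) by auto
  then have "e \<in> arcs D" using assms(1,2) unfolding cycle_partition_def by auto
  then have "e \<in> T" using cycle_partition_tail_unique[OF assms(1,3)] e assms(5) by blast
  then show ?thesis using e assms(1-3) disjointD[of \<S> S T] unfolding cycle_partition_def by blast
qed

section \<open>Answers available for each kind of request\<close>

context
  fixes hist :: "gstate list" and v w :: nat and D :: dgraph and \<chi> g \<S> f f' l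
  assumes last: "last hist = \<lparr>graph = D, labelling = \<chi>, counter = g\<rparr>"
    and part: "cycle_partition D \<S>"
    and new: "new_names hist f f' l"
begin

lemma new_D: "f \<noteq> f'" "f \<notin> arcs D" "f' \<notin> arcs D" "\<forall>\<delta> \<in> set hist. l \<notin> labels \<delta>"
  using new unfolding new_names_def last by simp_all

text \<open>The sides Q and \<open>Q'\<close> and the new names are fixed before Cutter decides, so
  that the three answers can be compared with one another.\<close>

lemma same_cycle_request:
  assumes S: "S \<in> \<S>" "v \<in> tail D ` S" "w \<in> tail D ` S"
  obtains Q Q' where "Q \<union> Q' = S" "Q \<inter> Q' = {}"
    "\<exists>G. full_move_to hist (v, w) (\<chi>(f := l, f' := l)) g ((\<S> - {S}) \<union> {insert f Q}) G"
    "\<exists>G. full_move_to hist (v, w) (\<chi>(f := l, f' := l)) g ((\<S> - {S}) \<union> {insert f' Q'}) G"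
    "g \<ge> 1 \<Longrightarrow> \<exists>G. full_move_to hist (v, w) (\<chi>(f := l, f' := l)) (g - 1)
       ((\<S> - {S}) \<union> {insert f Q, insert f' Q'}) G"
proof -
  have "\<exists>v\<^sub>1 v\<^sub>2 w\<^sub>1 w\<^sub>2 H X \<tau> \<eta> q r. same_turn hist v w \<S> D \<chi> g v\<^sub>1 v\<^sub>2 w\<^sub>1 w\<^sub>2 H X \<tau> \<eta> {S} q r f f' l"
  proof -
    obtain e where e: "e \<in> S" "v = tail D e" using S(2) by auto
    have "cycle_arcs D S" using part S(1) unfolding cycle_partition_def by simp
    then obtain p where p: "distinct (e # p)" "set (e # p) = S" "pre_digraph.cas D v (e # p) v"
      using cycle_arcs_rotate[of D S e] e by metis
    have sub: "S \<subseteq> arcs D" using part S(1) unfolding cycle_partition_def by auto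
    then have vD: "v \<in> verts D" "w \<in> verts D" using S part unfolding cycle_partition_def by auto
    have injD: "inj_on (tail D) (arcs D)" using part unfolding cycle_partition_def by blast
    have CV: "component (with_dummies D v w) v = with_dummies D v w \<restriction> (tail D ` S)"
      "component (with_dummies D v w) w = with_dummies D v w \<restriction> (tail D ` S)"
      using component_with_dummies[OF part S(1)] S by blast+
    show ?thesis
    proof (cases "v = w")
      case True
      \<comment> \<open>The cycle is cut only at v: one side is all of S, the other is empty with u
        as its trivial path.\<close>
      obtain H \<tau> \<eta> u where o: "opened D v v (\<tau> v) u u (\<eta> v) H" "opened_graph D H \<S> {v} \<tau> \<eta>"
        "\<tau> v = \<eta> v \<longleftrightarrow> v \<notin> verts D" "u \<notin> {\<tau> v, \<eta> v}" "{\<tau> v, \<eta> v, u} \<subseteq> verts H"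
        "{\<tau> v, \<eta> v, u} \<inter> verts D = {}" "\<And>x. x \<noteq> v \<Longrightarrow> \<tau> x = x \<and> \<eta> x = x"
        using opened_one[OF part, of v] by metis
      interpret opened_graph D H \<S> "{v}" \<tau> \<eta> by (rule o(2))
      obtain q where q: "set q = S" "open_walk H (\<tau> v) q (\<eta> v)"
        using open_walk_at[OF S(1) _ S(2)] by auto
      have u: "u \<notin> \<tau> ` verts D" "u \<notin> \<eta> ` verts D"
      proof -
        have "u \<noteq> \<tau> x \<and> u \<noteq> \<eta> x" if "x \<in> verts D" for x
          using that o(4,6) o(7)[of x] by (cases "x = v") auto
        then show "u \<notin> \<tau> ` verts D" "u \<notin> \<eta> ` verts D" by auto
      qed
      then have r: "open_walk H u [] u" using open_walk_trivial o(5) by simp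
      have "u \<notin> tail H ` S"
      proof
        assume "u \<in> tail H ` S"
        then obtain e where "e \<in> S" "u = tail H e" by auto
        moreover from this have "e \<in> arcs D" using sub by auto
        ultimately show False using u(1) tail_H tail_in_verts by blast
      qed
      then have "same_turn hist v w \<S> D \<chi> g (\<tau> v) u u (\<eta> v) H {v} \<tau> \<eta> {S} q [] f f' l"
        using o True S new_D last q r CV vD by unfold_locales auto
      then show ?thesis by blast
    next
      case False
      obtain H \<tau> \<eta> where o: "opened D v w (\<tau> v) (\<eta> v) (\<tau> w) (\<eta> w) H" "opened_graph D H \<S> {v, w} \<tau> \<eta>"
        "\<tau> v = \<eta> v \<longleftrightarrow> v \<notin> verts D" "\<tau> w = \<eta> w \<longleftrightarrow> w \<notin> verts D"
        "{\<tau> v, \<eta> v} \<inter> {\<tau> w, \<eta> w} = {}" "{\<tau> v, \<eta> v, \<tau> w, \<eta> w} \<subseteq> verts H"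
        "{\<tau> v, \<eta> v, \<tau> w, \<eta> w} \<inter> verts D = {}"
        using opened_two[OF part False] by metis
      interpret opened_graph D H \<S> "{v, w}" \<tau> \<eta> by (rule o(2))
      obtain e2 where e2: "e2 \<in> S" "w = tail D e2" using S(3) by auto
      then have "e2 \<in> set p" using False e p(2) by auto
      then obtain xs ys where p': "p = xs @ e2 # ys" by (metis split_list)
      \<comment> \<open>The closed walk from v is cut at w into q, from v to w, and r, from w back
        to v.\<close>
      define q where "q = e # xs"
      define r where "r = e2 # ys"
      have qr: "set q \<union> set r = S" "set q \<inter> set r = {}" "distinct q" "distinct r" "e # p = q @ r"
        using p(1,2) unfolding p' q_def r_def by auto
      obtain x where x: "pre_digraph.cas D v q x" "pre_digraph.cas D x r v"
        using p(3) unfolding qr(5) cas_append_iff by blast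
      then have "x = w" unfolding r_def using e2 by simp
      \<comment> \<open>By injectivity of tails, v and w are the tails of \<open>e\<close> and
        \<open>e2\<close> only, the first arcs of q and r; so the interior vertices are
        unsplit.\<close>
      have ne: "tail D a \<notin> {v, w}" if "a \<in> set xs \<union> set ys" for a
      proof
        have a: "a \<in> arcs D" "e \<in> arcs D" "e2 \<in> arcs D"
          using that sub p(2) unfolding p' by auto
        assume "tail D a \<in> {v, w}"
        then have "a = e \<or> a = e2" using a injD e e2 by (auto dest: inj_onD)
        then show False using that p(1) unfolding p' by auto
      qed
      have qs: "set q \<subseteq> arcs D" "set r \<subseteq> arcs D" using qr(1) sub by auto
      have q: "open_walk H (\<tau> v) q (\<eta> w)"
        using open_walk_nontrivial(1)[OF x(1)[unfolded \<open>x = w\<close>] _ qr(3) qs(1)] ne unfolding q_def by simp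
      have r: "open_walk H (\<tau> w) r (\<eta> v)"
        using open_walk_nontrivial(1)[OF x(2)[unfolded \<open>x = w\<close>] _ qr(4) qs(2)] ne unfolding r_def by simp
      have "tail H ` set q \<inter> tail H ` set r = {}" by (rule tail_H_images_disjoint[OF qs qr(2)])
      moreover have "\<eta> w \<notin> tail H ` set r" "\<eta> v \<notin> tail H ` set q"
        using qs tail_H_neq_eta[of _ v] tail_H_neq_eta[of _ w] vD by (metis imageE insertCI subsetD)+
      ultimately have "insert (\<eta> w) (tail H ` set q) \<inter> insert (\<eta> v) (tail H ` set r) = {}"
        using o(5) by auto
      then have "same_turn hist v w \<S> D \<chi> g (\<tau> v) (\<eta> v) (\<tau> w) (\<eta> w) H {v, w} \<tau> \<eta> {S} q r f f' l"
        using o S new_D last q r CV vD qr(1,2) by unfold_locales auto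
      then show ?thesis by blast
    qed
  qed
  then obtain v\<^sub>1 v\<^sub>2 w\<^sub>1 w\<^sub>2 H X \<tau> \<eta> q r where "same_turn hist v w \<S> D \<chi> g v\<^sub>1 v\<^sub>2 w\<^sub>1 w\<^sub>2 H X \<tau> \<eta> {S} q r f f' l"
    by blast
  then interpret same_turn hist v w \<S> D \<chi> g v\<^sub>1 v\<^sub>2 w\<^sub>1 w\<^sub>2 H X \<tau> \<eta> "{S}" q r f f' l .
  show thesis
  proof (rule that[of "set q" "set r"])
    show "set q \<union> set r = S" "set q \<inter> set r = {}" using qr by simp_all
    show "\<exists>G. full_move_to hist (v, w) (\<chi>(f := l, f' := l)) g ((\<S> - {S}) \<union> {insert f (set q)}) G"
      using keep_first unfolding full_move_to_def last by (metis gstate.select_convs(1))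
    show "\<exists>G. full_move_to hist (v, w) (\<chi>(f := l, f' := l)) g ((\<S> - {S}) \<union> {insert f' (set r)}) G"
      using keep_second unfolding full_move_to_def last by (metis gstate.select_convs(1))
    show "\<exists>G. full_move_to hist (v, w) (\<chi>(f := l, f' := l)) (g - 1)
       ((\<S> - {S}) \<union> {insert f (set q), insert f' (set r)}) G" if "g \<ge> 1"
      using keep_both[OF that] unfolding full_move_to_def last by (metis gstate.select_convs(1))
  qed
qed

text \<open>Both paths are trivial, so keeping the first one adds a loop and leaves the counter
  alone.\<close>

lemma single_dummy_request:
  assumes "v \<notin> verts D"
  shows "\<exists>G. full_move_to hist (v, v) (\<chi>(f := l, f' := l)) g (\<S> \<union> {{f}}) G"
proof -
  obtain H \<tau> \<eta> u where o: "opened D v v (\<tau> v) u u (\<eta> v) H" "opened_graph D H \<S> {v} \<tau> \<eta>"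
    "\<tau> v = \<eta> v \<longleftrightarrow> v \<notin> verts D" "u \<notin> {\<tau> v, \<eta> v}" "{\<tau> v, \<eta> v, u} \<subseteq> verts H"
    "{\<tau> v, \<eta> v, u} \<inter> verts D = {}" "\<And>x. x \<noteq> v \<Longrightarrow> \<tau> x = x \<and> \<eta> x = x"
    using opened_one[OF part, of v] by metis
  interpret opened_graph D H \<S> "{v}" \<tau> \<eta> by (rule o(2))
  have "x \<in> verts D \<Longrightarrow> \<tau> x = x \<and> \<eta> x = x" for x using o(7)[of x] assms by (cases "x = v") auto
  then have "\<tau> ` verts D = verts D" "\<eta> ` verts D = verts D" by force+
  then have "open_walk H (\<tau> v) [] (\<tau> v)" "open_walk H u [] u"
    using open_walk_trivial o(5,6) by simp_all
  then have "same_turn hist v v \<S> D \<chi> g (\<tau> v) u u (\<eta> v) H {v} \<tau> \<eta> {} [] [] f f' l"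
    using o assms new_D last component_dummy[OF part assms, of v v] by unfold_locales auto
  then interpret same_turn hist v v \<S> D \<chi> g "\<tau> v" u u "\<eta> v" H "{v}" \<tau> \<eta> "{}" "[]" "[]" f f' l .
  obtain G where "full_move hist (v, v) \<lparr>graph = G, labelling = \<chi>(f := l, f' := l), counter = g\<rparr>"
    "cycle_partition G ((\<S> - {}) \<union> {insert f (set [])})" "adjacency_reflecting D G"
    by (rule keep_first)
  then show ?thesis unfolding full_move_to_def last by auto
qed

text \<open>Encoding a dummy by the empty set treats two, one and no dummies alike. The last
  conclusion needs two real vertices: at a dummy, source and sink coincide and the two new arcs meet
  there.\<close>

lemma merge_request:
  assumes "v \<noteq> w"
    and A: "v \<notin> verts D \<and> A = {} \<or> (\<exists>S \<in> \<S>. v \<in> tail D ` S \<and> A = {S})"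
    and B: "w \<notin> verts D \<and> B = {} \<or> (\<exists>S \<in> \<S>. w \<in> tail D ` S \<and> B = {S})"
    and AB: "A \<inter> B = {}"
  obtains G where
    "full_move_to hist (v, w) (\<chi>(f := l, f' := l)) g ((\<S> - (A \<union> B)) \<union> {insert f (insert f' (\<Union>(A \<union> B)))}) G"
    "A \<noteq> {} \<Longrightarrow> B \<noteq> {} \<Longrightarrow> head G f \<noteq> tail G f' \<and> head G f' \<noteq> tail G f"
proof -
  obtain H \<tau> \<eta> where o: "opened D v w (\<tau> v) (\<eta> v) (\<tau> w) (\<eta> w) H" "opened_graph D H \<S> {v, w} \<tau> \<eta>"
    "\<tau> v = \<eta> v \<longleftrightarrow> v \<notin> verts D" "\<tau> w = \<eta> w \<longleftrightarrow> w \<notin> verts D"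
    "{\<tau> v, \<eta> v} \<inter> {\<tau> w, \<eta> w} = {}" "{\<tau> v, \<eta> v, \<tau> w, \<eta> w} \<subseteq> verts H"
    "{\<tau> v, \<eta> v, \<tau> w, \<eta> w} \<inter> verts D = {}" "\<And>x. x \<noteq> v \<Longrightarrow> x \<noteq> w \<Longrightarrow> \<tau> x = x \<and> \<eta> x = x"
    using opened_two[OF part assms(1)] by metis
  interpret opened_graph D H \<S> "{v, w}" \<tau> \<eta> by (rule o(2))
  have dummy: "\<tau> u \<notin> \<tau> ` verts D" "\<tau> u \<notin> \<eta> ` verts D" "\<tau> u = \<eta> u"
    if u: "u \<in> {v, w}" "u \<notin> verts D" for u
  proof -
    have "\<tau> u \<noteq> \<tau> x \<and> \<tau> u \<noteq> \<eta> x" if "x \<in> verts D" for x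
      using that u assms(1) o(3-5,7) o(8)[of x] by (cases "x = v"; cases "x = w") auto
    then show "\<tau> u \<notin> \<tau> ` verts D" "\<tau> u \<notin> \<eta> ` verts D" by auto
    show "\<tau> u = \<eta> u" using u o(3,4) by auto
  qed
  have sub: "\<Union>(A \<union> B) \<subseteq> arcs D" "A \<union> B \<subseteq> \<S>" using A B part unfolding cycle_partition_def by auto
  have vert: "\<exists>S \<in> \<S>. u \<in> tail D ` S" if "u \<in> verts D" for u
    using that part unfolding cycle_partition_def by auto
  \<comment> \<open>A vertex lies on one cycle only, so a cycle of A through w would also belong to
    B. Hence each cycle contains just one split vertex.\<close>
  have wA: "w \<notin> tail D ` \<Union>A"
  proof
    assume *: "w \<in> tail D ` \<Union>A"
    then obtain S where S: "A = {S}" "S \<in> \<S>" "w \<in> tail D ` S" using A by auto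
    then have "w \<in> verts D" using part unfolding cycle_partition_def by auto
    then obtain T where T: "B = {T}" "T \<in> \<S>" "w \<in> tail D ` T" using B by auto
    then show False using cycle_partition_same_cycle[OF part S(2) T(2) S(3) T(3)] S(1) AB by simp
  qed
  have vB: "v \<notin> tail D ` \<Union>B"
  proof
    assume *: "v \<in> tail D ` \<Union>B"
    then obtain S where S: "B = {S}" "S \<in> \<S>" "v \<in> tail D ` S" using B by auto
    then have "v \<in> verts D" using part unfolding cycle_partition_def by auto
    then obtain T where T: "A = {T}" "T \<in> \<S>" "v \<in> tail D ` T" using A by auto
    then show False using cycle_partition_same_cycle[OF part S(2) T(2) S(3) T(3)] S(1) AB by simp
  qed
  have "\<exists>q. set q = \<Union>A \<and> open_walk H (\<tau> v) q (\<eta> v)"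
    using A
  proof
    assume "v \<notin> verts D \<and> A = {}"
    then show ?thesis using open_walk_trivial[of "\<tau> v"] dummy[of v] o(6) by (intro exI[of _ "[]"]) auto
  next
    assume "\<exists>S \<in> \<S>. v \<in> tail D ` S \<and> A = {S}"
    then obtain S where S: "S \<in> \<S>" "v \<in> tail D ` S" "A = {S}" by blast
    then show ?thesis using wA open_walk_at[OF S(1) _ S(2)] by auto
  qed
  then obtain q where q: "set q = \<Union>A" "open_walk H (\<tau> v) q (\<eta> v)" by blast
  have "\<exists>q. set q = \<Union>B \<and> open_walk H (\<tau> w) q (\<eta> w)"
    using B
  proof
    assume "w \<notin> verts D \<and> B = {}"
    then show ?thesis using open_walk_trivial[of "\<tau> w"] dummy[of w] o(6) by (intro exI[of _ "[]"]) auto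
  next
    assume "\<exists>S \<in> \<S>. w \<in> tail D ` S \<and> B = {S}"
    then obtain S where S: "S \<in> \<S>" "w \<in> tail D ` S" "B = {S}" by blast
    then show ?thesis using vB open_walk_at[OF S(1) _ S(2)] by auto
  qed
  then obtain r where r: "set r = \<Union>B" "open_walk H (\<tau> w) r (\<eta> w)" by blast
  have eta: "\<eta> u \<notin> tail H ` Q" if "u \<in> {v, w}" "Q \<subseteq> arcs D" for u Q
  proof
    assume "\<eta> u \<in> tail H ` Q"
    then obtain e where e: "e \<in> arcs D" "tail H e = \<eta> u"
      using \<open>Q \<subseteq> arcs D\<close> by force
    then have "u \<notin> verts D" using tail_H_neq_eta that(1) by blast
    then have "tail H e \<notin> \<tau> ` verts D" using dummy[of u] that(1) e by simp
    then show False using tail_H[OF e(1)] tail_in_verts[OF e(1)] by simp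
  qed
  have qr: "set q \<inter> set r = {}"
  proof -
    have "S \<inter> T = {}" if "S \<in> A" "T \<in> B" for S T
    proof -
      have "S \<noteq> T" "S \<in> \<S>" "T \<in> \<S>" using that AB sub(2) by blast+
      then show ?thesis using part disjointD[of \<S> S T] unfolding cycle_partition_def by blast
    qed
    then show ?thesis unfolding q r by blast
  qed
  have qs: "set q \<subseteq> arcs D" "set r \<subseteq> arcs D" using q r sub(1) by auto
  have vd: "insert (\<eta> v) (tail H ` set q) \<inter> insert (\<eta> w) (tail H ` set r) = {}"
    using tail_H_images_disjoint[OF qs qr] eta[OF _ qs(1), of w] eta[OF _ qs(2), of v] o(5) by auto
  let ?C = "\<lambda>u. component (with_dummies D v w) u"
  have Cv: "verts (?C v) = insert v (tail D ` \<Union>A)"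
    using A
  proof
    assume "v \<notin> verts D \<and> A = {}"
    then show ?thesis using component_dummy[OF part, of v] by auto
  next
    assume "\<exists>S \<in> \<S>. v \<in> tail D ` S \<and> A = {S}"
    then show ?thesis using component_with_dummies[OF part] by auto
  qed
  have Cw: "verts (?C w) = insert w (tail D ` \<Union>B)"
    using B
  proof
    assume "w \<notin> verts D \<and> B = {}"
    then show ?thesis using component_dummy[OF part, of w] by auto
  next
    assume "\<exists>S \<in> \<S>. w \<in> tail D ` S \<and> B = {S}"
    then show ?thesis using component_with_dummies[OF part] by auto
  qed
  have "v \<notin> verts (?C w)" unfolding Cw using assms(1) vB by simp
  then have "?C v \<noteq> ?C w" using Cv by auto
  moreover have vX: "u \<in> verts D \<Longrightarrow> u \<in> {v, w} \<Longrightarrow> u \<in> tail D ` \<Union>(A \<union> B)" for u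
    using A B by auto
  moreover have "verts D - (verts (?C v) \<union> verts (?C w)) = verts D - tail D ` \<Union>(A \<union> B)"
    unfolding Cv Cw using vX by auto
  moreover have "{v, w} \<inter> verts D \<subseteq> tail D ` \<Union>(A \<union> B)" using vX by blast
  moreover have "set q \<union> set r = \<Union>(A \<union> B)" using q r by auto
  moreover have "\<eta> v \<notin> verts D" "\<eta> w \<notin> verts D" using o(7) by auto
  ultimately have "merge_turn hist v w \<S> D \<chi> g (\<tau> v) (\<eta> v) (\<tau> w) (\<eta> w) H {v, w} \<tau> \<eta> (A \<union> B) q r f f' l"
    using o(1) last new_D sub(2) q(2) r(2) vd qr by unfold_locales
  then interpret merge_turn hist v w \<S> D \<chi> g "\<tau> v" "\<eta> v" "\<tau> w" "\<eta> w" H "{v, w}" \<tau> \<eta> "A \<union> B" q r f f' l .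
  obtain G where G: "full_move hist (v, w) \<lparr>graph = G, labelling = \<chi>(f := l, f' := l), counter = g\<rparr>"
    "cycle_partition G ((\<S> - (A \<union> B)) \<union> {insert f (insert f' (\<Union>(A \<union> B)))})" "adjacency_reflecting D G"
    "head G f = \<tau> v" "tail G f' = \<eta> v" "head G f' = \<tau> w" "tail G f = \<eta> w"
    by (rule merge)
  have "head G f \<noteq> tail G f' \<and> head G f' \<noteq> tail G f" if "A \<noteq> {}" "B \<noteq> {}"
  proof -
    have "v \<in> verts D" "w \<in> verts D" using that A B part unfolding cycle_partition_def by auto
    then show ?thesis unfolding G(4-7) using o(3,4) by auto
  qed
  then show thesis using that G(1-3) unfolding full_move_to_def last by auto
qed

end

section \<open>The invariant\<close>

definition single_arcs :: "dgraph \<Rightarrow> (nat \<Rightarrow> nat) \<Rightarrow> nat set" where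
  "single_arcs D \<chi> = {e \<in> arcs D. \<forall>e' \<in> arcs D. \<chi> e' = \<chi> e \<longrightarrow> e' = e}"

text \<open>Under a proper labelling these are loops and pairs of equally labelled arcs. They are
  the only cycles whose arcs, once-used labels and labels in K may add up to less than 4, namely to
  3.\<close>

definition one_label_cycles :: "(nat \<Rightarrow> nat) \<Rightarrow> nat set set \<Rightarrow> nat set set" where
  "one_label_cycles \<chi> \<S> = {S \<in> \<S>. \<exists>l. \<chi> ` S = {l}}"

text \<open>The initial advantage of Cutter after one and after two turns, which yields the additive
  constant 2 of the theorem.\<close>

definition bonus :: "nat \<Rightarrow> nat" where
  "bonus n = (if n = 0 then 0 else if n = 1 then 6 else 10)"

text \<open>\<open>\<S>\<close> consists of the arc sets of the cycles. The labels in \<open>K\<close> are those used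
  once, and those created with a dummy vertex as long as both arcs are on the same cycle. The two
  arcs of any other label are never adjacent, so that a cycle containing both has at least four
  arcs. The last
  conjunct bounds the number \<open>g\<^sub>0 - g\<close> of moves (a): move (a) changes both sides by 8, the merger
  of two cycles neither of them, and every other move leaves a surplus.\<close>

definition invariant :: "nat \<Rightarrow> dgraph \<Rightarrow> (nat \<Rightarrow> nat) \<Rightarrow> nat \<Rightarrow> nat set set \<Rightarrow> nat set \<Rightarrow> bool" where
  "invariant g\<^sub>0 D \<chi> g \<S> K \<longleftrightarrow>
     cycle_partition D \<S> \<and> proper_labelling D \<chi> \<and>
     \<chi> ` single_arcs D \<chi> \<subseteq> K \<and> K \<subseteq> \<chi> ` arcs D \<and>
     (\<forall>S \<in> \<S>. \<forall>e \<in> S. \<forall>e' \<in> arcs D. \<chi> e \<in> K \<longrightarrow> \<chi> e' = \<chi> e \<longrightarrow> e' \<in> S) \<and>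
     (\<forall>e \<in> arcs D. \<forall>e' \<in> arcs D. e \<noteq> e' \<longrightarrow> \<chi> e = \<chi> e' \<longrightarrow> \<chi> e \<notin> K \<longrightarrow> head D e \<noteq> tail D e') \<and>
     (\<forall>S \<in> \<S>. (\<exists>e \<in> S. \<chi> e \<in> K) \<or> 4 \<le> card S) \<and>
     g \<le> g\<^sub>0 \<and>
     card K + 8 * (g\<^sub>0 - g) + card (one_label_cycles \<chi> \<S>) + bonus (card (\<chi> ` arcs D))
       \<le> 4 * card (\<chi> ` arcs D) + 4 * card \<S>"

text \<open>Deleting such a side would lose a label and thus the gain in value.\<close>

definition private_side :: "dgraph \<Rightarrow> (nat \<Rightarrow> nat) \<Rightarrow> nat set \<Rightarrow> bool" where
  "private_side D \<chi> Q \<longleftrightarrow> (\<exists>e \<in> Q. \<forall>e' \<in> arcs D. \<chi> e' = \<chi> e \<longrightarrow> e' \<in> Q)"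

text \<open>The sides that Cutter does not delete. The threshold serves twice: closing three arcs
  yields a cycle with four, while deleting at most two puts at most three labels into K, within the
  gain of 4.\<close>

definition big_side :: "dgraph \<Rightarrow> (nat \<Rightarrow> nat) \<Rightarrow> nat set \<Rightarrow> bool" where
  "big_side D \<chi> Q \<longleftrightarrow> private_side D \<chi> Q \<or> 3 \<le> card Q"

section \<open>Counting arcs and labels\<close>

lemma single_arcsD: "\<lbrakk>e \<in> single_arcs G \<chi>; z \<in> arcs G; \<chi> z = \<chi> e\<rbrakk> \<Longrightarrow> z = e"
  unfolding single_arcs_def by blast

text \<open>The four arcs are the two given ones and their successors. The successors differ because
  heads are injective, and neither given arc is a successor because they are not loops and not
  adjacent.\<close>

lemma cycle_partition_nonadjacent:
  assumes part: "cycle_partition D \<S>" and "S \<in> \<S>" "e \<in> S" "e' \<in> S" "e \<noteq> e'"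
    and "head D e \<noteq> tail D e'" "head D e' \<noteq> tail D e"
  shows "4 \<le> card S"
proof -
  have cyc: "cycle_arcs D S" and sub: "S \<subseteq> arcs D" and inj: "inj_on (tail D) (arcs D)"
    using part assms(2) unfolding cycle_partition_def by auto
  \<comment> \<open>A loop is a whole cycle and cannot share it with another arc.\<close>
  have noloop: "head D a \<noteq> tail D a" if "a \<in> S" "b \<in> S" "a \<noteq> b" for a b
  proof
    assume loop: "head D a = tail D a"
    obtain p where p: "distinct (a # p)" "set (a # p) = S" "pre_digraph.cas D (tail D a) (a # p) (tail D a)"
      using cycle_arcs_rotate[OF cyc \<open>a \<in> S\<close>] by metis
    then obtain c p' where "p = c # p'" using \<open>b \<in> S\<close> \<open>a \<noteq> b\<close> by (cases p) auto
    then have "tail D c = tail D a" "c \<noteq> a" "c \<in> S" using p loop by auto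
    then show False using inj sub \<open>a \<in> S\<close> by (meson inj_onD subsetD)
  qed
  have "\<exists>c \<in> S. tail D c = head D a" if "a \<in> S" for a
    using cycle_arcs_heads[OF cyc] that by (metis imageE imageI)
  then obtain c c' where c: "c \<in> S" "tail D c = head D e" "c' \<in> S" "tail D c' = head D e'"
    using assms(3,4) by metis
  have "c \<noteq> e" "c \<noteq> e'" "c' \<noteq> e" "c' \<noteq> e'"
    using c assms noloop[of e e'] noloop[of e' e] by auto
  moreover have "c \<noteq> c'"
    using c cycle_partition_inj_head[OF part] sub assms(3,4,5) by (metis inj_onD subsetD)
  ultimately have "card {e, e', c, c'} = 4" using assms(5) by simp
  moreover have "{e, e', c, c'} \<subseteq> S" using assms(3,4) c by simp
  ultimately show ?thesis using card_mono[OF cycle_arcs_finite[OF cyc]] by metis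
qed

text \<open>When arcs with a once-used label are counted twice, every label accounts for at most
  2.\<close>

lemma two_labels_lower_bound:
  assumes "finite (arcs D)" "proper_labelling D \<chi>"
  shows "card (arcs D) + card (single_arcs D \<chi>) \<le> 2 * card (\<chi> ` arcs D)"
proof -
  let ?w = "\<lambda>e. 1 + (if e \<in> single_arcs D \<chi> then 1 else 0) :: nat"
  have "single_arcs D \<chi> \<subseteq> arcs D" unfolding single_arcs_def by auto
  then have "arcs D \<inter> single_arcs D \<chi> = single_arcs D \<chi>" by blast
  then have "(\<Sum>e \<in> arcs D. ?w e) = card (arcs D) + card (single_arcs D \<chi>)"
    using assms(1) by (simp only: sum.distrib sum.inter_restrict[symmetric] card_eq_sum) 
  moreover have "(\<Sum>e \<in> arcs D. ?w e) = (\<Sum>l \<in> \<chi> ` arcs D. \<Sum>e \<in> {e \<in> arcs D. \<chi> e = l}. ?w e)"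
    using assms(1) by (rule sum.image_gen)
  moreover have "(\<Sum>e \<in> {e \<in> arcs D. \<chi> e = l}. ?w e) \<le> 2" for l
  proof (cases "\<exists>a \<in> single_arcs D \<chi>. \<chi> a = l")
    case True
    then obtain a where "{e \<in> arcs D. \<chi> e = l} = {a}" unfolding single_arcs_def by auto
    then show ?thesis by simp
  next
    case False
    then have "(\<Sum>e \<in> {e \<in> arcs D. \<chi> e = l}. ?w e) = card {e \<in> arcs D. \<chi> e = l}"
      unfolding card_eq_sum by (intro sum.cong) auto
    then show ?thesis using assms(2) unfolding proper_labelling_def by simp
  qed
  then have "(\<Sum>l \<in> \<chi> ` arcs D. \<Sum>e \<in> {e \<in> arcs D. \<chi> e = l}. ?w e) \<le> (\<Sum>l \<in> \<chi> ` arcs D. 2)"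
    by (intro sum_mono)
  ultimately show ?thesis by simp
qed

context
  fixes g\<^sub>0 D \<chi> g \<S> K
  assumes inv: "invariant g\<^sub>0 D \<chi> g \<S> K"
begin

lemma inv_facts:
  shows inv_part: "cycle_partition D \<S>" and inv_proper: "proper_labelling D \<chi>"
    and inv_single: "\<chi> ` single_arcs D \<chi> \<subseteq> K" and inv_K: "K \<subseteq> \<chi> ` arcs D"
    and inv_confined: "\<And>S e e'. \<lbrakk>S \<in> \<S>; e \<in> S; e' \<in> arcs D; \<chi> e \<in> K; \<chi> e' = \<chi> e\<rbrakk> \<Longrightarrow> e' \<in> S"
    and inv_nonadj: "\<And>e e'. \<lbrakk>e \<in> arcs D; e' \<in> arcs D; e \<noteq> e'; \<chi> e = \<chi> e'; \<chi> e \<notin> K\<rbrakk> \<Longrightarrow> head D e \<noteq> tail D e'"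
    and inv_size: "\<And>S. S \<in> \<S> \<Longrightarrow> (\<exists>e \<in> S. \<chi> e \<in> K) \<or> 4 \<le> card S"
    and inv_counter: "g \<le> g\<^sub>0"
    and inv_budget: "card K + 8 * (g\<^sub>0 - g) + card (one_label_cycles \<chi> \<S>) + bonus (card (\<chi> ` arcs D))
       \<le> 4 * card (\<chi> ` arcs D) + 4 * card \<S>"
proof -
  show "cycle_partition D \<S>" "proper_labelling D \<chi>" "\<chi> ` single_arcs D \<chi> \<subseteq> K" "K \<subseteq> \<chi> ` arcs D" "g \<le> g\<^sub>0"
    using inv unfolding invariant_def by simp_all
  show "\<And>S e e'. \<lbrakk>S \<in> \<S>; e \<in> S; e' \<in> arcs D; \<chi> e \<in> K; \<chi> e' = \<chi> e\<rbrakk> \<Longrightarrow> e' \<in> S"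
    using inv[unfolded invariant_def, THEN conjunct2, THEN conjunct2, THEN conjunct2, THEN conjunct2, THEN conjunct1] by blast
  show "\<And>e e'. \<lbrakk>e \<in> arcs D; e' \<in> arcs D; e \<noteq> e'; \<chi> e = \<chi> e'; \<chi> e \<notin> K\<rbrakk> \<Longrightarrow> head D e \<noteq> tail D e'"
    using inv[unfolded invariant_def, THEN conjunct2, THEN conjunct2, THEN conjunct2, THEN conjunct2, THEN conjunct2, THEN conjunct1] by blast
  show "\<And>S. S \<in> \<S> \<Longrightarrow> (\<exists>e \<in> S. \<chi> e \<in> K) \<or> 4 \<le> card S"
    using inv[unfolded invariant_def, THEN conjunct2, THEN conjunct2, THEN conjunct2, THEN conjunct2, THEN conjunct2, THEN conjunct2, THEN conjunct1] by blast
  show "card K + 8 * (g\<^sub>0 - g) + card (one_label_cycles \<chi> \<S>) + bonus (card (\<chi> ` arcs D))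
       \<le> 4 * card (\<chi> ` arcs D) + 4 * card \<S>"
    using inv[unfolded invariant_def, THEN conjunct2, THEN conjunct2, THEN conjunct2, THEN conjunct2, THEN conjunct2, THEN conjunct2, THEN conjunct2, THEN conjunct2] by assumption
qed

lemma inv_finite: "finite (arcs D)" "finite \<S>" "finite K"
proof -
  show "finite (arcs D)" by (rule cycle_partition_finite_arcs[OF inv_part])
  then show "finite K" using inv_K finite_surj by blast
  show "finite \<S>" using inv_part unfolding cycle_partition_def by blast
qed

lemma inv_arcs: "arcs D = \<Union>\<S>" "S \<in> \<S> \<Longrightarrow> S \<subseteq> arcs D" "S \<in> \<S> \<Longrightarrow> finite S" "S \<in> \<S> \<Longrightarrow> S \<noteq> {}"
  "\<lbrakk>S \<in> \<S>; T \<in> \<S>; S \<noteq> T\<rbrakk> \<Longrightarrow> S \<inter> T = {}"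
proof -
  have P: "disjoint \<S>" "arcs D = \<Union>\<S>" "\<forall>S \<in> \<S>. cycle_arcs D S"
    using inv_part unfolding cycle_partition_def by blast+
  then show "arcs D = \<Union>\<S>" "S \<in> \<S> \<Longrightarrow> S \<subseteq> arcs D" by auto
  show "S \<in> \<S> \<Longrightarrow> finite S" using P(3) cycle_arcs_finite by blast
  show "S \<in> \<S> \<Longrightarrow> S \<noteq> {}" using P(3) cycle_arcs_nonempty by blast
  show "\<lbrakk>S \<in> \<S>; T \<in> \<S>; S \<noteq> T\<rbrakk> \<Longrightarrow> S \<inter> T = {}" using disjointD[OF P(1)] .
qed

definition weight :: "nat set \<Rightarrow> nat" where
  "weight Q = card Q + card (single_arcs D \<chi> \<inter> Q)"

lemma weight_union:
  assumes "finite Q" "finite Q'" "Q \<inter> Q' = {}"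
  shows "weight (Q \<union> Q') = weight Q + weight Q'"
proof -
  have "single_arcs D \<chi> \<inter> (Q \<union> Q') = (single_arcs D \<chi> \<inter> Q) \<union> (single_arcs D \<chi> \<inter> Q')" by blast
  then show ?thesis
    using assms unfolding weight_def by (simp add: card_Un_disjoint disjoint_iff)
qed

lemma sum_weight: "(\<Sum>S \<in> \<S>. weight S) \<le> 2 * card (\<chi> ` arcs D)"
proof -
  have "card (arcs D) = (\<Sum>S \<in> \<S>. card S)"
    unfolding inv_arcs(1) using inv_part inv_arcs(3) unfolding cycle_partition_def
    by (intro card_Union_disjoint) auto
  moreover have "card (single_arcs D \<chi>) = (\<Sum>S \<in> \<S>. card (single_arcs D \<chi> \<inter> S))"
  proof -
    have "single_arcs D \<chi> = (\<Union>S \<in> \<S>. single_arcs D \<chi> \<inter> S)"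
      using inv_arcs(1) unfolding single_arcs_def by auto
    moreover have "card (\<Union>S \<in> \<S>. single_arcs D \<chi> \<inter> S) = (\<Sum>S \<in> \<S>. card (single_arcs D \<chi> \<inter> S))"
      using inv_finite(2) inv_arcs(3,5) by (intro card_UN_disjoint) blast+
    ultimately show ?thesis by simp
  qed
  ultimately show ?thesis
    using two_labels_lower_bound[OF inv_finite(1) inv_proper] unfolding weight_def by (simp add: sum.distrib)
qed

text \<open>By confinement a label in K occurs on one cycle only, so the counted sets are
  disjoint.\<close>

lemma sum_K: "(\<Sum>S \<in> \<S>. card (K \<inter> \<chi> ` S)) \<le> card K"
proof -
  have "(\<Sum>S \<in> \<S>. card (K \<inter> \<chi> ` S)) = card (\<Union>S \<in> \<S>. K \<inter> \<chi> ` S)"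
  proof (rule card_UN_disjoint[symmetric])
    show "\<forall>S \<in> \<S>. \<forall>T \<in> \<S>. S \<noteq> T \<longrightarrow> (K \<inter> \<chi> ` S) \<inter> (K \<inter> \<chi> ` T) = {}"
    proof (intro ballI impI, rule ccontr)
      fix S T assume *: "S \<in> \<S>" "T \<in> \<S>" "S \<noteq> T" "(K \<inter> \<chi> ` S) \<inter> (K \<inter> \<chi> ` T) \<noteq> {}"
      then obtain e e' where e: "e \<in> S" "e' \<in> T" "\<chi> e = \<chi> e'" "\<chi> e \<in> K" by auto
      then have "e' \<in> S" using inv_confined[OF *(1) e(1)] inv_arcs(2)[OF *(2)] by auto
      then show False using e inv_arcs(5)[OF *(1,2,3)] by blast
    qed
  qed (use inv_finite in auto)
  also have "\<dots> \<le> card K" by (rule card_mono) (use inv_finite in auto)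
  finally show ?thesis .
qed

lemma single_arc_iff: "e \<in> single_arcs D \<chi> \<longleftrightarrow> e \<in> arcs D \<and> (\<forall>e' \<in> arcs D. \<chi> e' = \<chi> e \<longrightarrow> e' = e)"
  unfolding single_arcs_def by simp

text \<open>A cycle with fewer than four arcs has a label in K. Three arcs need no more. With two
  arcs of different labels, confinement makes the label in K a once-used one, which counts again. A
  loop and two arcs of equal label reach only 3, which the last summand corrects.\<close>

lemma cycle_weight:
  assumes "S \<in> \<S>"
  shows "4 \<le> weight S + card (K \<inter> \<chi> ` S) + (if S \<in> one_label_cycles \<chi> \<S> then 1 else 0)"
proof (cases "4 \<le> card S")
  case True
  then show ?thesis unfolding weight_def by simp
next
  case False
  then obtain e where e: "e \<in> S" "\<chi> e \<in> K" using inv_size[OF assms] by blast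
  have fin: "finite S" using inv_arcs(3)[OF assms] .
  have "K \<inter> \<chi> ` S \<noteq> {}" using e by blast
  then have k: "card (K \<inter> \<chi> ` S) \<ge> 1" using inv_finite(3) by (simp add: Suc_leI card_gt_0_iff)
  have sing: "card (single_arcs D \<chi> \<inter> S) \<ge> 1" if "e \<in> single_arcs D \<chi>"
  proof -
    have "single_arcs D \<chi> \<inter> S \<noteq> {}" using that e by blast
    then show ?thesis using fin by (simp add: Suc_leI card_gt_0_iff)
  qed
  have "card S \<noteq> 0" using e fin by auto
  then consider "card S = 1" | "card S = 2" | "card S = 3" using False by linarith
  then show ?thesis
  proof cases
    case 1
    then have S: "S = {e}" using e by (metis card_1_singletonE singletonD)
    then have "e \<in> single_arcs D \<chi>"
      using inv_confined[OF assms e(1) _ e(2)] inv_arcs(2)[OF assms] by (auto simp: single_arc_iff)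
    moreover have "S \<in> one_label_cycles \<chi> \<S>" using S assms unfolding one_label_cycles_def by simp
    ultimately show ?thesis using sing k 1 unfolding weight_def by simp
  next
    case 2
    then obtain b where b: "S = {e, b}" "b \<noteq> e" using e by (metis card_2_iff insertE singletonD doubleton_eq_iff)
    show ?thesis
    proof (cases "\<chi> b = \<chi> e")
      case True
      then have "S \<in> one_label_cycles \<chi> \<S>" using b assms unfolding one_label_cycles_def by simp
      then show ?thesis using k 2 unfolding weight_def by simp
    next
      case False
      then have "e \<in> single_arcs D \<chi>"
        using inv_confined[OF assms e(1) _ e(2)] inv_arcs(2)[OF assms] b by (auto simp: single_arc_iff)
      then show ?thesis using sing k 2 unfolding weight_def by simp
    qed
  next
    case 3
    then show ?thesis using k unfolding weight_def by simp
  qed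
qed

text \<open>A side with fewer than three arcs has a private label, and the side weighs 2 already:
  through one arc used once, or through two arcs. The label is in K, in the second case because
  \<open>gap\<close> would otherwise give three arcs. Being private, it is absent from
  \<open>Q'\<close> and provides the third unit.\<close>

lemma side_weight:
  assumes Q: "Q \<subseteq> arcs D" "big_side D \<chi> Q" "Q \<inter> Q' = {}" "Q' \<subseteq> arcs D"
    and gap: "\<And>e e'. \<lbrakk>e \<in> Q; e' \<in> Q; e \<noteq> e'; \<chi> e = \<chi> e'; \<chi> e \<notin> K\<rbrakk> \<Longrightarrow> 3 \<le> card Q"
  shows "3 \<le> weight Q + card (K \<inter> (\<chi> ` Q - \<chi> ` Q'))"
proof (cases "3 \<le> card Q")
  case True
  then show ?thesis unfolding weight_def by simp
next
  case False
  then obtain e where e: "e \<in> Q" "\<forall>e' \<in> arcs D. \<chi> e' = \<chi> e \<longrightarrow> e' \<in> Q"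
    using Q(2) unfolding big_side_def private_side_def by blast
  have fin: "finite Q" using Q(1) inv_finite(1) finite_subset by blast
  have w: "2 \<le> weight Q \<and> \<chi> e \<in> K"
  proof (cases "e \<in> single_arcs D \<chi>")
    case True
    then have "single_arcs D \<chi> \<inter> Q \<noteq> {}" "Q \<noteq> {}" using e by blast+
    then have "card (single_arcs D \<chi> \<inter> Q) \<ge> 1" "card Q \<ge> 1"
      using fin by (simp_all add: Suc_leI card_gt_0_iff)
    moreover have "\<chi> e \<in> K" using True inv_single by blast
    ultimately show ?thesis unfolding weight_def by simp
  next
    case False
    then obtain e' where e': "e' \<in> arcs D" "\<chi> e' = \<chi> e" "e' \<noteq> e"
      using e Q(1) by (auto simp: single_arc_iff)
    then have "e' \<in> Q" using e by blast
    then have "card {e, e'} \<le> card Q" using e fin by (intro card_mono) auto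
    moreover have "\<chi> e \<in> K" using gap[of e e'] \<open>e' \<in> Q\<close> e e' \<open>\<not> 3 \<le> card Q\<close> by auto
    ultimately show ?thesis using e'(3) unfolding weight_def by simp
  qed
  have "\<chi> e \<notin> \<chi> ` Q'" using e(2) Q(3,4) by auto
  then have "K \<inter> (\<chi> ` Q - \<chi> ` Q') \<noteq> {}" using w e(1) by blast
  then have "card (K \<inter> (\<chi> ` Q - \<chi> ` Q')) \<ge> 1" using inv_finite(3) by (simp add: Suc_leI card_gt_0_iff)
  then show ?thesis using w by simp
qed

context
  fixes S Q Q'
  assumes S: "S \<in> \<S>" and QQ: "Q \<union> Q' = S" "Q \<inter> Q' = {}"
    and big: "big_side D \<chi> Q" "big_side D \<chi> Q'"
begin

lemma sides_sub: "Q \<subseteq> arcs D" "Q' \<subseteq> arcs D" "finite Q" "finite Q'" "Q \<subseteq> S" "Q' \<subseteq> S"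
  using QQ(1) inv_arcs(2,3)[OF S] by (auto intro: finite_subset)

lemma sides_nonempty: "Q \<noteq> {}" "Q' \<noteq> {}"
  using big unfolding big_side_def private_side_def by auto

text \<open>Ensures that the bonus is at its final value when move (a) is considered. A single label
  has at most two arcs, so both sides would need a private label, which a label common to all arcs
  cannot be.\<close>

lemma two_labels: "2 \<le> card (\<chi> ` arcs D)"
proof (rule ccontr)
  assume "\<not> 2 \<le> card (\<chi> ` arcs D)"
  then have c1: "card (\<chi> ` arcs D) \<le> 1" by simp
  obtain a where a: "a \<in> Q" using sides_nonempty by auto
  have same: "\<chi> e = \<chi> a" if "e \<in> arcs D" for e
  proof -
    have "\<chi> e \<in> \<chi> ` arcs D" "\<chi> a \<in> \<chi> ` arcs D" using that a sides_sub(1) by blast+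
    moreover have "finite (\<chi> ` arcs D)" using inv_finite(1) by (rule finite_imageI)
    ultimately show ?thesis
      using c1 card_le_Suc0_iff_eq[of "\<chi> ` arcs D"]
      unfolding One_nat_def by blast
  qed
  then have "{e \<in> arcs D. \<chi> e = \<chi> a} = arcs D" by auto
  then have c2: "card (arcs D) \<le> 2" using inv_proper unfolding proper_labelling_def by metis
  then have "card Q \<le> 2" "card Q' \<le> 2"
    using sides_sub(1,2) card_mono[OF inv_finite(1)] le_trans by blast+
  then have "private_side D \<chi> Q" "private_side D \<chi> Q'" using big unfolding big_side_def by auto
  then obtain e where e: "e \<in> Q" "\<forall>e' \<in> arcs D. \<chi> e' = \<chi> e \<longrightarrow> e' \<in> Q"
    unfolding private_side_def by blast
  obtain b where "b \<in> Q'" using sides_nonempty by auto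
  then have "b \<in> Q" using e same sides_sub by (metis subsetD)
  then show False using \<open>b \<in> Q'\<close> QQ(2) by blast
qed

text \<open>The requested cycle weighs at least 6 and the others 4, which improves the lower bound
  on the sum of weights by 2; adding the bonus 10 gives the 12. For \<open>g = 0\<close> the
  conclusion says that the target value has been reached, so before that a move (a) is never
  lacking.\<close>

lemma blocked_value:
  assumes gap: "\<And>e e'. \<lbrakk>e \<in> Q; e' \<in> Q; e \<noteq> e'; \<chi> e = \<chi> e'; \<chi> e \<notin> K\<rbrakk> \<Longrightarrow> 3 \<le> card Q"
    "\<And>e e'. \<lbrakk>e \<in> Q'; e' \<in> Q'; e \<noteq> e'; \<chi> e = \<chi> e'; \<chi> e \<notin> K\<rbrakk> \<Longrightarrow> 3 \<le> card Q'"
  shows "8 * (g\<^sub>0 - g) + 12 \<le> 6 * card (\<chi> ` arcs D)"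
proof -
  let ?t = "\<lambda>S. weight S + card (K \<inter> \<chi> ` S) + (if S \<in> one_label_cycles \<chi> \<S> then 1 else 0)"
  have "6 \<le> ?t S"
  proof -
    have "3 \<le> weight Q + card (K \<inter> (\<chi> ` Q - \<chi> ` Q'))"
      using sides_sub big QQ gap by (intro side_weight) auto
    moreover have "3 \<le> weight Q' + card (K \<inter> (\<chi> ` Q' - \<chi> ` Q))"
      using sides_sub big QQ gap by (intro side_weight) auto
    moreover have "weight S = weight Q + weight Q'"
      using weight_union[OF sides_sub(3,4) QQ(2)] QQ(1) by simp
    \<comment> \<open>Labels on both sides are left out, so no label in K is counted for
      both.\<close>
    moreover have "card (K \<inter> (\<chi> ` Q - \<chi> ` Q')) + card (K \<inter> (\<chi> ` Q' - \<chi> ` Q)) \<le> card (K \<inter> \<chi> ` S)"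
    proof -
      have "card (K \<inter> (\<chi> ` Q - \<chi> ` Q')) + card (K \<inter> (\<chi> ` Q' - \<chi> ` Q)) =
          card ((K \<inter> (\<chi> ` Q - \<chi> ` Q')) \<union> (K \<inter> (\<chi> ` Q' - \<chi> ` Q)))"
        using inv_finite(3) by (intro card_Un_disjoint[symmetric]) auto
      also have "\<dots> \<le> card (K \<inter> \<chi> ` S)"
        using inv_finite(3) QQ(1) by (intro card_mono) auto
      finally show ?thesis .
    qed
    ultimately show ?thesis by linarith
  qed
  moreover have "(\<Sum>T \<in> \<S> - {S}. 4) \<le> (\<Sum>T \<in> \<S> - {S}. ?t T)"
    by (rule sum_mono) (use cycle_weight in blast)
  moreover have "(\<Sum>T \<in> \<S>. ?t T) = ?t S + (\<Sum>T \<in> \<S> - {S}. ?t T)"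
    using inv_finite(2) S by (rule sum.remove)
  moreover have "(\<Sum>T \<in> \<S>. 4 :: nat) = 4 + (\<Sum>T \<in> \<S> - {S}. 4)"
    using inv_finite(2) S by (rule sum.remove)
  then have "(\<Sum>T \<in> \<S> - {S}. 4 :: nat) + 4 = 4 * card \<S>" by simp
  moreover have "(\<Sum>T \<in> \<S>. ?t T) = (\<Sum>T \<in> \<S>. weight T) + (\<Sum>T \<in> \<S>. card (K \<inter> \<chi> ` T)) + card (one_label_cycles \<chi> \<S>)"
  proof -
    have "(\<Sum>T \<in> \<S>. if T \<in> one_label_cycles \<chi> \<S> then 1 else 0) = card (\<S> \<inter> one_label_cycles \<chi> \<S>)"
      using inv_finite(2) by (simp add: sum.If_cases)
    moreover have "\<S> \<inter> one_label_cycles \<chi> \<S> = one_label_cycles \<chi> \<S>"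
      unfolding one_label_cycles_def by auto
    ultimately show ?thesis by (simp add: sum.distrib)
  qed
  ultimately have "4 * card \<S> + 2 \<le> 2 * card (\<chi> ` arcs D) + card K + card (one_label_cycles \<chi> \<S>)"
    using sum_weight sum_K by linarith
  then show ?thesis using inv_budget two_labels unfolding bonus_def by simp
qed

end

end

section \<open>Preservation of the invariant\<close>

text \<open>Nothing is said about the move itself: besides reflecting adjacency, G enters through
  its cycle partition and the adjacency of the new arcs, as assumed in the lemmas below.\<close>

locale inv_step =
  fixes g\<^sub>0 D \<chi> g \<S> K G f f' l
  assumes inv: "invariant g\<^sub>0 D \<chi> g \<S> K"
    and reflect: "adjacency_reflecting D G"
    and new: "f \<noteq> f'" "f \<notin> arcs D" "f' \<notin> arcs D" "l \<notin> \<chi> ` arcs D"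
begin

definition \<chi>' :: "nat \<Rightarrow> nat" where "\<chi>' = \<chi>(f := l, f' := l)"

lemmas facts = inv_part[OF inv] inv_proper[OF inv] inv_single[OF inv] inv_K[OF inv]
lemmas confined = inv_confined[OF inv]
lemmas nonadj = inv_nonadj[OF inv]
lemmas size = inv_size[OF inv]
lemmas budget = inv_budget[OF inv]
lemmas fin = inv_finite[OF inv]
lemmas ars = inv_arcs[OF inv]

lemma old_label: "e \<in> arcs D \<Longrightarrow> \<chi>' e = \<chi> e"
  using new unfolding \<chi>'_def by auto

lemma old_not_l: "e \<in> arcs D \<Longrightarrow> \<chi>' e \<noteq> l"
  using new(4) old_label by auto

lemma old_labels: "T \<subseteq> arcs D \<Longrightarrow> \<chi>' ` T = \<chi> ` T"
  by (intro image_cong refl old_label) (rule subsetD)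

lemma new_label [simp]: "\<chi>' f = l" "\<chi>' f' = l"
  unfolding \<chi>'_def by simp_all

lemma l_notin_K: "l \<notin> K"
  using facts(4) new(4) by blast

lemma f_notin: "S \<in> \<S> \<Longrightarrow> f \<notin> S" "S \<in> \<S> \<Longrightarrow> f' \<notin> S"
  using ars(2) new by blast+

lemma card_labels:
  assumes "\<chi>' ` arcs G = insert l (\<chi> ` arcs D)"
  shows "card (\<chi>' ` arcs G) = Suc (card (\<chi> ` arcs D))"
  unfolding assms using new(4) fin(1) by simp

text \<open>Labels outside both the old and the new K stay non-adjacent by reflection, so adjacency
  is left to check only for the new label and for labels that leave K.\<close>

lemma invI:
  assumes part: "cycle_partition G \<S>'" and arcs: "arcs G \<subseteq> insert f (insert f' (arcs D))"
    and labels: "\<chi>' ` arcs G = insert l (\<chi> ` arcs D)"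
    and single: "\<chi>' ` single_arcs G \<chi>' \<subseteq> K'" and K': "K' \<subseteq> insert l (\<chi> ` arcs D)"
    and conf: "\<And>S e e'. \<lbrakk>S \<in> \<S>'; e \<in> S; e' \<in> arcs G; \<chi>' e \<in> K'; \<chi>' e' = \<chi>' e\<rbrakk> \<Longrightarrow> e' \<in> S"
    and gap_new: "\<lbrakk>l \<notin> K'; f \<in> arcs G; f' \<in> arcs G\<rbrakk> \<Longrightarrow> head G f \<noteq> tail G f' \<and> head G f' \<noteq> tail G f"
    and gap_old: "\<And>e e'. \<lbrakk>e \<in> arcs D; e' \<in> arcs D; e \<in> arcs G; e' \<in> arcs G; e \<noteq> e'; \<chi> e = \<chi> e'; \<chi> e \<in> K; \<chi> e \<notin> K'\<rbrakk>
        \<Longrightarrow> head G e \<noteq> tail G e'"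
    and sz: "\<And>S. S \<in> \<S>' \<Longrightarrow> (\<exists>e \<in> S. \<chi>' e \<in> K') \<or> 4 \<le> card S"
    and g': "g' \<le> g\<^sub>0"
    and bud: "card K' + 8 * (g\<^sub>0 - g') + card (one_label_cycles \<chi>' \<S>') + bonus (Suc (card (\<chi> ` arcs D)))
       \<le> 4 * Suc (card (\<chi> ` arcs D)) + 4 * card \<S>'"
  shows "invariant g\<^sub>0 G \<chi>' g' \<S>' K'"
proof -
  note E = card_labels[OF labels]
  have "card {e \<in> arcs G. \<chi>' e = m} \<le> 2" for m
  proof (cases "m = l")
    case True
    then have "{e \<in> arcs G. \<chi>' e = m} \<subseteq> {f, f'}"
      using arcs old_not_l by auto
    then have "card {e \<in> arcs G. \<chi>' e = m} \<le> card {f, f'}" by (intro card_mono) auto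
    then show ?thesis using new(1) by simp
  next
    case False
    then have "{e \<in> arcs G. \<chi>' e = m} \<subseteq> {e \<in> arcs D. \<chi> e = m}" using arcs old_label by auto
    then have "card {e \<in> arcs G. \<chi>' e = m} \<le> card {e \<in> arcs D. \<chi> e = m}"
      using fin(1) by (intro card_mono) auto
    then show ?thesis using facts(2) unfolding proper_labelling_def by (meson le_trans)
  qed
  then have proper: "proper_labelling G \<chi>'" unfolding proper_labelling_def by blast
  have "head G e \<noteq> tail G e'"
    if e: "e \<in> arcs G" "e' \<in> arcs G" "e \<noteq> e'" "\<chi>' e = \<chi>' e'" "\<chi>' e \<notin> K'" for e e'
  proof (cases "\<chi>' e = l")
    case True
    then have "e \<in> {f, f'} \<and> e' \<in> {f, f'}"
      using e(1,2,4) arcs old_not_l by (metis insertE insertI1 insertI2 subsetD)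
    then show ?thesis using e gap_new True by auto
  next
    case False
    then have D: "e \<in> arcs D" "e' \<in> arcs D" using e arcs by auto
    then have \<chi>: "\<chi> e = \<chi> e'" "\<chi> e \<notin> K'" using e old_label by auto
    show ?thesis
    proof (cases "\<chi> e \<in> K")
      case True
      then show ?thesis using gap_old D e \<chi> by blast
    next
      case False
      then have "head D e \<noteq> tail D e'" using nonadj D e(3) \<chi>(1) by blast
      then show ?thesis using reflect D e unfolding adjacency_reflecting_def by blast
    qed
  qed
  then show "invariant g\<^sub>0 G \<chi>' g' \<S>' K'"
    unfolding invariant_def E using part proper single K' conf sz g' bud unfolding labels
    by (intro conjI ballI impI) blast+
qed

lemma one_label_mono:
  assumes "finite \<S>" "\<S>' = (\<S> - \<T>) \<union> \<N>" "\<And>N. N \<in> \<N> \<Longrightarrow> N \<notin> one_label_cycles \<chi>' \<N>"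
  shows "one_label_cycles \<chi>' \<S>' \<subseteq> one_label_cycles \<chi> \<S> - \<T>"
proof
  fix S assume "S \<in> one_label_cycles \<chi>' \<S>'"
  then obtain m where S: "S \<in> \<S>'" "\<chi>' ` S = {m}" unfolding one_label_cycles_def by auto
  then have "S \<notin> \<N>" using assms(3) unfolding one_label_cycles_def by blast
  then have "S \<in> \<S>" "S \<notin> \<T>" using S assms(2) by auto
  moreover have "\<chi> ` S = {m}" using S old_labels ars(2)[OF \<open>S \<in> \<S>\<close>] by simp
  ultimately show "S \<in> one_label_cycles \<chi> \<S> - \<T>" unfolding one_label_cycles_def by auto
qed

lemma one_label_finite: "finite (one_label_cycles \<chi> \<S>)"
  using fin(2) unfolding one_label_cycles_def by simp

text \<open>A label can become a once-used one only through deletion of its other arc; otherwise it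
  was used once before, hence in K already.\<close>

lemma single_transfer:
  assumes "e \<in> single_arcs G \<chi>'" "e \<in> arcs D" "\<And>e'. e' \<in> arcs D \<Longrightarrow> \<chi> e' = \<chi> e \<Longrightarrow> e' \<in> arcs G"
  shows "\<chi>' e \<in> K"
proof -
  have "e \<in> single_arcs D \<chi>"
    unfolding single_arcs_def using assms old_label unfolding single_arcs_def by auto
  then show ?thesis using facts(3) old_label assms(2) by auto
qed

text \<open>N is a loop for a dummy chosen twice, and a cycle of two arcs for two dummies. In the
  first case l is used once, in the second its arcs are adjacent; either way it belongs to
  K.\<close>

lemma new_cycle:
  assumes N: "N = {f} \<or> N = {f, f'}" and part: "cycle_partition G (\<S> \<union> {N})"
  shows "invariant g\<^sub>0 G \<chi>' g (\<S> \<union> {N}) (insert l K)" "card (\<chi>' ` arcs G) = Suc (card (\<chi> ` arcs D))"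
proof -
  have arcs: "arcs G = arcs D \<union> N"
    using part facts(1) unfolding cycle_partition_def by auto
  have NS: "N \<notin> \<S>" using N f_notin by auto
  have lab: "\<chi>' ` N = {l}" using N by auto
  have conf: "e' \<in> S" if "S \<in> \<S> \<union> {N}" "e \<in> S" "e' \<in> arcs G" "\<chi>' e \<in> insert l K" "\<chi>' e' = \<chi>' e" for S e e'
  proof (cases "S = N")
    case True
    then have "\<chi>' e' = l" using that lab by auto
    then show ?thesis using that(3) arcs True old_not_l by auto
  next
    case False
    then have S: "S \<in> \<S>" "e \<in> arcs D" using that ars(2) by auto
    then have "\<chi>' e \<noteq> l" using old_not_l by blast
    moreover from this have "e' \<in> arcs D" using that(3,5) arcs lab by (metis UnE image_eqI singletonD)
    ultimately show ?thesis using that confined[OF S(1)] S old_label by auto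
  qed
  have c: "card (insert l K) = Suc (card K)" "card (\<S> \<union> {N}) = Suc (card \<S>)"
    using fin NS l_notin_K by simp_all
  have "one_label_cycles \<chi>' (\<S> \<union> {N}) \<subseteq> insert N (one_label_cycles \<chi> \<S>)"
    using old_labels ars(2) unfolding one_label_cycles_def by auto
  then have "card (one_label_cycles \<chi>' (\<S> \<union> {N})) \<le> card (insert N (one_label_cycles \<chi> \<S>))"
    using one_label_finite by (intro card_mono) auto
  then have I: "card (one_label_cycles \<chi>' (\<S> \<union> {N})) \<le> Suc (card (one_label_cycles \<chi> \<S>))"
    using card_insert_le_m1 one_label_finite by (simp add: card_insert_if split: if_splits)
  \<comment> \<open>The rise by 6 occurs at the opening turn. With one new label in K and one new
    one-label cycle it uses up the entire gain 4 + 4.\<close>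
  have bn: "bonus (Suc n) \<le> 6 + bonus n" for n unfolding bonus_def by simp
  have single: "\<chi>' ` single_arcs G \<chi>' \<subseteq> insert l K"
  proof
    fix m assume "m \<in> \<chi>' ` single_arcs G \<chi>'"
    then obtain e where e: "e \<in> single_arcs G \<chi>'" "m = \<chi>' e" by auto
    then have "e \<in> arcs D \<union> N" using arcs unfolding single_arcs_def by auto
    then show "m \<in> insert l K" using single_transfer[OF e(1)] e(2) lab arcs by auto
  qed
  have labels: "\<chi>' ` arcs G = insert l (\<chi> ` arcs D)"
    unfolding arcs image_Un lab old_labels[OF order_refl] by simp
  show "card (\<chi>' ` arcs G) = Suc (card (\<chi> ` arcs D))" by (rule card_labels[OF labels])
  show "invariant g\<^sub>0 G \<chi>' g (\<S> \<union> {N}) (insert l K)"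
  proof (rule invI[OF part _ _ single _ conf])
    show "arcs G \<subseteq> insert f (insert f' (arcs D))" using arcs N by auto
    show "\<chi>' ` arcs G = insert l (\<chi> ` arcs D)" by (rule labels)
    show "insert l K \<subseteq> insert l (\<chi> ` arcs D)" using facts(4) by auto
    show "(\<exists>e \<in> S. \<chi>' e \<in> insert l K) \<or> 4 \<le> card S" if "S \<in> \<S> \<union> {N}" for S
    proof (cases "S = N")
      case True
      then show ?thesis using N by auto
    next
      case False
      then have "S \<in> \<S>" using that by auto
      then show ?thesis using size[of S] ars(2)[of S] old_label by (metis insertCI subsetD)
    qed
    show "g \<le> g\<^sub>0" using inv_counter[OF inv] .
    show "card (insert l K) + 8 * (g\<^sub>0 - g) + card (one_label_cycles \<chi>' (\<S> \<union> {N})) + bonus (Suc (card (\<chi> ` arcs D)))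
       \<le> 4 * Suc (card (\<chi> ` arcs D)) + 4 * card (\<S> \<union> {N})"
      unfolding c using I bn[of "card (\<chi> ` arcs D)"] budget by simp
  qed auto
qed

text \<open>One label means at most two arcs, so no cycle has four and the label is in K;
  confinement then leaves room for a single cycle.\<close>

lemma single_label_state:
  assumes "card (\<chi> ` arcs D) = 1" "S \<in> \<S>"
  shows "S \<in> one_label_cycles \<chi> \<S>" "K = \<chi> ` arcs D" "\<S> = {S}"
proof -
  obtain m where m: "\<chi> ` arcs D = {m}" using assms(1) card_1_singletonE by blast
  have K: "m \<in> K" "\<chi> ` T = {m}" if T: "T \<in> \<S>" for T
  proof -
    have T': "T \<subseteq> arcs D" "T \<noteq> {}" using ars(2,4)[OF T] by auto
    have "\<chi> ` T \<subseteq> {m}" using image_mono[OF T'(1), of \<chi>] unfolding m .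
    then show im: "\<chi> ` T = {m}" using T'(2) by (simp add: subset_singleton_iff)
    have all: "{e \<in> arcs D. \<chi> e = m} = arcs D" using m by auto
    have "card {e \<in> arcs D. \<chi> e = m} \<le> 2" using facts(2) unfolding proper_labelling_def by simp
    then have "card T \<le> 2" using card_mono[OF fin(1) T'(1)] unfolding all by linarith
    then show "m \<in> K" using size[OF T] im by auto
  qed
  show "S \<in> one_label_cycles \<chi> \<S>" using K(2)[OF assms(2)] assms(2) unfolding one_label_cycles_def by auto
  show "K = \<chi> ` arcs D" using K(1)[OF assms(2)] facts(4) m by auto
  have "T = S" if "T \<in> \<S>" for T
  proof (rule ccontr)
    assume "T \<noteq> S"
    obtain a b where ab: "a \<in> S" "b \<in> T" using ars(4)[OF assms(2)] ars(4)[OF \<open>T \<in> \<S>\<close>] by blast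
    then have "\<chi> a = m" "\<chi> b = m" "b \<in> arcs D" using K(2) assms(2) that ars(2) by blast+
    then have "b \<in> S" using confined[OF assms(2) ab(1)] K(1)[OF that] by simp
    then show False using ars(5)[OF that assms(2) \<open>T \<noteq> S\<close>] ab by blast
  qed
  then show "\<S> = {S}" using assms(2) by blast
qed

text \<open>The second part saves one unit at the step from one label to two, where the rise of the
  bonus by 4 alone consumes the gain and l still has to be paid for.\<close>

lemma one_label_drop:
  assumes S: "S \<in> \<S>" and \<S>': "\<S>' = (\<S> - {S}) \<union> \<N>" "\<And>N. N \<in> \<N> \<Longrightarrow> N \<notin> one_label_cycles \<chi>' \<N>"
  shows "card (one_label_cycles \<chi>' \<S>') \<le> card (one_label_cycles \<chi> \<S>)"
    "card (\<chi> ` arcs D) = 1 \<Longrightarrow> Suc (card (one_label_cycles \<chi>' \<S>')) \<le> card (one_label_cycles \<chi> \<S>)"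
proof -
  have sub: "one_label_cycles \<chi>' \<S>' \<subseteq> one_label_cycles \<chi> \<S> - {S}"
    using one_label_mono[OF fin(2) \<S>'] .
  have "card (one_label_cycles \<chi>' \<S>') \<le> card (one_label_cycles \<chi> \<S> - {S})"
    using sub one_label_finite by (intro card_mono) auto
  moreover have "card (one_label_cycles \<chi> \<S> - {S}) \<le> card (one_label_cycles \<chi> \<S>)"
    using one_label_finite by (intro card_mono) auto
  ultimately show "card (one_label_cycles \<chi>' \<S>') \<le> card (one_label_cycles \<chi> \<S>)" by linarith
  assume "card (\<chi> ` arcs D) = 1"
  then have S1: "S \<in> one_label_cycles \<chi> \<S>" using single_label_state(1) S by blast
  then have "card (one_label_cycles \<chi> \<S>) \<ge> 1" using one_label_finite by (metis One_nat_def Suc_leI card_gt_0_iff empty_iff)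
  then show "Suc (card (one_label_cycles \<chi>' \<S>')) \<le> card (one_label_cycles \<chi> \<S>)"
    using \<open>card (one_label_cycles \<chi>' \<S>') \<le> card (one_label_cycles \<chi> \<S> - {S})\<close> S1
    by (simp add: card_Diff_singleton)
qed

lemma some_label:
  assumes "S \<in> \<S>"
  shows "1 \<le> card (\<chi> ` arcs D)"
proof -
  have "arcs D \<noteq> {}" using ars(2,4)[OF assms] by auto
  then show ?thesis using fin(1) by (simp add: Suc_leI card_gt_0_iff)
qed

lemma bonus_step: "1 \<le> n \<Longrightarrow> bonus (Suc n) \<le> bonus n + (if n = 1 then 4 else 0)"
  unfolding bonus_def by simp

lemma card_replace:
  assumes "S \<in> \<S>" "N \<notin> \<S>"
  shows "card ((\<S> - {S}) \<union> {N}) = card \<S>"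
proof -
  have "card ((\<S> - {S}) \<union> {N}) = Suc (card (\<S> - {S}))" using assms fin(2) by simp
  also have "\<dots> = card \<S>" using card_Suc_Diff1[OF fin(2) assms(1)] .
  finally show ?thesis .
qed

text \<open>The answer to a vertex and a dummy: the cycle is lengthened by both new arcs, which meet
  at the dummy. So l joins K, confined to the lengthened cycle.\<close>

lemma spur:
  assumes S: "S \<in> \<S>" and part: "cycle_partition G ((\<S> - {S}) \<union> {insert f (insert f' S)})"
  shows "invariant g\<^sub>0 G \<chi>' g ((\<S> - {S}) \<union> {insert f (insert f' S)}) (insert l K)"
    "card (\<chi>' ` arcs G) = Suc (card (\<chi> ` arcs D))"
proof -
  let ?N = "insert f (insert f' S)"
  let ?S' = "(\<S> - {S}) \<union> {?N}"
  have arcs: "arcs G = arcs D \<union> {f, f'}"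
    using part facts(1) S unfolding cycle_partition_def by auto
  have NS: "?N \<notin> \<S>" using f_notin by auto
  have SD: "S \<subseteq> arcs D" using ars(2)[OF S] .
  have conf: "e' \<in> T" if "T \<in> ?S'" "e \<in> T" "e' \<in> arcs G" "\<chi>' e \<in> insert l K" "\<chi>' e' = \<chi>' e" for T e e'
  proof (cases "e \<in> {f, f'}")
    case True
    then have "\<chi>' e' = l" using that(5) by auto
    then have "e' \<in> {f, f'}" using that(3) arcs old_not_l by auto
    moreover have "T = ?N" using True that(1,2) f_notin by auto
    ultimately show ?thesis by auto
  next
    case False
    then have e: "e \<in> arcs D" using that(1,2) ars(2) SD by blast
    then have "\<chi>' e \<noteq> l" using old_not_l by blast
    then have "e' \<in> arcs D" using that(3,5) arcs by auto
    then have k: "\<chi> e \<in> K" "\<chi> e' = \<chi> e" using \<open>\<chi>' e \<noteq> l\<close> that(4,5) e old_label by auto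
    show ?thesis
    proof (cases "T = ?N")
      case True
      then have "e \<in> S" using False that(2) by auto
      then show ?thesis using confined[OF S _ \<open>e' \<in> arcs D\<close> k] True by auto
    next
      case F: False
      then have "T \<in> \<S>" using that(1) by auto
      then show ?thesis using confined[OF _ that(2) \<open>e' \<in> arcs D\<close> k] by auto
    qed
  qed
  have c: "card (insert l K) = Suc (card K)" "card ?S' = card \<S>"
    using fin l_notin_K card_replace[OF S NS] by simp_all
  have "?N \<notin> one_label_cycles \<chi>' {?N}"
  proof -
    obtain a where "a \<in> S" using ars(4)[OF S] by auto
    then have "\<chi>' a \<noteq> l" "\<chi>' a \<in> \<chi>' ` ?N" "l \<in> \<chi>' ` ?N" using SD old_not_l by auto
    then show ?thesis unfolding one_label_cycles_def by auto
  qed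
  then have I: "card (one_label_cycles \<chi>' ?S') \<le> card (one_label_cycles \<chi> \<S>)"
    "card (\<chi> ` arcs D) = 1 \<Longrightarrow> Suc (card (one_label_cycles \<chi>' ?S')) \<le> card (one_label_cycles \<chi> \<S>)"
    using one_label_drop[OF S refl, of "{?N}"] by simp_all
  have single: "\<chi>' ` single_arcs G \<chi>' \<subseteq> insert l K"
  proof
    fix m assume "m \<in> \<chi>' ` single_arcs G \<chi>'"
    then obtain e where e: "e \<in> single_arcs G \<chi>'" "m = \<chi>' e" by auto
    then have "e \<in> arcs D \<union> {f, f'}" using arcs unfolding single_arcs_def by auto
    then show "m \<in> insert l K" using single_transfer[OF e(1)] e(2) arcs by auto
  qed
  have labels: "\<chi>' ` arcs G = insert l (\<chi> ` arcs D)"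
    unfolding arcs image_Un old_labels[OF order_refl] by simp
  show "card (\<chi>' ` arcs G) = Suc (card (\<chi> ` arcs D))" by (rule card_labels[OF labels])
  show "invariant g\<^sub>0 G \<chi>' g ?S' (insert l K)"
  proof (rule invI[OF part _ _ single _ conf])
    show "arcs G \<subseteq> insert f (insert f' (arcs D))" using arcs by auto
    show "\<chi>' ` arcs G = insert l (\<chi> ` arcs D)" by (rule labels)
    show "insert l K \<subseteq> insert l (\<chi> ` arcs D)" using facts(4) by auto
    show "(\<exists>e \<in> T. \<chi>' e \<in> insert l K) \<or> 4 \<le> card T" if "T \<in> ?S'" for T
    proof (cases "T = ?N")
      case True
      then show ?thesis by auto
    next
      case False
      then have "T \<in> \<S>" using that by auto
      then show ?thesis using size[of T] ars(2)[of T] old_label by (metis insertCI subsetD)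
    qed
    show "g \<le> g\<^sub>0" using inv_counter[OF inv] .
    show "card (insert l K) + 8 * (g\<^sub>0 - g) + card (one_label_cycles \<chi>' ?S') + bonus (Suc (card (\<chi> ` arcs D)))
       \<le> 4 * Suc (card (\<chi> ` arcs D)) + 4 * card ?S'"
      unfolding c using I bonus_step[OF some_label[OF S]] budget by (simp split: if_splits)
  qed auto
qed

text \<open>The larger value and the lost cycle cancel in the budget, so K must not grow, and
  \<open>gap\<close> keeps l out of it. The bonus is constant too, because a single label does not
  allow two cycles.\<close>

lemma merge_cycles:
  assumes S: "S \<in> \<S>" "T \<in> \<S>" "S \<noteq> T"
    and part: "cycle_partition G ((\<S> - {S, T}) \<union> {insert f (insert f' (S \<union> T))})"
    and gap: "head G f \<noteq> tail G f'" "head G f' \<noteq> tail G f"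
  shows "invariant g\<^sub>0 G \<chi>' g ((\<S> - {S, T}) \<union> {insert f (insert f' (S \<union> T))}) K"
    "card (\<chi>' ` arcs G) = Suc (card (\<chi> ` arcs D))"
proof -
  let ?N = "insert f (insert f' (S \<union> T))"
  let ?S' = "(\<S> - {S, T}) \<union> {?N}"
  have arcs: "arcs G = arcs D \<union> {f, f'}"
    using part facts(1) S unfolding cycle_partition_def by auto
  have NS: "?N \<notin> \<S>" using f_notin by auto
  have SD: "S \<subseteq> arcs D" "T \<subseteq> arcs D" using ars(2) S by auto
  have conf: "e' \<in> U" if "U \<in> ?S'" "e \<in> U" "e' \<in> arcs G" "\<chi>' e \<in> K" "\<chi>' e' = \<chi>' e" for U e e'
  proof -
    have "\<chi>' e \<noteq> l" using that(4) l_notin_K by auto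
    then have e: "e \<in> arcs D" "e' \<in> arcs D" using that ars(2) SD arcs by auto
    then have k: "\<chi> e \<in> K" "\<chi> e' = \<chi> e" using that(4,5) old_label by auto
    show ?thesis
    proof (cases "U = ?N")
      case True
      then have "e \<in> S \<union> T" using that(2) e(1) new by auto
      then show ?thesis using confined[OF S(1) _ e(2) k] confined[OF S(2) _ e(2) k] True by auto
    next
      case F: False
      then have "U \<in> \<S>" using that(1) by auto
      then show ?thesis using confined[OF _ that(2) e(2) k] by auto
    qed
  qed
  have "card (\<S> - {S, T}) = card \<S> - card {S, T}"
    using S fin(2) by (simp add: card_Diff_subset)
  moreover have "card {S, T} \<le> card \<S>" using S fin(2) by (intro card_mono) auto
  ultimately have c: "Suc (card ?S') = card \<S>"
    using NS fin(2) S(3) by simp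
  have "?N \<notin> one_label_cycles \<chi>' {?N}"
  proof -
    obtain a where "a \<in> S" using ars(4)[OF S(1)] by auto
    then have "\<chi>' a \<noteq> l" "\<chi>' a \<in> \<chi>' ` ?N" "l \<in> \<chi>' ` ?N" using SD old_not_l by auto
    then show ?thesis unfolding one_label_cycles_def by auto
  qed
  then have "one_label_cycles \<chi>' ?S' \<subseteq> one_label_cycles \<chi> \<S> - {S, T}"
    using one_label_mono[OF fin(2), of ?S' "{S, T}" "{?N}"] by simp
  then have I: "card (one_label_cycles \<chi>' ?S') \<le> card (one_label_cycles \<chi> \<S>)"
    using one_label_finite by (intro card_mono) auto
  have E: "card (\<chi> ` arcs D) \<noteq> 1" using single_label_state(3)[OF _ S(1)] S by auto
  have single: "\<chi>' ` single_arcs G \<chi>' \<subseteq> K"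
  proof
    fix m assume "m \<in> \<chi>' ` single_arcs G \<chi>'"
    then obtain e where e: "e \<in> single_arcs G \<chi>'" "m = \<chi>' e" by auto
    moreover have "f \<in> arcs G" "f' \<in> arcs G" using arcs by auto
    ultimately have "e \<notin> {f, f'}" using new(1) unfolding single_arcs_def by force
    then have "e \<in> arcs D" using arcs e unfolding single_arcs_def by auto
    then show "m \<in> K" using single_transfer[OF e(1)] e(2) arcs by auto
  qed
  have labels: "\<chi>' ` arcs G = insert l (\<chi> ` arcs D)"
    unfolding arcs image_Un old_labels[OF order_refl] by simp
  show "card (\<chi>' ` arcs G) = Suc (card (\<chi> ` arcs D))" by (rule card_labels[OF labels])
  show "invariant g\<^sub>0 G \<chi>' g ?S' K"
  proof (rule invI[OF part _ _ single _ conf])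
    show "arcs G \<subseteq> insert f (insert f' (arcs D))" using arcs by auto
    show "\<chi>' ` arcs G = insert l (\<chi> ` arcs D)" by (rule labels)
    show "K \<subseteq> insert l (\<chi> ` arcs D)" using facts(4) by auto
    show "(\<exists>e \<in> U. \<chi>' e \<in> K) \<or> 4 \<le> card U" if "U \<in> ?S'" for U
    proof (cases "U = ?N")
      case True
      have "finite S" "finite T" "S \<noteq> {}" "T \<noteq> {}" "S \<inter> T = {}"
        using ars(3-5) S by auto
      \<comment> \<open>One arc from each old cycle and the two new ones make four.\<close>
      then have "card (S \<union> T) \<ge> 2"
        by (simp add: card_Un_disjoint) (metis One_nat_def Suc_leI add_mono card_gt_0_iff one_add_one)
      moreover have "card ?N = Suc (Suc (card (S \<union> T)))"
        using new f_notin S \<open>finite S\<close> \<open>finite T\<close> by simp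
      ultimately show ?thesis using True by simp
    next
      case False
      then have "U \<in> \<S>" using that by auto
      then show ?thesis using size[of U] ars(2)[of U] old_label by (metis subsetD)
    qed
    show "g \<le> g\<^sub>0" using inv_counter[OF inv] .
    show "card K + 8 * (g\<^sub>0 - g) + card (one_label_cycles \<chi>' ?S') + bonus (Suc (card (\<chi> ` arcs D)))
       \<le> 4 * Suc (card (\<chi> ` arcs D)) + 4 * card ?S'"
      using c I E bonus_step[OF some_label[OF S(1)]] budget by simp
  qed (use gap in auto)
qed

end

lemma card_le_two_third:
  assumes "card A \<le> 2" "finite A" "x \<in> A" "y \<in> A" "z \<in> A" "x \<noteq> y" "x \<noteq> z"
  shows "y = z"
proof (rule ccontr)
  assume "y \<noteq> z"
  then have "card {x, y, z} = 3" using assms by simp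
  moreover have "card {x, y, z} \<le> card A" using assms by (intro card_mono) auto
  ultimately show False using assms(1) by simp
qed

section \<open>Requests on a single cycle\<close>

context inv_step
begin

lemma third_arc:
  assumes "x \<in> arcs D" "y \<in> arcs D" "z \<in> arcs D" "\<chi> y = \<chi> x" "\<chi> z = \<chi> x" "x \<noteq> y" "x \<noteq> z"
  shows "y = z"
proof (rule card_le_two_third[of "{e \<in> arcs D. \<chi> e = \<chi> x}" x])
  show "card {e \<in> arcs D. \<chi> e = \<chi> x} \<le> 2" using facts(2) unfolding proper_labelling_def by simp
qed (use assms fin in auto)

text \<open>Applied to the state in which only this side is kept, even if Cutter rejects it: e and
  \<open>e'\<close> stay non-adjacent there, so the closed cycle has at least four arcs and Q at
  least three.\<close>

lemma gap_side:
  assumes "cycle_partition G \<S>'" "insert a Q \<in> \<S>'" "Q \<subseteq> arcs D"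
    and e: "e \<in> Q" "e' \<in> Q" "e \<noteq> e'" "\<chi> e = \<chi> e'" "\<chi> e \<notin> K"
  shows "3 \<le> card Q"
proof -
  have G: "insert a Q \<subseteq> arcs G" using assms(1,2) unfolding cycle_partition_def by auto
  have D: "e \<in> arcs D" "e' \<in> arcs D" using e assms(3) by auto
  have "head D e \<noteq> tail D e'" "head D e' \<noteq> tail D e"
    using nonadj[OF D e(3,4,5)] nonadj[OF D(2,1) e(3)[symmetric] e(4)[symmetric]] e(4,5) by simp_all
  then have "head G e \<noteq> tail G e'" "head G e' \<noteq> tail G e"
    using reflect D e G unfolding adjacency_reflecting_def by blast+
  then have "4 \<le> card (insert a Q)"
    using cycle_partition_nonadjacent[OF assms(1,2), of e e'] e by simp
  moreover have "finite Q" using assms(3) fin(1) finite_subset by blast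
  ultimately show ?thesis by (simp add: card_insert_if split: if_splits)
qed

text \<open>Each label of \<open>Q'\<close> survives on exactly one arc outside \<open>Q'\<close>
  and becomes a once-used label, as does l, whose other arc is dropped. So at most three labels
  enter K, against a gain of 4.\<close>

lemma delete_side:
  assumes S: "S \<in> \<S>" and QQ: "Q \<union> Q' = S" "Q \<inter> Q' = {}" and a: "a \<in> {f, f'}"
    and small: "card Q' \<le> 2" and np: "\<not> private_side D \<chi> Q'"
    and part: "cycle_partition G ((\<S> - {S}) \<union> {insert a Q})"
  shows "invariant g\<^sub>0 G \<chi>' g ((\<S> - {S}) \<union> {insert a Q}) (insert l (K \<union> \<chi> ` Q'))"
    "card (\<chi>' ` arcs G) = Suc (card (\<chi> ` arcs D))"
proof -
  let ?N = "insert a Q"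
  let ?S' = "(\<S> - {S}) \<union> {?N}"
  let ?K = "insert l (K \<union> \<chi> ` Q')"
  have SD: "S \<subseteq> arcs D" "Q \<subseteq> arcs D" "Q' \<subseteq> arcs D" using ars(2)[OF S] QQ by auto
  have al: "\<chi>' a = l" "a \<notin> arcs D" using a new by auto
  have twin: "\<exists>e' \<in> arcs D - Q'. \<chi> e' = \<chi> e" if "e \<in> Q'" for e
    using np that unfolding private_side_def by blast
  have arcs: "arcs G = insert a (arcs D - Q')"
  proof -
    have "arcs G = \<Union>(\<S> - {S}) \<union> insert a Q" using part unfolding cycle_partition_def by auto
    moreover have "\<Union>(\<S> - {S}) = arcs D - S"
    proof -
      have "T \<inter> S = {}" if "T \<in> \<S> - {S}" for T using that ars(5)[of T S] S by blast
      then show ?thesis unfolding ars(1) using S by blast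
    qed
    moreover have "(arcs D - S) \<union> Q = arcs D - Q'" using QQ SD by blast
    ultimately show ?thesis by auto
  qed
  have NS: "?N \<notin> \<S>" using f_notin a by auto
  \<comment> \<open>Otherwise S would have at most two arcs, hence a label in K, and confinement
    would make this label private to \<open>Q'\<close>.\<close>
  have Q: "Q \<noteq> {}"
  proof
    assume "Q = {}"
    then have "Q' = S" using QQ by simp
    then obtain e where e: "e \<in> S" "\<chi> e \<in> K" using size[OF S] small by auto
    then obtain e' where "e' \<in> arcs D - Q'" "\<chi> e' = \<chi> e" using twin \<open>Q' = S\<close> by blast
    then show False using confined[OF S e(1) _ e(2)] \<open>Q' = S\<close> by blast
  qed
  have labels: "\<chi>' ` arcs G = insert l (\<chi> ` arcs D)"
  proof -
    have "\<chi> ` (arcs D - Q') = \<chi> ` arcs D"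
    proof
      show "\<chi> ` arcs D \<subseteq> \<chi> ` (arcs D - Q')"
      proof
        fix m assume "m \<in> \<chi> ` arcs D"
        then obtain e where "e \<in> arcs D" "m = \<chi> e" by auto
        moreover have "\<exists>e' \<in> arcs D - Q'. \<chi> e' = \<chi> e"
          using twin[of e] \<open>e \<in> arcs D\<close> by (cases "e \<in> Q'") auto
        ultimately show "m \<in> \<chi> ` (arcs D - Q')" by (metis imageI)
      qed
    qed auto
    then show ?thesis unfolding arcs using old_labels[of "arcs D - Q'"] al(1) by simp
  qed
  have single: "\<chi>' ` single_arcs G \<chi>' \<subseteq> ?K"
  proof
    fix m assume "m \<in> \<chi>' ` single_arcs G \<chi>'"
    then obtain e where e: "e \<in> single_arcs G \<chi>'" "m = \<chi>' e" by auto
    then have "e \<in> insert a (arcs D - Q')" using arcs unfolding single_arcs_def by auto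
    then consider "e = a" | "e \<in> arcs D" by blast
    then show "m \<in> ?K"
    proof cases
      case 1
      then show ?thesis using e(2) al by simp
    next
      case 2
      show ?thesis
      proof (cases "\<chi> e \<in> \<chi> ` Q'")
        case True
        then show ?thesis using e(2) 2 old_label by simp
      next
        case False
        then have "e' \<in> arcs G" if "e' \<in> arcs D" "\<chi> e' = \<chi> e" for e'
          using that arcs by (metis DiffI image_eqI insertI2)
        then show ?thesis using single_transfer[OF e(1) 2] e(2) by blast
      qed
    qed
  qed
  have conf: "e' \<in> T" if T: "T \<in> ?S'" "e \<in> T" "e' \<in> arcs G" "\<chi>' e \<in> ?K" "\<chi>' e' = \<chi>' e" for T e e'
  proof -
    have eG: "e \<in> insert a (arcs D - Q')"
      using T(1,2) cycle_partition_arcs[OF part] arcs by blast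
    have e'G: "e' \<in> insert a (arcs D - Q')" using T(3) arcs by simp
    show ?thesis
    proof (cases "\<chi>' e = l")
      case True
      then have "e = a" "e' = a" using eG e'G T(5) old_not_l by auto
      then show ?thesis using T(2) by simp
    next
      case False
      then have D: "e \<in> arcs D - Q'" "e' \<in> arcs D - Q'" using eG e'G T(5) al(1) by auto
      then have eq: "\<chi> e' = \<chi> e" "\<chi>' e = \<chi> e" using T(5) old_label by auto
      show ?thesis
      proof (cases "\<chi> e \<in> \<chi> ` Q'")
        case True
        then obtain x where x: "x \<in> Q'" "\<chi> e = \<chi> x" by auto
        \<comment> \<open>One arc with this label was deleted, so by properness only one is
          left.\<close>
        then have "e = e'" using third_arc[of x e e'] D eq SD(3) by auto
        then show ?thesis using T(2) by simp
      next
        case False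
        then have k: "\<chi> e \<in> K" using T(4) eq \<open>\<chi>' e \<noteq> l\<close> by auto
        show ?thesis
        proof (cases "T = ?N")
          case True
          then have "e \<in> S" using T(2) D QQ al(2) by auto
          then have "e' \<in> S" using confined[OF S _ _ k eq(1)] D by blast
          then show ?thesis using True D QQ by blast
        next
          case False
          then have "T \<in> \<S>" using T(1) by blast
          then show ?thesis using confined[OF _ T(2) _ k eq(1)] D by blast
        qed
      qed
    qed
  qed
  have "?N \<notin> one_label_cycles \<chi>' {?N}"
  proof -
    obtain b where "b \<in> Q" using Q by auto
    then have "\<chi>' b \<noteq> l" "\<chi>' b \<in> \<chi>' ` ?N" using SD old_not_l by auto
    moreover have "l \<in> \<chi>' ` ?N" using al(1) by auto
    ultimately have "\<nexists>m. \<chi>' ` ?N = {m}" by (metis singletonD)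
    then show ?thesis unfolding one_label_cycles_def by simp
  qed
  then have I: "card (one_label_cycles \<chi>' ?S') \<le> card (one_label_cycles \<chi> \<S>)"
    "card (\<chi> ` arcs D) = 1 \<Longrightarrow> Suc (card (one_label_cycles \<chi>' ?S')) \<le> card (one_label_cycles \<chi> \<S>)"
    using one_label_drop[OF S refl, of "{?N}"] by simp_all
  have c: "card ?S' = card \<S>" using card_replace[OF S NS] .
  have finQ: "finite Q'" using SD(3) fin(1) finite_subset by blast
  have cK: "card ?K \<le> card K + 3"
  proof -
    have "card ?K \<le> Suc (card (K \<union> \<chi> ` Q'))" by (rule card_insert_le_m1) simp_all
    also have "\<dots> \<le> Suc (card K + card (\<chi> ` Q'))" using card_Un_le by simp
    also have "card (\<chi> ` Q') \<le> card Q'" using finQ by (rule card_image_le)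
    finally show ?thesis using small by simp
  qed
  \<comment> \<open>Here K contains the only old label already. The one-label cycle that disappears
    pays for l, and the gain of 4 for the bonus.\<close>
  have cK1: "card ?K \<le> card K + 1" if "card (\<chi> ` arcs D) = 1"
  proof -
    have "?K = insert l K" using single_label_state(2)[OF that S] SD(3) by auto
    then show ?thesis using fin(3) l_notin_K by simp
  qed
  show "card (\<chi>' ` arcs G) = Suc (card (\<chi> ` arcs D))" by (rule card_labels[OF labels])
  show "invariant g\<^sub>0 G \<chi>' g ?S' ?K"
  proof (rule invI[OF part _ labels single _ conf])
    show "arcs G \<subseteq> insert f (insert f' (arcs D))" using arcs a by auto
    show "?K \<subseteq> insert l (\<chi> ` arcs D)" using facts(4) SD(3) by auto
    show "(\<exists>e \<in> T. \<chi>' e \<in> ?K) \<or> 4 \<le> card T" if "T \<in> ?S'" for T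
    proof (cases "T = ?N")
      case True
      then show ?thesis using al(1) by auto
    next
      case False
      then have "T \<in> \<S>" using that by auto
      then show ?thesis using size[of T] ars(2)[of T] old_label by (metis UnI1 insertCI subsetD)
    qed
    show "g \<le> g\<^sub>0" using inv_counter[OF inv] .
    show "card ?K + 8 * (g\<^sub>0 - g) + card (one_label_cycles \<chi>' ?S') + bonus (Suc (card (\<chi> ` arcs D)))
       \<le> 4 * Suc (card (\<chi> ` arcs D)) + 4 * card ?S'"
      unfolding c using I bonus_step[OF some_label[OF S]] budget cK cK1 by (simp split: if_splits)
  qed auto
qed

text \<open>Labels found on both sides leave K, since their arcs now lie on different cycles; for
  the same reason they are not adjacent, and neither are the two new arcs. Each new cycle has four
  arcs or retains a private label in K.\<close>

lemma keep_both_sides: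
  assumes S: "S \<in> \<S>" and QQ: "Q \<union> Q' = S" "Q \<inter> Q' = {}"
    and big: "big_side D \<chi> Q" "big_side D \<chi> Q'"
    and gap: "\<And>e e'. \<lbrakk>e \<in> Q; e' \<in> Q; e \<noteq> e'; \<chi> e = \<chi> e'; \<chi> e \<notin> K\<rbrakk> \<Longrightarrow> 3 \<le> card Q"
    "\<And>e e'. \<lbrakk>e \<in> Q'; e' \<in> Q'; e \<noteq> e'; \<chi> e = \<chi> e'; \<chi> e \<notin> K\<rbrakk> \<Longrightarrow> 3 \<le> card Q'"
    and g: "1 \<le> g"
    and part: "cycle_partition G ((\<S> - {S}) \<union> {insert f Q, insert f' Q'})"
  shows "invariant g\<^sub>0 G \<chi>' (g - 1) ((\<S> - {S}) \<union> {insert f Q, insert f' Q'}) (K - (\<chi> ` Q \<inter> \<chi> ` Q'))"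
    "card (\<chi>' ` arcs G) = Suc (card (\<chi> ` arcs D))"
proof -
  let ?N1 = "insert f Q" and ?N2 = "insert f' Q'"
  let ?S' = "(\<S> - {S}) \<union> {?N1, ?N2}"
  let ?K = "K - (\<chi> ` Q \<inter> \<chi> ` Q')"
  have SD: "S \<subseteq> arcs D" "Q \<subseteq> arcs D" "Q' \<subseteq> arcs D" using ars(2)[OF S] QQ by auto
  have finQ: "finite Q" "finite Q'" using SD fin(1) finite_subset by blast+
  have Q: "Q \<noteq> {}" "Q' \<noteq> {}" using sides_nonempty[OF inv S QQ big] .
  have arcs: "arcs G = arcs D \<union> {f, f'}"
    using part facts(1) S QQ unfolding cycle_partition_def by auto
  have NS: "?N1 \<notin> \<S>" "?N2 \<notin> \<S>" "?N1 \<noteq> ?N2" using f_notin new(1,2) SD(3) by auto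
  have N: "?N1 \<in> ?S'" "?N2 \<in> ?S'" "?N1 \<inter> ?N2 = {}" using QQ(2) new SD by auto
  have labels: "\<chi>' ` arcs G = insert l (\<chi> ` arcs D)"
    unfolding arcs image_Un old_labels[OF order_refl] by simp
  have single: "\<chi>' ` single_arcs G \<chi>' \<subseteq> ?K"
  proof
    fix m assume "m \<in> \<chi>' ` single_arcs G \<chi>'"
    then obtain e where e: "e \<in> single_arcs G \<chi>'" "m = \<chi>' e" by auto
    moreover have "f \<in> arcs G" "f' \<in> arcs G" using arcs by auto
    ultimately have "e \<notin> {f, f'}" using new(1) unfolding single_arcs_def by force
    then have D: "e \<in> arcs D" using arcs e unfolding single_arcs_def by auto
    then have m: "m = \<chi> e" using e(2) old_label by simp
    have "m \<in> K" using single_transfer[OF e(1) D] e(2) arcs by auto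
    moreover have "\<not> (\<chi> e \<in> \<chi> ` Q \<and> \<chi> e \<in> \<chi> ` Q')"
    proof
      assume "\<chi> e \<in> \<chi> ` Q \<and> \<chi> e \<in> \<chi> ` Q'"
      then obtain x y where xy: "x \<in> Q" "\<chi> x = \<chi> e" "y \<in> Q'" "\<chi> y = \<chi> e" by auto
      then have "x \<in> arcs G" "y \<in> arcs G" using SD arcs by auto
      moreover have "\<chi>' x = \<chi>' e" "\<chi>' y = \<chi>' e"
        using xy SD D old_label[of x] old_label[of y] old_label[of e] by auto
      ultimately have "x = e" "y = e"
        using single_arcsD[OF e(1), of x] single_arcsD[OF e(1), of y] by simp_all
      then have "e \<in> Q \<inter> Q'" using xy(1,3) by simp
      then show False using QQ(2) by simp
    qed
    ultimately show "m \<in> ?K" using m by simp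
  qed
  have conf: "e' \<in> T" if T: "T \<in> ?S'" "e \<in> T" "e' \<in> arcs G" "\<chi>' e \<in> ?K" "\<chi>' e' = \<chi>' e" for T e e'
  proof -
    have "\<chi>' e \<noteq> l" using T(4) l_notin_K by auto
    moreover have eG: "e \<in> arcs G" using T(1,2) cycle_partition_arcs[OF part] by blast
    ultimately have "e \<notin> {f, f'}" "e' \<notin> {f, f'}" using T(5) by auto
    then have D: "e \<in> arcs D" "e' \<in> arcs D" using eG T(3) arcs by simp_all
    then have k: "\<chi> e \<in> K" "\<chi> e' = \<chi> e" "\<not> (\<chi> e \<in> \<chi> ` Q \<and> \<chi> e \<in> \<chi> ` Q')" using T(4,5) old_label by auto
    show ?thesis
    proof (cases "T \<in> \<S> - {S}")
      case True
      then show ?thesis using confined[OF _ T(2) D(2) k(1,2)] by blast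
    next
      case False
      then have "T = ?N1 \<or> T = ?N2" using T(1) by blast
      moreover from this have "e \<in> S" using T(2) D new QQ by auto
      then have "e' \<in> S" using confined[OF S _ D(2) k(1,2)] by blast
      moreover have "e \<in> Q \<and> e' \<in> Q' \<Longrightarrow> False" "e \<in> Q' \<and> e' \<in> Q \<Longrightarrow> False"
        using k(2,3) by (metis imageI)+
      ultimately show ?thesis using T(2) D new QQ(1) by auto
    qed
  qed
  \<comment> \<open>Adjacent arcs belong to the same cycle.\<close>
  have apart: "head G e \<noteq> tail G e'"
    if "e \<in> ?N1 \<and> e' \<in> ?N2 \<or> e \<in> ?N2 \<and> e' \<in> ?N1" for e e'
  proof
    assume *: "head G e = tail G e'"
    have G: "e \<in> arcs G" using that SD arcs by auto
    from that show False
    proof (elim disjE conjE)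
      assume "e \<in> ?N1" "e' \<in> ?N2"
      then have "e \<in> ?N2" using cycle_partition_head_unique[OF part N(2) G] * by blast
      then show False using \<open>e \<in> ?N1\<close> N(3) by blast
    next
      assume "e \<in> ?N2" "e' \<in> ?N1"
      then have "e \<in> ?N1" using cycle_partition_head_unique[OF part N(1) G] * by blast
      then show False using \<open>e \<in> ?N2\<close> N(3) by blast
    qed
  qed
  have one: "N \<notin> one_label_cycles \<chi>' {?N1, ?N2}" if N': "N \<in> {?N1, ?N2}" for N
  proof -
    obtain b where "b \<in> N" "b \<in> arcs D" using Q N' SD by auto
    then have "\<chi>' b \<noteq> l" "\<chi>' b \<in> \<chi>' ` N" using old_not_l by auto
    moreover have "l \<in> \<chi>' ` N" using N' by auto
    ultimately have "\<nexists>m. \<chi>' ` N = {m}" by (metis singletonD)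
    then show ?thesis unfolding one_label_cycles_def by simp
  qed
  then have I: "card (one_label_cycles \<chi>' ?S') \<le> card (one_label_cycles \<chi> \<S>)"
    using one_label_drop(1)[OF S refl, of "{?N1, ?N2}"] by blast
  have c: "card ?S' = Suc (card \<S>)"
  proof -
    have "card ?S' = Suc (Suc (card (\<S> - {S})))" using NS fin(2) by simp
    then show ?thesis using card_Suc_Diff1[OF fin(2) S] by simp
  qed
  have cK: "card ?K \<le> card K" using fin(3) by (intro card_mono) auto
  \<comment> \<open>Stated for either side P, with \<open>P'\<close> the other one. A short side has
    a private label, which lies in K as a once-used label or by \<open>gapP\<close>, and stays there
    because it is absent from \<open>P'\<close>.\<close>
  have side: "(\<exists>e \<in> insert a P. \<chi>' e \<in> ?K) \<or> 4 \<le> card (insert a P)"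
    if P: "P \<subseteq> arcs D" "big_side D \<chi> P" "P \<inter> P' = {}" "P' \<subseteq> arcs D" "\<chi> ` Q \<inter> \<chi> ` Q' \<subseteq> \<chi> ` P'" "a \<notin> arcs D"
    and gapP: "\<And>e e'. \<lbrakk>e \<in> P; e' \<in> P; e \<noteq> e'; \<chi> e = \<chi> e'; \<chi> e \<notin> K\<rbrakk> \<Longrightarrow> 3 \<le> card P" for P P' a
  proof (cases "3 \<le> card P")
    case True
    have "finite P" using P(1) fin(1) finite_subset by blast
    moreover have "a \<notin> P" using P(1,6) by blast
    ultimately show ?thesis using True by simp
  next
    case False
    then obtain e where e: "e \<in> P" "\<forall>e' \<in> arcs D. \<chi> e' = \<chi> e \<longrightarrow> e' \<in> P"
      using P(2) unfolding big_side_def private_side_def by blast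
    have "\<chi> e \<in> K"
    proof (rule ccontr)
      assume nK: "\<chi> e \<notin> K"
      then have "e \<notin> single_arcs D \<chi>" using facts(3) by blast
      then obtain e' where e': "e' \<in> arcs D" "\<chi> e' = \<chi> e" "e' \<noteq> e"
        using e(1) P(1) unfolding single_arcs_def by auto
      then have "e' \<in> P" using e(2) by blast
      from gapP[OF e(1) this e'(3)[symmetric] e'(2)[symmetric] nK] show False using False by blast
    qed
    moreover have "\<chi> e \<notin> \<chi> ` P'"
    proof
      assume "\<chi> e \<in> \<chi> ` P'"
      then obtain y where y: "y \<in> P'" "\<chi> y = \<chi> e" by auto
      have "y \<in> arcs D" using y(1) P(4) by blast
      then have "y \<in> P" using e(2) y(2) by blast
      then show False using P(3) y(1) by blast
    qed
    ultimately have "\<chi> e \<in> ?K" using P(5) by blast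
    moreover have "\<chi>' e = \<chi> e" using old_label e(1) P(1) by blast
    ultimately have "\<chi>' e \<in> ?K" by (simp only:)
    then show ?thesis using e(1) by blast
  qed
  show "card (\<chi>' ` arcs G) = Suc (card (\<chi> ` arcs D))" by (rule card_labels[OF labels])
  show "invariant g\<^sub>0 G \<chi>' (g - 1) ?S' ?K"
  proof (rule invI[OF part _ labels single _ conf])
    show "arcs G \<subseteq> insert f (insert f' (arcs D))" using arcs by auto
    show "?K \<subseteq> insert l (\<chi> ` arcs D)" using facts(4) by auto
    show "head G f \<noteq> tail G f' \<and> head G f' \<noteq> tail G f" using apart by blast
    show "head G e \<noteq> tail G e'"
      if e: "e \<in> arcs D" "e' \<in> arcs D" "e \<noteq> e'" "\<chi> e = \<chi> e'" "\<chi> e \<in> K" "\<chi> e \<notin> ?K" for e e'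
    proof -
      \<comment> \<open>A label leaving K has one arc on each side and by properness no third, so e
        and \<open>e'\<close> are on different new cycles.\<close>
      obtain x y where xy: "x \<in> Q" "\<chi> x = \<chi> e" "y \<in> Q'" "\<chi> y = \<chi> e" using e(5,6) by auto
      have xyD: "x \<in> arcs D" "y \<in> arcs D" "x \<noteq> y" using xy SD QQ(2) by auto
      have "e = x \<or> e = y" using third_arc[of e x y] xyD xy e by auto
      moreover have "e' = x \<or> e' = y" using third_arc[of e' x y] xyD xy e by auto
      ultimately show ?thesis using apart xy e(3) by blast
    qed
    show "(\<exists>e \<in> T. \<chi>' e \<in> ?K) \<or> 4 \<le> card T" if T: "T \<in> ?S'" for T
    proof -
      consider "T = ?N1" | "T = ?N2" | "T \<in> \<S>" "T \<noteq> S" using T by blast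
      then show ?thesis
      proof cases
        case 1
        show ?thesis unfolding 1
          by (rule side[OF SD(2) big(1) QQ(2) SD(3) Int_lower2 new(2)]) (rule gap(1))
      next
        case 2
        have "Q' \<inter> Q = {}" using QQ(2) by blast
        then show ?thesis unfolding 2
          by (rule side[OF SD(3) big(2) _ SD(2) Int_lower1 new(3)]) (rule gap(2))
      next
        case 3
        from size[OF 3(1)] show ?thesis
        proof
          assume "\<exists>e \<in> T. \<chi> e \<in> K"
          then obtain e where e: "e \<in> T" "\<chi> e \<in> K" by blast
          \<comment> \<open>A label in K on another cycle is confined to that cycle, so it is not
            among the labels removed from K.\<close>
          have "\<chi> e \<notin> \<chi> ` Q"
          proof
            assume "\<chi> e \<in> \<chi> ` Q"
            then obtain x where x: "x \<in> Q" "\<chi> x = \<chi> e" by auto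
            then have "x \<in> T" using confined[OF 3(1) e(1) _ e(2)] SD by blast
            then show False using x QQ(1) ars(5)[OF 3(1) S 3(2)] by blast
          qed
          then have "\<chi> e \<in> ?K" using e(2) by blast
          moreover have "\<chi>' e = \<chi> e" using e(1) old_label ars(2)[OF 3(1)] by blast
          ultimately have "\<chi>' e \<in> ?K" by (simp only:)
          then show ?thesis using e(1) by blast
        qed simp
      qed
    qed
    show "g - 1 \<le> g\<^sub>0" using inv_counter[OF inv] by simp
    show "card ?K + 8 * (g\<^sub>0 - (g - 1)) + card (one_label_cycles \<chi>' ?S') + bonus (Suc (card (\<chi> ` arcs D)))
       \<le> 4 * Suc (card (\<chi> ` arcs D)) + 4 * card ?S'"
    proof -
      \<comment> \<open>The 8 is paid for exactly by the new label and the additional cycle, 4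
        each.\<close>
      have "8 * (g\<^sub>0 - (g - 1)) = 8 * (g\<^sub>0 - g) + 8" using g inv_counter[OF inv] by simp
      moreover have "bonus (Suc (card (\<chi> ` arcs D))) = bonus (card (\<chi> ` arcs D))"
        using two_labels[OF inv S QQ big] unfolding bonus_def by simp
      ultimately show ?thesis unfolding c using I cK budget by simp
    qed
  qed auto
qed

end

section \<open>Cutter's answer and the strategy\<close>

lemma contraction_arcs:
  assumes "contraction\<^sup>*\<^sup>* G G'"
  shows "arcs G' \<subseteq> arcs G"
  using assms
proof (induction rule: rtranclp_induct)
  case (step G1 G2)
  then show ?case
    unfolding contraction_def contract_arc_def delete_isolated_def Let_def by auto
qed simp

text \<open>Contractions only delete arcs, a reduction keeps the labels of the remaining ones, and
  equivalence relabels bijectively.\<close>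

lemma reduction_value:
  assumes "reduction_of \<delta> \<gamma>" "equivalent \<gamma>' \<delta>" "finite (arcs (graph \<gamma>))"
  shows "state_value \<gamma>' \<le> state_value \<gamma>"
proof -
  obtain \<rho> where "bij_betw \<rho> (labels \<gamma>') (labels \<delta>)"
    using assms(2) unfolding equivalent_def by blast
  then have eq: "state_value \<gamma>' = state_value \<delta>"
    unfolding state_value_def by (rule bij_betw_same_card)
  have "arcs (graph \<delta>) \<subseteq> arcs (graph \<gamma>)"
    using assms(1) contraction_arcs unfolding reduction_of_def by blast
  then have "labels \<delta> \<subseteq> labels \<gamma>"
    using assms(1) unfolding reduction_of_def labels_def by auto
  then show ?thesis
    unfolding eq unfolding state_value_def using assms(3) by (intro card_mono) (simp_all add: labels_def)
qed

definition good_state :: "nat \<Rightarrow> gstate \<Rightarrow> bool" where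
  "good_state g\<^sub>0 \<gamma> \<longleftrightarrow> (\<exists>\<S> K. invariant g\<^sub>0 (graph \<gamma>) (labelling \<gamma>) (counter \<gamma>) \<S> K)"

definition good_move :: "nat \<Rightarrow> gstate list \<Rightarrow> nat \<times> nat \<Rightarrow> gstate \<Rightarrow> bool" where
  "good_move g\<^sub>0 hist vw \<gamma>' \<longleftrightarrow> full_move hist vw \<gamma>' \<and> good_state g\<^sub>0 \<gamma>' \<and>
     state_value \<gamma>' = Suc (state_value (last hist))"

lemma good_state_initial: "good_state g (initial_state g)"
proof -
  have "single_arcs (graph (initial_state g)) (\<lambda>_. 0) = {}"
    unfolding single_arcs_def initial_state_def by simp
  then have "invariant g (graph (initial_state g)) (\<lambda>_. 0) g {} {}"
    unfolding invariant_def cycle_partition_def proper_labelling_def one_label_cycles_def bonus_def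
    by (simp add: initial_state_def)
  then show ?thesis unfolding good_state_def by (auto simp: initial_state_def)
qed

lemma good_state_game_state: "good_state g\<^sub>0 \<gamma> \<Longrightarrow> game_state \<gamma>"
  unfolding good_state_def game_state_def
  using inv_part inv_proper cycle_partition_boundary_cycles by blast

lemma good_state_finite: "good_state g\<^sub>0 \<gamma> \<Longrightarrow> finite (arcs (graph \<gamma>))"
  unfolding good_state_def using inv_finite(1) by blast

lemma not_big_side:
  assumes "\<not> big_side D \<chi> Q"
  shows "card Q \<le> 2" "\<not> private_side D \<chi> Q"
  using assms unfolding big_side_def by auto

lemma good_move_exists:
  assumes last: "last hist = \<lparr>graph = D, labelling = \<chi>, counter = g\<rparr>"
    and inv: "invariant g\<^sub>0 D \<chi> g \<S> K" and nn: "new_names hist f f' l" and hist: "hist \<noteq> []"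
    and low: "3 * card (\<chi> ` arcs D) < 4 * g\<^sub>0 + 6"
  shows "\<exists>\<gamma>'. good_move g\<^sub>0 hist (v, w) \<gamma>'"
proof -
  note part = inv_part[OF inv]
  let ?\<chi> = "\<chi>(f := l, f' := l)"
  have new: "f \<noteq> f'" "f \<notin> arcs D" "f' \<notin> arcs D" "l \<notin> \<chi> ` arcs D"
    using nn hist last_in_set[OF hist] unfolding new_names_def labels_def last by fastforce+
  have step: "inv_step g\<^sub>0 D \<chi> g \<S> K G f f' l" if "full_move_to hist (v, w) ?\<chi> g' \<S>' G" for G g' \<S>'
    using that inv new unfolding full_move_to_def last by unfold_locales simp_all
  have finish: "\<exists>\<gamma>'. good_move g\<^sub>0 hist (v, w) \<gamma>'"
    if "full_move_to hist (v, w) ?\<chi> g' \<S>' G" "invariant g\<^sub>0 G ?\<chi> g' \<S>' K'"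
      "card (?\<chi> ` arcs G) = Suc (card (\<chi> ` arcs D))" for G g' \<S>' K'
    using that unfolding good_move_def good_state_def full_move_to_def state_value_def labels_def last
    by (intro exI[of _ "\<lparr>graph = G, labelling = ?\<chi>, counter = g'\<rparr>"]) auto
  have cycle_of: "\<exists>S \<in> \<S>. u \<in> tail D ` S" if "u \<in> verts D" for u
    using that part unfolding cycle_partition_def by auto
  have merged: ?thesis if vw: "v \<noteq> w" "\<And>S. S \<in> \<S> \<Longrightarrow> v \<in> tail D ` S \<Longrightarrow> w \<in> tail D ` S \<Longrightarrow> False"
  proof -
    obtain A where A: "v \<notin> verts D \<and> A = {} \<or> (\<exists>S \<in> \<S>. v \<in> tail D ` S \<and> A = {S})"
      using cycle_of[of v] by (cases "v \<in> verts D") auto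
    obtain B where B: "w \<notin> verts D \<and> B = {} \<or> (\<exists>S \<in> \<S>. w \<in> tail D ` S \<and> B = {S})"
      using cycle_of[of w] by (cases "w \<in> verts D") auto
    have AB: "A \<inter> B = {}" using A B vw(2) by auto
    obtain G where G: "full_move_to hist (v, w) ?\<chi> g ((\<S> - (A \<union> B)) \<union> {insert f (insert f' (\<Union>(A \<union> B)))}) G"
      "A \<noteq> {} \<Longrightarrow> B \<noteq> {} \<Longrightarrow> head G f \<noteq> tail G f' \<and> head G f' \<noteq> tail G f"
      using merge_request[OF last part nn vw(1) A B AB] by metis
    interpret s: inv_step g\<^sub>0 D \<chi> g \<S> K G f f' l by (rule step[OF G(1)])
    have partG: "cycle_partition G ((\<S> - (A \<union> B)) \<union> {insert f (insert f' (\<Union>(A \<union> B)))})"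
      using G(1) unfolding full_move_to_def by blast
    \<comment> \<open>The cases are two dummies, one dummy, and vertices on two different
      cycles.\<close>
    consider "A = {}" "B = {}" | S where "S \<in> \<S>" "A \<union> B = {S}"
      | S T where "S \<in> \<S>" "T \<in> \<S>" "A = {S}" "B = {T}" "S \<noteq> T"
      using A B AB by auto
    then show ?thesis
    proof cases
      case 1
      then show ?thesis
        using finish[OF G(1)] s.new_cycle[of "{f, f'}"] partG unfolding s.\<chi>'_def by auto
    next
      case (2 S)
      then show ?thesis
        using finish[OF G(1)] s.spur[OF 2(1)] partG unfolding s.\<chi>'_def by auto
    next
      case (3 S T)
      have eq: "A \<union> B = {S, T}" "\<Union>(A \<union> B) = S \<union> T" using 3 by auto
      then show ?thesis
        using finish[OF G(1)] s.merge_cycles[OF 3(1,2,5)] partG G(2) 3(3,4) unfolding s.\<chi>'_def eq by auto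
    qed
  qed
  have same: ?thesis if S: "S \<in> \<S>" "v \<in> tail D ` S" "w \<in> tail D ` S" for S
  proof -
    obtain Q Q' where QQ: "Q \<union> Q' = S" "Q \<inter> Q' = {}" and
      G1: "\<exists>G. full_move_to hist (v, w) ?\<chi> g ((\<S> - {S}) \<union> {insert f Q}) G" and
      G2: "\<exists>G. full_move_to hist (v, w) ?\<chi> g ((\<S> - {S}) \<union> {insert f' Q'}) G" and
      G3: "g \<ge> 1 \<Longrightarrow> \<exists>G. full_move_to hist (v, w) ?\<chi> (g - 1) ((\<S> - {S}) \<union> {insert f Q, insert f' Q'}) G"
      using same_cycle_request[OF last part nn S] by blast
    obtain G1 where G1: "full_move_to hist (v, w) ?\<chi> g ((\<S> - {S}) \<union> {insert f Q}) G1" using G1 by blast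
    obtain G2 where G2: "full_move_to hist (v, w) ?\<chi> g ((\<S> - {S}) \<union> {insert f' Q'}) G2" using G2 by blast
    interpret s1: inv_step g\<^sub>0 D \<chi> g \<S> K G1 f f' l by (rule step[OF G1])
    interpret s2: inv_step g\<^sub>0 D \<chi> g \<S> K G2 f f' l by (rule step[OF G2])
    have part1: "cycle_partition G1 ((\<S> - {S}) \<union> {insert f Q})" using G1 unfolding full_move_to_def by blast
    have part2: "cycle_partition G2 ((\<S> - {S}) \<union> {insert f' Q'})" using G2 unfolding full_move_to_def by blast
    have SD: "Q \<subseteq> arcs D" "Q' \<subseteq> arcs D" using s1.ars(2)[OF S(1)] QQ(1) by auto
    show ?thesis
    proof (cases "big_side D \<chi> Q'")
      case False
      note d = s1.delete_side[OF S(1) QQ _ not_big_side[OF False] part1]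
      show ?thesis using finish[OF G1] d unfolding s1.\<chi>'_def by blast
    next
      case big': True
      show ?thesis
      proof (cases "big_side D \<chi> Q")
        case False
        have "Q' \<union> Q = S" "Q' \<inter> Q = {}" using QQ by auto
        note d = s2.delete_side[OF S(1) this _ not_big_side[OF False] part2]
        show ?thesis using finish[OF G2] d unfolding s2.\<chi>'_def by blast
      next
        case big: True
        \<comment> \<open>The graphs \<open>G1\<close> and \<open>G2\<close>, rejected as answers
          here, still serve to bound the lengths of the sides.\<close>
        have gap1: "3 \<le> card Q" if "e \<in> Q" "e' \<in> Q" "e \<noteq> e'" "\<chi> e = \<chi> e'" "\<chi> e \<notin> K" for e e'
          using s1.gap_side[OF part1 _ SD(1) that] by blast
        have gap2: "3 \<le> card Q'" if "e \<in> Q'" "e' \<in> Q'" "e \<noteq> e'" "\<chi> e = \<chi> e'" "\<chi> e \<notin> K" for e e'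
          using s2.gap_side[OF part2 _ SD(2) that] by blast
        have "8 * (g\<^sub>0 - g) + 12 \<le> 6 * card (\<chi> ` arcs D)"
          by (rule blocked_value[OF inv S(1) QQ big big' gap1 gap2])
        then have g: "1 \<le> g" using low by (cases g) auto
        then obtain G3 where G3: "full_move_to hist (v, w) ?\<chi> (g - 1) ((\<S> - {S}) \<union> {insert f Q, insert f' Q'}) G3"
          using G3 by blast
        interpret s3: inv_step g\<^sub>0 D \<chi> g \<S> K G3 f f' l by (rule step[OF G3])
        have part3: "cycle_partition G3 ((\<S> - {S}) \<union> {insert f Q, insert f' Q'})"
          using G3 unfolding full_move_to_def by blast
        note d = s3.keep_both_sides[OF S(1) QQ big big' gap1 gap2 g part3]
        show ?thesis by (rule finish[OF G3 d[unfolded s3.\<chi>'_def]])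
      qed
    qed
  qed
  show ?thesis
  proof (cases "\<exists>S \<in> \<S>. v \<in> tail D ` S \<and> w \<in> tail D ` S")
    case True
    then show ?thesis using same by blast
  next
    case False
    show ?thesis
    proof (cases "v = w")
      case vw: True
      then have v: "v \<notin> verts D" using False cycle_of[of v] by blast
      obtain G where G: "full_move_to hist (v, w) ?\<chi> g (\<S> \<union> {{f}}) G"
        using single_dummy_request[OF last part nn v] vw by blast
      interpret s: inv_step g\<^sub>0 D \<chi> g \<S> K G f f' l by (rule step[OF G])
      have partG: "cycle_partition G (\<S> \<union> {{f}})" using G unfolding full_move_to_def by blast
      show ?thesis
        by (rule finish[OF G s.new_cycle[OF disjI1[OF refl] partG, unfolded s.\<chi>'_def]])
    next
      case vw: False
      show ?thesis by (rule merged[OF vw]) (use False in blast)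
    qed
  qed
qed

text \<open>No earlier value exceeds the current one, so a state of larger value is not equivalent
  to a reduction of any earlier state.\<close>

lemma good_move_restricted:
  assumes "good_move g\<^sub>0 hist vw \<gamma>'"
    "\<forall>\<gamma> \<in> set hist. finite (arcs (graph \<gamma>)) \<and> state_value \<gamma> \<le> state_value (last hist)"
  shows "restricted_move hist vw \<gamma>'"
proof -
  have "\<not> (reduction_of \<delta> \<gamma> \<and> equivalent \<gamma>' \<delta>)" if "\<gamma> \<in> set hist" for \<gamma> \<delta>
    using assms reduction_value[of \<delta> \<gamma> \<gamma>'] that unfolding good_move_def by fastforce
  then show ?thesis
    using assms(1) unfolding restricted_move_def good_move_def full_move_def by blast
qed

text \<open>The fallback keeps the strategy legal after arbitrary histories, including those it
  never produces and those beyond the target value.\<close>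

definition cutter_strategy :: "nat \<Rightarrow> strategy" where
  "cutter_strategy g\<^sub>0 hist vw =
     (if \<exists>\<gamma>'. good_move g\<^sub>0 hist vw \<gamma>' \<and> restricted_move hist vw \<gamma>'
      then SOME \<gamma>'. good_move g\<^sub>0 hist vw \<gamma>' \<and> restricted_move hist vw \<gamma>'
      else SOME \<gamma>'. restricted_move hist vw \<gamma>')"

lemma cutter_strategy_restricted: "restricted_strategy (cutter_strategy g\<^sub>0)"
  unfolding restricted_strategy_def
proof (intro allI impI)
  fix hist vw
  assume ex: "\<exists>\<gamma>'. restricted_move hist vw \<gamma>'"
  show "restricted_move hist vw (cutter_strategy g\<^sub>0 hist vw)"
  proof (cases "\<exists>\<gamma>'. good_move g\<^sub>0 hist vw \<gamma>' \<and> restricted_move hist vw \<gamma>'")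
    case True
    then show ?thesis unfolding cutter_strategy_def using someI_ex[OF True] by simp
  next
    case False
    then show ?thesis unfolding cutter_strategy_def if_not_P[OF False] by (intro someI_ex[OF ex])
  qed
qed

lemma cutter_strategy_good:
  assumes "good_move g\<^sub>0 hist vw \<gamma>'" "restricted_move hist vw \<gamma>'"
  shows "good_move g\<^sub>0 hist vw (cutter_strategy g\<^sub>0 hist vw) \<and>
    restricted_move hist vw (cutter_strategy g\<^sub>0 hist vw)"
proof -
  have ex: "\<exists>\<gamma>'. good_move g\<^sub>0 hist vw \<gamma>' \<and> restricted_move hist vw \<gamma>'" using assms by blast
  then show ?thesis unfolding cutter_strategy_def using someI_ex[OF ex] by simp
qed

text \<open>Finiteness of all states so far is recorded for the choice of a fresh label and for
  comparing values.\<close>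

definition good_play :: "nat \<Rightarrow> gstate list \<Rightarrow> bool" where
  "good_play g\<^sub>0 hist \<longleftrightarrow> hist \<noteq> [] \<and> good_state g\<^sub>0 (last hist) \<and>
     (\<forall>\<gamma> \<in> set hist. finite (arcs (graph \<gamma>)) \<and> state_value \<gamma> \<le> state_value (last hist))"

lemma cutter_strategy_step:
  fixes vw :: "nat \<times> nat"
  assumes "good_play g\<^sub>0 hist" "3 * state_value (last hist) < 4 * g\<^sub>0 + 6"
  defines "\<gamma>' \<equiv> cutter_strategy g\<^sub>0 hist vw"
  shows "restricted_move hist vw \<gamma>'" "good_play g\<^sub>0 (hist @ [\<gamma>'])"
    "state_value \<gamma>' = Suc (state_value (last hist))"
proof -
  obtain D \<chi> g where last: "last hist = \<lparr>graph = D, labelling = \<chi>, counter = g\<rparr>"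
    by (cases "last hist") auto
  obtain v w where vw: "vw = (v, w)" by (cases vw)
  have play: "hist \<noteq> []" "good_state g\<^sub>0 (last hist)"
    "\<forall>\<gamma> \<in> set hist. finite (arcs (graph \<gamma>)) \<and> state_value \<gamma> \<le> state_value (last hist)"
    using assms(1) unfolding good_play_def by blast+
  obtain \<S> K where inv: "invariant g\<^sub>0 D \<chi> g \<S> K"
    using play(2) unfolding good_state_def last by auto
  have "\<forall>\<delta> \<in> set hist. finite (labels \<delta>)" using play(3) unfolding labels_def by simp
  moreover have "finite (arcs (graph (last hist)))" using play(1,3) last_in_set by blast
  ultimately obtain f f' l where nn: "new_names hist f f' l" using new_names_exist by metis
  have "3 * card (\<chi> ` arcs D) < 4 * g\<^sub>0 + 6"
    using assms(2) unfolding last state_value_def labels_def by simp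
  from good_move_exists[OF last inv nn play(1) this, of v w]
  obtain \<delta> where "good_move g\<^sub>0 hist vw \<delta>" unfolding vw by blast
  then have "good_move g\<^sub>0 hist vw \<gamma>' \<and> restricted_move hist vw \<gamma>'"
    unfolding \<gamma>'_def using good_move_restricted[OF _ play(3)] cutter_strategy_good by blast
  then show "restricted_move hist vw \<gamma>'" and v: "state_value \<gamma>' = Suc (state_value (last hist))"
    and "good_play g\<^sub>0 (hist @ [\<gamma>'])"
    unfolding good_move_def good_play_def using play good_state_finite by fastforce+
qed

theorem theorem5p5:
  fixes g\<^sub>0 :: nat
  assumes "g\<^sub>0 \<ge> 1"
  shows "\<exists>\<sigma>. restricted_strategy \<sigma> \<and> ensures_value g\<^sub>0 \<sigma> (4 / 3 * real g\<^sub>0 + 2)"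
proof (intro exI conjI)
  let ?\<sigma> = "cutter_strategy g\<^sub>0"
  show "restricted_strategy ?\<sigma>" by (rule cutter_strategy_restricted)
  show "ensures_value g\<^sub>0 ?\<sigma> (4 / 3 * real g\<^sub>0 + 2)"
    unfolding ensures_value_def
  proof
    fix m
    let ?P = "play g\<^sub>0 ?\<sigma> m"
    \<comment> \<open>Each good turn adds one label, so n turns give value n. Minimality of n keeps
      all earlier values below the target, as \<open>cutter_strategy_step\<close> requires.\<close>
    define n where "n = (LEAST n. 4 * g\<^sub>0 + 6 \<le> 3 * n)"
    have n: "4 * g\<^sub>0 + 6 \<le> 3 * n" unfolding n_def by (rule LeastI[of _ "4 * g\<^sub>0 + 6"]) simp
    have less: "3 * k < 4 * g\<^sub>0 + 6" if "k < n" for k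
      using not_less_Least[OF that[unfolded n_def]] by simp
    have play: "good_play g\<^sub>0 (?P k) \<and> state_value (last (?P k)) = k" if "k \<le> n" for k
      using that
    proof (induction k)
      case 0
      have "state_value (initial_state g\<^sub>0) = 0"
        unfolding state_value_def labels_def initial_state_def by simp
      then show ?case
        using good_state_initial good_state_finite unfolding good_play_def by auto
    next
      case (Suc k)
      then have *: "good_play g\<^sub>0 (?P k)" "state_value (last (?P k)) = k" by simp_all
      then show ?case
        using cutter_strategy_step[OF *(1), of "m k"] less[of k] Suc.prems by simp
    qed
    have "restricted_move (?P k) (m k) (?\<sigma> (?P k) (m k))" if "k < n" for k
      using cutter_strategy_step(1)[of g\<^sub>0 "?P k"] play[of k] less[OF that] that by simp
    moreover have "game_state (last (?P n))"
      using play[of n] good_state_game_state unfolding good_play_def by blast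
    moreover have "4 / 3 * real g\<^sub>0 + 2 \<le> real (state_value (last (?P n)))"
      using play[of n] n by simp
    ultimately show "\<exists>n. (\<forall>k < n. restricted_move (?P k) (m k) (?\<sigma> (?P k) (m k))) \<and>
        game_state (last (?P n)) \<and> 4 / 3 * real g\<^sub>0 + 2 \<le> real (state_value (last (?P n)))"
      by blast
  qed
qed

end
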